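(* Let $q>0$, $\eta>0$, $C\in\mathbb{R}$. Let $f:\mathbb{R}\to\mathbb{R}$ be convex, with $|f(x)|\le k_1+k_2|x|^{N}$ for all $x\in\mathbb{R}$ for some $k_1,k_2>0$, $N\in\mathbb{N}$, and $f'_+(-\infty)<-Cq<f'_+(\infty)$. Let $X$ be a one-dimensional Lévy process with Lévy measure $\Pi$ that is not a driftless compound Poisson process and satisfies $\int_{\mathbb{R}\setminus(-1,1)}e^{\bar\theta|z|}\,\Pi(\mathrm{d}z)<\infty$ for some $\bar\theta>0$. Define $$\rho(b):=\mathbb{E}_b\Big[\int_0^\infty e^{-qt}f'_+(U^b_t)\,\mathrm{d}t\Big],\qquad b^*:=\inf\{b\in\mathbb{R}:\rho(b)+C\ge 0\}.$$ Then the periodic barrier strategy $\pi^{b^*}$ is an optimal strategy for the problem of minimizing $v_\pi(x)$ over $\pi\in\mathcal{A}$, and thus $v(x)=v_{b^*}(x)$ for all $x\in\mathbb{R}$.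
   Context: Conventions: $\mathbb{N}=\{1,2,\dots\}$; $y^+=\max(y,0)$; $f'_+$ is the right-hand derivative, $f'_+(\pm\infty):=\lim_{x\to\pm\infty}f'_+(x)\in[-\infty,\infty]$; $\inf\varnothing=\infty$. The identically constant process counts as a driftless compound Poisson process. Process and control opportunities. $X=(X_t)_{t\ge0}$ is a one-dimensional Lévy process; $\mathbb{P}_x$, $\mathbb{E}_x$ denote law and expectation when $X_0=x$. $N^\eta$ is a Poisson process with intensity $\eta$, independent of $X$, with arrival times $T(1)<T(2)<\cdots$ (so $T(k)-T(k-1)$, $k\ge1$, with $T(0)=0$, are i.i.d. exponential with rate $\eta$); $\mathcal{T}_\eta=\{T(k):k\in\mathbb{N}\}$. $\mathbb{F}$ is the natural filtration generated by $(X,N^\eta)$. Strategies. A strategy is a process $\pi=(R^\pi_t)_{t\ge0}$ of the form $R^\pi_t=\int_{[0,t]}\nu^\pi_s\,\mathrm{d}N^\eta_s=\sum_{k:\,T(k)\le t}\nu^\pi_{T(k)}$, where $\nu^\pi$ is a càglàd (left-continuous with right limits), non-negative, $\mathbb{F}$-adapted process. The controlled process is $U^\pi_t=X_t+R^\pi_t$. For an initial value $x$, $\mathcal{A}$ is the set of (admissible) strategies with $\mathbb{E}_x[\int_0^\infty e^{-qt}|f(U^\pi_t)|\,\mathrm{d}t+\int_0^\infty e^{-qt}\,\mathrm{d}R^\pi_t]<\infty$. The cost of $\pi$ is $$v_\pi(x)=\mathbb{E}_x\Big[\int_0^\infty e^{-qt}f(U^\pi_t)\,\mathrm{d}t+C\int_0^\infty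 e^{-qt}\,\mathrm{d}R^\pi_t\Big],$$ and $v(x)=\inf_{\pi\in\mathcal{A}}v_\pi(x)$. A strategy $\pi^*$ is optimal if it is admissible and $v_{\pi^*}(x)=v(x)$. Periodic barrier strategy. For $b\in\mathbb{R}$, $\pi^b$ pushes the controlled process up to $b$ at each time in $\mathcal{T}_\eta$ at which it is observed to be below $b$. Explicitly, the control and controlled processes are $R^b_t=\max_{1\le k\le N^\eta_t}(b-X_{T(k)})^+$ (equal to $0$ if $N^\eta_t=0$) and $U^b_t=X_t+R^b_t$. Write $v_b:=v_{\pi^b}$. *)

theory Defs
  imports "HOL-Probability.Probability"
begin

text \<open>Real-valued processes are functions \<open>real \<Rightarrow> 'a \<Rightarrow> real\<close>; only times \<open>t \<ge> 0\<close> matter, and the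
  definitions below never inspect a process at negative times. \<open>L\<close> denotes a Levy process started
  at 0, so that under \<open>\<P>\<^sub>x\<close> the process is \<open>X t = x + L t\<close>.\<close>

definition cadlag :: "(real \<Rightarrow> real) \<Rightarrow> bool" where
  "cadlag g \<longleftrightarrow> (\<forall>t\<ge>0. (g \<longlongrightarrow> g t) (at_right t)) \<and> (\<forall>t>0. \<exists>l. (g \<longlongrightarrow> l) (at_left t))"

definition caglad :: "(real \<Rightarrow> real) \<Rightarrow> bool" where
  "caglad g \<longleftrightarrow> (\<forall>t>0. (g \<longlongrightarrow> g t) (at_left t)) \<and> (\<forall>t\<ge>0. \<exists>l. (g \<longlongrightarrow> l) (at_right t))"

definition levy_process :: "'a measure \<Rightarrow> (real \<Rightarrow> 'a \<Rightarrow> real) \<Rightarrow> bool" where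
  "levy_process M L \<longleftrightarrow>
     prob_space M \<and>
     (\<forall>t\<ge>0. L t \<in> borel_measurable M) \<and>
     (\<forall>\<omega>\<in>space M. L 0 \<omega> = 0 \<and> cadlag (\<lambda>t. L t \<omega>)) \<and>
     (\<forall>(n::nat) t. 0 \<le> t 0 \<and> (\<forall>i<n. t i \<le> t (Suc i)) \<longrightarrow>
        prob_space.indep_vars M (\<lambda>_. borel) (\<lambda>i \<omega>. L (t (Suc i)) \<omega> - L (t i) \<omega>) {..<n}) \<and>
     (\<forall>s\<ge>0. \<forall>h\<ge>0. distr M borel (\<lambda>\<omega>. L (s + h) \<omega> - L s \<omega>) = distr M borel (L h))"

text \<open>\<open>\<Lambda>\<close> is the Levy measure of \<open>L\<close>: the jump measure in the Levy--Khintchine formula, with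
  linear drift \<open>\<gamma>\<close> and Gaussian coefficient \<open>\<sigma>\<close> relative to the truncation \<open>\<bar>z\<bar> < 1\<close>.\<close>

definition levy_measure_of :: "'a measure \<Rightarrow> (real \<Rightarrow> 'a \<Rightarrow> real) \<Rightarrow> real measure \<Rightarrow> bool" where
  "levy_measure_of M L \<Lambda> \<longleftrightarrow>
     sets \<Lambda> = sets borel \<and> emeasure \<Lambda> {0} = 0 \<and> (\<integral>\<^sup>+z. ennreal (min 1 (z\<^sup>2)) \<partial>\<Lambda>) < \<infinity> \<and>
     (\<exists>\<gamma> \<sigma>. \<sigma> \<ge> 0 \<and> (\<forall>t\<ge>0. \<forall>\<theta>.
        char (distr M borel (L t)) \<theta> =
          exp (complex_of_real t *
            (\<i> * complex_of_real (\<gamma> * \<theta>) - complex_of_real (\<sigma>\<^sup>2 * \<theta>\<^sup>2 / 2)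
             + (CLINT z|\<Lambda>. iexp (\<theta> * z) - 1
                  - \<i> * complex_of_real (\<theta> * z * indicator {-1<..<1} z))))))"

text \<open>A Levy process is a driftless compound Poisson process if it is constant, or if, for each
  time \<open>t\<close>, its value has the law of a sum of \<open>Poisson (c t)\<close> many i.i.d. jumps of law \<open>\<mu>\<close>
  independent of their number. (The one-dimensional marginals of a Levy process determine its law.)\<close>

definition driftless_compound_poisson :: "'a measure \<Rightarrow> (real \<Rightarrow> 'a \<Rightarrow> real) \<Rightarrow> bool" where
  "driftless_compound_poisson M L \<longleftrightarrow>
     (AE \<omega> in M. \<forall>t\<ge>0. L t \<omega> = L 0 \<omega>) \<or>
     (\<exists>c>0. \<exists>\<mu>. prob_space \<mu> \<and> sets \<mu> = sets borel \<and>
        (\<forall>t>0. distr M borel (L t) =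
           distr (measure_pmf (poisson_pmf (c * t)) \<Otimes>\<^sub>M PiM UNIV (\<lambda>_::nat. \<mu>)) borel
             (\<lambda>(n, \<xi>). \<Sum>k<n. \<xi> k)))"

text \<open>A Poisson process of intensity \<open>\<eta>\<close> is given by its arrival times \<open>T 1 < T 2 < \<dots>\<close> (with
  \<open>T 0 = 0\<close> as an auxiliary value); \<open>arrivals T t \<omega>\<close> is the set of indices of the arrivals
  up to \<open>t\<close>.\<close>

definition poisson_process :: "'a measure \<Rightarrow> real \<Rightarrow> (nat \<Rightarrow> 'a \<Rightarrow> real) \<Rightarrow> bool" where
  "poisson_process M \<eta> T \<longleftrightarrow>
     (\<forall>\<omega>\<in>space M. T 0 \<omega> = 0 \<and> strict_mono (\<lambda>k. T k \<omega>) \<and>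
        filterlim (\<lambda>k. T k \<omega>) at_top sequentially) \<and>
     prob_space.indep_vars M (\<lambda>_. borel) (\<lambda>k \<omega>. T (Suc k) \<omega> - T k \<omega>) UNIV \<and>
     (\<forall>k. distributed M lborel (\<lambda>\<omega>. T (Suc k) \<omega> - T k \<omega>) (exponential_density \<eta>))"

definition arrivals :: "(nat \<Rightarrow> 'a \<Rightarrow> real) \<Rightarrow> real \<Rightarrow> 'a \<Rightarrow> nat set" where
  "arrivals T t \<omega> = {k. 1 \<le> k \<and> T k \<omega> \<le> t}"

definition counting :: "(nat \<Rightarrow> 'a \<Rightarrow> real) \<Rightarrow> real \<Rightarrow> 'a \<Rightarrow> nat" where
  "counting T t \<omega> = card (arrivals T t \<omega>)"

definition independent_processes ::
    "'a measure \<Rightarrow> (real \<Rightarrow> 'a \<Rightarrow> real) \<Rightarrow> (nat \<Rightarrow> 'a \<Rightarrow> real) \<Rightarrow> bool" where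
  "independent_processes M L T \<longleftrightarrow>
     prob_space.indep_var M
       (PiM {0..} (\<lambda>_. borel)) (\<lambda>\<omega>. \<lambda>t\<in>{0..}. L t \<omega>)
       (PiM {0..} (\<lambda>_. borel)) (\<lambda>\<omega>. \<lambda>t\<in>{0..}. real (counting T t \<omega>))"

text \<open>The natural filtration is not augmented; it does not depend on the starting point of \<open>X\<close>.\<close>

definition natural_filtration ::
    "'a measure \<Rightarrow> (real \<Rightarrow> 'a \<Rightarrow> real) \<Rightarrow> (nat \<Rightarrow> 'a \<Rightarrow> real) \<Rightarrow> real \<Rightarrow> 'a measure" where
  "natural_filtration M L T t = sigma (space M)
     ({L s -` B \<inter> space M | s B. 0 \<le> s \<and> s \<le> t \<and> B \<in> sets borel} \<union>
      {counting T s -` B \<inter> space M | s B. 0 \<le> s \<and> s \<le> t})"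

text \<open>As usual, the representation \<open>R\<^sub>t = \<integral>\<^bsub>[0,t]\<^esub> \<nu> dN\<close> is understood up to indistinguishability: the
  periodic barrier control is represented by a caglad adapted \<open>\<nu>\<close> only off the null event that
  \<open>X\<close> and \<open>N\<close> jump simultaneously.\<close>

definition strategy ::
    "'a measure \<Rightarrow> (real \<Rightarrow> 'a \<Rightarrow> real) \<Rightarrow> (nat \<Rightarrow> 'a \<Rightarrow> real) \<Rightarrow> (real \<Rightarrow> 'a \<Rightarrow> real) \<Rightarrow> bool" where
  "strategy M L T R \<longleftrightarrow> (\<exists>\<nu>.
     (\<forall>\<omega>\<in>space M. caglad (\<lambda>t. \<nu> t \<omega>) \<and> (\<forall>t\<ge>0. \<nu> t \<omega> \<ge> 0)) \<and>
     (\<forall>t\<ge>0. \<nu> t \<in> borel_measurable (natural_filtration M L T t)) \<and>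
     (AE \<omega> in M. \<forall>t\<ge>0. R t \<omega> = (\<Sum>k\<in>arrivals T t \<omega>. \<nu> (T k \<omega>) \<omega>)))"

text \<open>The Stieltjes measure \<open>dR\<close> of a control path on \<open>[0,\<infinity>)\<close>, with the convention that \<open>R\<close>
  vanishes before time 0.\<close>

definition control_measure :: "(real \<Rightarrow> 'a \<Rightarrow> real) \<Rightarrow> 'a \<Rightarrow> real measure" where
  "control_measure R \<omega> = interval_measure (\<lambda>t. if t < 0 then 0 else R t \<omega>)"

text \<open>Expectations are taken with respect to \<open>completion M\<close>, so that they do not depend on the
  choice of an indistinguishable version; for measurable integrands this is the expectation
  under \<open>M\<close>.\<close>

definition admissible_strategies ::
    "'a measure \<Rightarrow> (real \<Rightarrow> 'a \<Rightarrow> real) \<Rightarrow> (nat \<Rightarrow> 'a \<Rightarrow> real) \<Rightarrow> real \<Rightarrow> (real \<Rightarrow> real) \<Rightarrow> real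
      \<Rightarrow> (real \<Rightarrow> 'a \<Rightarrow> real) set" where
  "admissible_strategies M L T q f x = {R. strategy M L T R \<and>
     (\<integral>\<^sup>+\<omega>. ((\<integral>\<^sup>+t\<in>{0..}. ennreal (exp (- q * t) * \<bar>f (x + L t \<omega> + R t \<omega>)\<bar>) \<partial>lborel)
        + (\<integral>\<^sup>+t\<in>{0..}. ennreal (exp (- q * t)) \<partial>control_measure R \<omega>)) \<partial>completion M) < \<infinity>}"

definition cost ::
    "'a measure \<Rightarrow> (real \<Rightarrow> 'a \<Rightarrow> real) \<Rightarrow> real \<Rightarrow> real \<Rightarrow> (real \<Rightarrow> real) \<Rightarrow> (real \<Rightarrow> 'a \<Rightarrow> real)
      \<Rightarrow> real \<Rightarrow> real" where
  "cost M L q C f R x = (LINT \<omega>|completion M.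
     (LINT t:{0..}|lborel. exp (- q * t) * f (x + L t \<omega> + R t \<omega>))
     + C * (LINT t:{0..}|control_measure R \<omega>. exp (- q * t)))"

definition value_function ::
    "'a measure \<Rightarrow> (real \<Rightarrow> 'a \<Rightarrow> real) \<Rightarrow> (nat \<Rightarrow> 'a \<Rightarrow> real) \<Rightarrow> real \<Rightarrow> real \<Rightarrow> (real \<Rightarrow> real)
      \<Rightarrow> real \<Rightarrow> ereal" where
  "value_function M L T q C f x =
     (INF R\<in>admissible_strategies M L T q f x. ereal (cost M L q C f R x))"

definition optimal_strategy ::
    "'a measure \<Rightarrow> (real \<Rightarrow> 'a \<Rightarrow> real) \<Rightarrow> (nat \<Rightarrow> 'a \<Rightarrow> real) \<Rightarrow> real \<Rightarrow> real \<Rightarrow> (real \<Rightarrow> real)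
      \<Rightarrow> real \<Rightarrow> (real \<Rightarrow> 'a \<Rightarrow> real) \<Rightarrow> bool" where
  "optimal_strategy M L T q C f x R \<longleftrightarrow>
     R \<in> admissible_strategies M L T q f x \<and>
     ereal (cost M L q C f R x) = value_function M L T q C f x"

text \<open>The control \<open>R\<^sup>b\<close> of the periodic barrier strategy with barrier \<open>b\<close>, started from \<open>x\<close>.\<close>

definition barrier_strategy ::
    "(real \<Rightarrow> 'a \<Rightarrow> real) \<Rightarrow> (nat \<Rightarrow> 'a \<Rightarrow> real) \<Rightarrow> real \<Rightarrow> real \<Rightarrow> real \<Rightarrow> 'a \<Rightarrow> real" where
  "barrier_strategy L T b x t \<omega> =
     (if counting T t \<omega> = 0 then 0
      else Max ((\<lambda>k. max (b - (x + L (T k \<omega>) \<omega>)) 0) ` {1..counting T t \<omega>}))"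

definition right_deriv :: "(real \<Rightarrow> real) \<Rightarrow> real \<Rightarrow> real" where
  "right_deriv f x = Lim (at_right x) (\<lambda>y. (f y - f x) / (y - x))"

definition right_deriv_neg_inf :: "(real \<Rightarrow> real) \<Rightarrow> ereal" where
  "right_deriv_neg_inf f = Lim at_bot (\<lambda>x. ereal (right_deriv f x))"

definition right_deriv_pos_inf :: "(real \<Rightarrow> real) \<Rightarrow> ereal" where
  "right_deriv_pos_inf f = Lim at_top (\<lambda>x. ereal (right_deriv f x))"

definition rho ::
    "'a measure \<Rightarrow> (real \<Rightarrow> 'a \<Rightarrow> real) \<Rightarrow> (nat \<Rightarrow> 'a \<Rightarrow> real) \<Rightarrow> real \<Rightarrow> (real \<Rightarrow> real) \<Rightarrow> real \<Rightarrow> real" where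
  "rho M L T q f b = (LINT \<omega>|completion M.
     (LINT t:{0..}|lborel.
        exp (- q * t) * right_deriv f (b + L t \<omega> + barrier_strategy L T b b t \<omega>)))"

definition b_star ::
    "'a measure \<Rightarrow> (real \<Rightarrow> 'a \<Rightarrow> real) \<Rightarrow> (nat \<Rightarrow> 'a \<Rightarrow> real) \<Rightarrow> real \<Rightarrow> real \<Rightarrow> (real \<Rightarrow> real) \<Rightarrow> ereal" where
  "b_star M L T q C f = Inf (ereal ` {b. rho M L T q f b + C \<ge> 0})"

end

theory Submission
  imports Defs "HOL-Complex_Analysis.Complex_Analysis" "HOL-Real_Asymp.Real_Asymp"
begin

text \<open>The proof compares costs directly, without a verification theorem. Since
  \<open>\<integral> e\<^sup>-\<^sup>q\<^sup>t dR = q \<integral> e\<^sup>-\<^sup>q\<^sup>t R dt\<close>, convexity of \<open>f\<close> bounds the cost of a strategy minus that of the barrier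
  strategy from below by the expectation of \<open>\<integral> e\<^sup>-\<^sup>q\<^sup>t g (U\<^sup>b) (R - R\<^sup>b) dt\<close>, where \<open>g = h + C q\<close> and \<open>h\<close> is any
  selection of subgradients of \<open>f\<close>. Both controls only move at arrival times, so the strong Markov
  property there turns this into a sum over the jumps, weighted by
  \<open>\<Gamma> y = E\<^sub>y \<integral> e\<^sup>-\<^sup>q\<^sup>t g (U\<^sup>b) dt\<close> at the position \<open>y \<ge> b\<close> after the arrival. \<open>\<Gamma>\<close> is nondecreasing because the
  barrier flow is monotone in its starting point, and \<open>R\<^sup>b\<close> jumps only if \<open>y = b\<close>; hence it suffices that
  \<open>\<Gamma> b = 0\<close>. At \<open>b = b\<^sup>*\<close> this is achieved by taking for \<open>h\<close> a convex combination of the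
  right and left derivatives of \<open>f\<close>.\<close>

text \<open>Two obstacles shape the proof. The pairing of \<open>g (U\<^sup>b)\<close> with
  \<open>R - R\<^sup>b\<close> is not known to be integrable in advance: \<open>R\<close> has only a
  finite discounted mean, while \<open>g\<close> may grow polynomially. So the strong Markov
  argument is carried out with nonnegative extended integrals, for the positive and the negative
  part of \<open>g\<close> separately. Among starting points y \<ge> b the value of the negative
  part is largest at b, which bounds its pairing with any control; the positive part is then
  dominated through the convexity inequality itself. Secondly, the cost of the barrier control calls
  for moments of the process that grow in time more slowly than the discount decays, but the Levy
  measure is tied to the process only through the characteristic function. The exponential moment of
  the large jumps continues the exponent holomorphically to a disc around 0, and even moments are
  read off from bounds there. The interpolation at \<open>b\<^sup>*\<close> covers a jump across 0:
  as a function of the barrier, the integral of the right derivative is handled only as monotone and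
  right-continuous.\<close>

section \<open>Moments of Levy processes\<close>

primrec central_diff :: "nat \<Rightarrow> real \<Rightarrow> (real \<Rightarrow> complex) \<Rightarrow> real \<Rightarrow> complex" where
  "central_diff 0 h F = F"
| "central_diff (Suc n) h F = central_diff n h (\<lambda>u. F (u + h/2) - F (u - h/2))"

lemma central_diff_cong:
  assumes "\<And>v. \<bar>v\<bar> \<le> \<bar>u\<bar> + n * h / 2 \<Longrightarrow> F v = G v" "0 < h"
  shows "central_diff n h F u = central_diff n h G u"
  using assms
proof (induction n arbitrary: F G)
  case 0
  then show ?case by simp
next
  case (Suc n)
  have "F (v + h/2) - F (v - h/2) = G (v + h/2) - G (v - h/2)" if "\<bar>v\<bar> \<le> \<bar>u\<bar> + n * h / 2" for v
  proof -
    have "Suc n * h / 2 = n * h / 2 + h / 2" by (simp add: field_simps)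
    then have "\<bar>v + h / 2\<bar> \<le> \<bar>u\<bar> + Suc n * h / 2" "\<bar>v - h / 2\<bar> \<le> \<bar>u\<bar> + Suc n * h / 2"
      using that \<open>0 < h\<close> by linarith+
    then show ?thesis
      using Suc.prems(1) by simp
  qed
  from Suc.IH[OF this \<open>0 < h\<close>] show ?case by simp
qed

text \<open>\<open>F k\<close> plays the role of the k-th derivative. Differencing commutes with
  differentiation, so the mean value inequality at top order gains one factor h and induction does
  the rest; the radius shrinks by h/2 each time to keep both shifted points inside.\<close>

lemma norm_central_diff_le:
  fixes F :: "nat \<Rightarrow> real \<Rightarrow> complex"
  assumes "\<And>k u. \<bar>u\<bar> < R \<Longrightarrow> k < n \<Longrightarrow> (F k has_vector_derivative F (Suc k) u) (at u)"
    and "\<And>u. \<bar>u\<bar> < R \<Longrightarrow> norm (F n u) \<le> B" "0 < h" "\<bar>u\<bar> + n * h / 2 < R"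
  shows "norm (central_diff n h (F 0) u) \<le> B * h ^ n"
  using assms
proof (induction n arbitrary: F R B)
  case 0
  then show ?case by simp
next
  case (Suc n)
  define G where "G k v = F k (v + h/2) - F k (v - h/2)" for k v
  have 1: "(G k has_vector_derivative G (Suc k) v) (at v)" if v: "\<bar>v\<bar> < R - h/2" and k: "k < n" for k v
  proof -
    have a: "(F k has_vector_derivative F (Suc k) (v + h/2)) (at (v + h/2))"
      by (rule Suc.prems(1)) (use v k \<open>0 < h\<close> in linarith)+
    have b: "(F k has_vector_derivative F (Suc k) (v - h/2)) (at (v - h/2))"
      by (rule Suc.prems(1)) (use v k \<open>0 < h\<close> in linarith)+
    have a': "((\<lambda>v. F k (v + h/2)) has_vector_derivative F (Suc k) (v + h/2)) (at v)"
    proof -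
      have "((\<lambda>v. v + h/2) has_vector_derivative 1) (at v)"
        by (auto intro!: derivative_eq_intros)
      from vector_diff_chain_at[OF this a] show ?thesis by (simp add: o_def)
    qed
    have b': "((\<lambda>v. F k (v - h/2)) has_vector_derivative F (Suc k) (v - h/2)) (at v)"
    proof -
      have "((\<lambda>v. v - h/2) has_vector_derivative 1) (at v)"
        by (auto intro!: derivative_eq_intros)
      from vector_diff_chain_at[OF this b] show ?thesis by (simp add: o_def)
    qed
    show ?thesis
      unfolding G_def by (intro has_vector_derivative_diff a' b')
  qed
  have 2: "norm (G n v) \<le> B * h" if v: "\<bar>v\<bar> < R - h/2" for v
  proof -
    have "norm (F n (v + h/2) - F n (v - h/2)) \<le> B * norm ((v + h/2) - (v - h/2))"
    proof (rule differentiable_bound[where S = "{-R<..<R}" and f' = "\<lambda>u t. t *\<^sub>R F (Suc n) u"])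
      fix x assume "x \<in> {-R<..<R}"
      then have x: "\<bar>x\<bar> < R" by (simp add: abs_less_iff)
      show "(F n has_derivative (\<lambda>t. t *\<^sub>R F (Suc n) x)) (at x within {-R<..<R})"
        using Suc.prems(1)[OF x lessI, unfolded has_vector_derivative_def] by (rule has_derivative_at_withinI)
      show "onorm (\<lambda>t. t *\<^sub>R F (Suc n) x) \<le> B"
      proof (rule onorm_le)
        show "norm (t *\<^sub>R F (Suc n) x) \<le> B * norm t" for t
          using mult_left_mono[OF Suc.prems(2)[OF x], of "\<bar>t\<bar>"] by (simp add: mult.commute)
      qed
    next
      show "v + h/2 \<in> {-R<..<R}" "v - h/2 \<in> {-R<..<R}"
        using v \<open>0 < h\<close> by (simp_all, linarith+)
    qed simp
    then show ?thesis using \<open>0 < h\<close> by (simp add: G_def)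
  qed
  have "norm (central_diff n h (G 0) u) \<le> (B * h) * h ^ n"
  proof (rule Suc.IH[of "R - h/2", OF 1 2 \<open>0 < h\<close>])
    have "Suc n * h / 2 = n * h / 2 + h / 2" by (simp add: field_simps)
    then show "\<bar>u\<bar> + n * h / 2 < R - h / 2" using Suc.prems(4) by linarith
  qed
  then show ?case
    by (simp add: G_def[abs_def] mult_ac)
qed

text \<open>A symmetric step multiplies iexp(u x) by 2 i sin(h x / 2), without any phase factor. The
  weight \<open>k\<close> is carried along so that the induction can absorb these
  multipliers.\<close>

lemma (in real_distribution) central_diff_char:
  fixes k :: "real \<Rightarrow> complex"
  assumes [measurable]: "k \<in> borel_measurable borel" and bd: "\<And>x. norm (k x) \<le> B"
  shows "central_diff n h (\<lambda>u. CLINT x|M. iexp (u * x) * k x) u =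
    (CLINT x|M. iexp (u * x) * k x * (2 * \<i> * of_real (sin (h * x / 2))) ^ n)"
  using assms
proof (induction n arbitrary: k B)
  case 0
  then show ?case by simp
next
  case (Suc n)
  note [measurable] = Suc.prems(1)
  have int: "integrable M (\<lambda>x. iexp (u * x) * k x)" for u
    by (rule integrable_const_bound[where B = B]) (use Suc.prems(2) in \<open>auto simp: norm_mult\<close>)
  have key: "iexp ((v + h/2) * x) - iexp ((v - h/2) * x) = iexp (v * x) * (2 * \<i> * of_real (sin (h * x / 2)))" for v x
  proof -
    have 1: "2 * \<i> * of_real (sin (h * x / 2)) = iexp (h * x / 2) - iexp (- (h * x / 2))"
      unfolding cis_conv_exp[symmetric] by (simp add: complex_eq_iff)
    have 2: "iexp ((v + h/2) * x) = iexp (v * x) * iexp (h * x / 2)"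
      "iexp ((v - h/2) * x) = iexp (v * x) * iexp (- (h * x / 2))"
      by (simp_all add: algebra_simps flip: exp_add)
    show ?thesis
      unfolding 1 2 by (simp only: right_diff_distrib)
  qed
  have key': "(iexp ((v + h/2) * x) - iexp ((v - h/2) * x)) * k x
      = iexp (v * x) * (k x * (2 * \<i> * of_real (sin (h * x / 2))))" for v x
    unfolding key by (simp only: mult_ac)
  have eq: "(\<lambda>v. (CLINT x|M. iexp ((v + h/2) * x) * k x) - (CLINT x|M. iexp ((v - h/2) * x) * k x))
      = (\<lambda>v. CLINT x|M. iexp (v * x) * (k x * (2 * \<i> * of_real (sin (h * x / 2)))))"
    by (rule ext, subst Bochner_Integration.integral_diff[symmetric, OF int int],
        rule Bochner_Integration.integral_cong[OF refl])
       (simp only: left_diff_distrib[symmetric] key' )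
  have bd2: "norm (k x * (2 * \<i> * of_real (sin (h * x / 2)))) \<le> B * 2" for x
  proof -
    have "norm (k x * (2 * \<i> * of_real (sin (h * x / 2)))) = norm (k x) * (2 * \<bar>sin (h * x / 2)\<bar>)"
      by (simp add: norm_mult)
    also have "\<dots> \<le> B * 2"
      using abs_sin_le_one[of "h * x / 2"] order_trans[OF norm_ge_zero Suc.prems(2)[of x]]
      by (intro mult_mono Suc.prems(2)) auto
    finally show ?thesis .
  qed
  have "(\<lambda>x. k x * (2 * \<i> * of_real (sin (h * x / 2)))) \<in> borel_measurable borel"
    by measurable
  from Suc.IH[OF this bd2] show ?case
    unfolding central_diff.simps eq power_Suc by (simp only: mult.assoc)
qed

lemma sin_quotient_tendsto:
  assumes "h > (0::real)"
  shows "(\<lambda>i. 2 * sin (h / Suc i * x / 2) / (h / Suc i)) \<longlonglongrightarrow> x"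
proof -
  have "((\<lambda>t::real. 2 * sin (t * x / 2) / t) \<longlongrightarrow> x) (at 0)"
  proof -
    have "((\<lambda>t. 2 * sin (t * x / 2)) has_real_derivative x) (at 0)"
      by (auto intro!: derivative_eq_intros)
    then show ?thesis
      unfolding has_field_derivative_iff by simp
  qed
  moreover have "filterlim (\<lambda>i. h / Suc i) (at 0) sequentially"
    unfolding filterlim_at using assms LIMSEQ_inverse_real_of_nat[THEN tendsto_mult_right_zero, of h]
    by (auto simp: field_simps)
  ultimately show ?thesis
    by (rule filterlim_compose)
qed

text \<open>The moments are recovered from the characteristic function as limits of its central
  differences at 0, which Cauchy's estimates bound for a function holomorphic near 0.\<close>

lemma (in real_distribution) even_moment_le:
  assumes hol: "F holomorphic_on ball 0 r" and r: "r > 0"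
    and B: "\<And>z. norm z < r \<Longrightarrow> norm (F z) \<le> B"
    and eq: "\<And>u. \<bar>u\<bar> < r \<Longrightarrow> char M u = F (complex_of_real u)"
  shows "(\<integral>\<^sup>+x. ennreal (x ^ (2 * m)) \<partial>M) \<le> ennreal (fact (2 * m) * B / (r / 4) ^ (2 * m))"
proof -
  define n where "n = 2 * m"
  \<comment> \<open>Cauchy's bound for the n-th derivative with radius r/4: for \<bar>u\<bar> < r/2
    the closed disc of that radius around u stays inside the ball of radius r.\<close>
  define K where "K = fact n * B / (r / 4) ^ n"
  have Bn: "0 \<le> B" using B[of 0] r by (auto intro: order_trans[OF norm_ge_zero])
  have K0: "0 \<le> K" using Bn r by (auto simp: K_def)
  define Fk where "Fk k u = (deriv ^^ k) F (complex_of_real u)" for k u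
  have D: "(Fk k has_vector_derivative Fk (Suc k) u) (at u)" if "\<bar>u\<bar> < r/2" for k u
  proof -
    have "((deriv ^^ k) F has_field_derivative deriv ((deriv ^^ k) F) (of_real u)) (at (of_real u))"
      by (rule holomorphic_derivI[OF holomorphic_higher_deriv[OF hol]]) (use that r in auto)
    from has_vector_derivative_real_field[OF this] show ?thesis
      unfolding Fk_def o_def by simp
  qed
  have bdd: "norm (Fk n u) \<le> K" if "\<bar>u\<bar> < r/2" for u
    unfolding Fk_def K_def
  proof (rule Cauchy_inequality)
    have sub: "cball (complex_of_real u) (r/4) \<subseteq> ball 0 r"
    proof
      fix z assume "z \<in> cball (complex_of_real u) (r/4)"
      then have "norm (complex_of_real u - z) \<le> r/4" by (simp add: dist_norm)
      moreover have "norm z \<le> norm (complex_of_real u) + norm (complex_of_real u - z)"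
        using norm_triangle_sub[of z "complex_of_real u"] by (simp only: norm_minus_commute)
      ultimately show "z \<in> ball 0 r" using that r by simp
    qed
    show "F holomorphic_on ball (complex_of_real u) (r / 4)"
      by (rule holomorphic_on_subset[OF hol]) (use sub ball_subset_cball in blast)
    show "continuous_on (cball (complex_of_real u) (r/4)) F"
      by (rule continuous_on_subset[OF holomorphic_on_imp_continuous_on[OF hol] sub])
    show "norm (F x) \<le> B" if "norm (complex_of_real u - x) = r/4" for x
      using sub that by (intro B) (auto simp: dist_norm subset_iff)
  qed (use r in auto)
  \<comment> \<open>Chosen so that n h / 2 < r/4: all points entering the n-th difference at 0 stay
    where the characteristic function is \<open>F\<close>. The summand 1 in the denominator covers n
    = 0.\<close>
  define h where "h i = r / (4 * (n + 1)) / Suc i" for i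
  have h0: "0 < h i" for i using r by (simp add: h_def)
  have hn: "n * h i / 2 < r / 4" for i
  proof -
    have "h i \<le> r / (4 * (n + 1)) / 1"
      unfolding h_def using r by (intro divide_left_mono) auto
    then have "n * h i \<le> n * (r / (4 * (n + 1)))"
      by (intro mult_left_mono) auto
    also have "\<dots> < r / 4 * 2" using r by (auto simp: field_simps add_pos_nonneg)
    finally show ?thesis by simp
  qed
  have cd: "norm (central_diff n (h i) (char M) 0) \<le> K * h i ^ n" for i
  proof -
    have "central_diff n (h i) (char M) 0 = central_diff n (h i) (Fk 0) 0"
      by (rule central_diff_cong) (use hn[of i] h0[of i] r in \<open>auto simp: Fk_def intro!: eq\<close>)
    also have "norm \<dots> \<le> K * h i ^ n"
      by (rule norm_central_diff_le[of "r/2"]) (use D bdd hn[of i] h0[of i] r in auto)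
    finally show ?thesis .
  qed
  have rep: "norm (central_diff n (h i) (char M) 0) = (LINT x|M. (2 * sin (h i * x / 2)) ^ n)" for i
  proof -
    have "central_diff n (h i) (char M) 0 = (CLINT x|M. (2 * \<i> * of_real (sin (h i * x / 2))) ^ n)"
      using central_diff_char[of "\<lambda>_. 1" 1 n "h i" 0] by (simp add: char_def[abs_def])
    \<comment> \<open>For even order the powers of i collapse to a sign, so the norm of the
      difference equals the integral of a nonnegative function.\<close>
    also have "\<dots> = (CLINT x|M. (-1) ^ m * complex_of_real ((2 * sin (h i * x / 2)) ^ n))"
    proof (rule Bochner_Integration.integral_cong)
      show "(2 * \<i> * of_real (sin (h i * x / 2))) ^ n = (-1) ^ m * complex_of_real ((2 * sin (h i * x / 2)) ^ n)" for x
      proof -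
        have "(2 * \<i> * of_real s)\<^sup>2 = (-1) * complex_of_real ((2 * s)\<^sup>2)" for s
          by (simp add: power_mult_distrib)
        then show ?thesis unfolding n_def power_mult of_real_power[symmetric]
          by (simp only: power_mult_distrib[of "-1"] of_real_power)
      qed
    qed simp
    also have "\<dots> = (-1) ^ m * complex_of_real (LINT x|M. (2 * sin (h i * x / 2)) ^ n)"
      by (simp only: integral_mult_right_zero integral_complex_of_real)
    also have "norm \<dots> = \<bar>LINT x|M. (2 * sin (h i * x / 2)) ^ n\<bar>"
      by (simp only: norm_mult norm_power norm_minus_cancel norm_one power_one mult_1 norm_of_real)
    also have "\<dots> = (LINT x|M. (2 * sin (h i * x / 2)) ^ n)"
      by (intro abs_of_nonneg integral_nonneg_AE) (auto simp: n_def)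
    finally show ?thesis .
  qed
  have le: "(\<integral>\<^sup>+x. ennreal ((2 * sin (h i * x / 2) / h i) ^ n) \<partial>M) \<le> ennreal K" for i
  proof -
    have "integrable M (\<lambda>x. (2 * sin (h i * x / 2)) ^ n)"
    proof (rule integrable_const_bound[where B = "2 ^ n"])
      show "AE x in M. norm ((2 * sin (h i * x / 2)) ^ n) \<le> 2 ^ n"
        unfolding real_norm_def power_abs abs_mult by (intro AE_I2 power_mono) auto
    qed auto
    then have int: "integrable M (\<lambda>x. (2 * sin (h i * x / 2)) ^ n / h i ^ n)"
      by (rule integrable_divide_zero) 
    have "(\<integral>\<^sup>+x. ennreal ((2 * sin (h i * x / 2) / h i) ^ n) \<partial>M)
        = ennreal (LINT x|M. (2 * sin (h i * x / 2)) ^ n / h i ^ n)"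
      unfolding power_divide
      by (rule nn_integral_eq_integral[OF int]) (use h0[of i] in \<open>auto simp: n_def intro!: AE_I2\<close>)
    also have "(LINT x|M. (2 * sin (h i * x / 2)) ^ n / h i ^ n) \<le> K"
      using cd[of i] h0[of i] unfolding rep by (simp add: field_simps)
    finally show ?thesis using K0 by (simp add: ennreal_leI)
  qed
  have lim: "liminf (\<lambda>i. ennreal ((2 * sin (h i * x / 2) / h i) ^ n)) = ennreal (x ^ n)" for x
  proof (rule lim_imp_Liminf)
    have "(\<lambda>i. 2 * sin (h i * x / 2) / h i) \<longlonglongrightarrow> x"
      unfolding h_def by (rule sin_quotient_tendsto) (use r in auto)
    then show "(\<lambda>i. ennreal ((2 * sin (h i * x / 2) / h i) ^ n)) \<longlonglongrightarrow> ennreal (x ^ n)"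
      by (intro tendsto_ennrealI tendsto_power)
  qed auto
  have "(\<integral>\<^sup>+x. ennreal (x ^ n) \<partial>M) = (\<integral>\<^sup>+x. liminf (\<lambda>i. ennreal ((2 * sin (h i * x / 2) / h i) ^ n)) \<partial>M)"
    by (simp add: lim)
  also have "\<dots> \<le> liminf (\<lambda>i. \<integral>\<^sup>+x. ennreal ((2 * sin (h i * x / 2) / h i) ^ n) \<partial>M)"
    by (rule nn_integral_liminf) auto
  also have "\<dots> \<le> ennreal K"
    by (rule order_trans[OF Liminf_mono[where g = "\<lambda>_. ennreal K"]]) (use le in \<open>auto simp: Liminf_const\<close>)
  finally show ?thesis by (simp add: n_def K_def)
qed

text \<open>The exponent is the power series obtained by integrating the exponential series term by term.\<close>

lemma levy_exponent_holomorphic: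
  fixes \<Lambda> :: "real measure"
  assumes [measurable_cong]: "sets \<Lambda> = sets borel"
    and m2: "(\<integral>\<^sup>+z. ennreal (min 1 (z\<^sup>2)) \<partial>\<Lambda>) < \<infinity>"
    and \<theta>: "0 < \<theta>"
    and mexp: "(\<integral>\<^sup>+z\<in>- {-1<..<1}. ennreal (exp (\<theta> * \<bar>z\<bar>)) \<partial>\<Lambda>) < \<infinity>"
  obtains \<Psi> r where "0 < r" "\<Psi> holomorphic_on ball 0 r" "\<Psi> 0 = 0"
    "\<And>u. \<bar>u\<bar> < r \<Longrightarrow> (CLINT z|\<Lambda>. iexp (u * z) - 1 - \<i> * complex_of_real (u * z * indicator {-1<..<1} z))
       = \<Psi> (complex_of_real u)"
proof -
  \<comment> \<open>r \<le> \<theta> lets the exponential moment control large jumps; r \<le> 1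
    makes the quadratic bound of exp applicable to small ones.\<close>
  define r where "r = min \<theta> 1"
  have r: "0 < r" "r \<le> 1" "r \<le> \<theta>" using \<theta> by (auto simp: r_def)
  define ind :: "real \<Rightarrow> real" where "ind = indicator {-1<..<1}"
  have [measurable]: "ind \<in> borel_measurable borel" by (simp add: ind_def)
  \<comment> \<open>The coefficient of the n-th power of the argument in the integrand. The
    compensation removes the constant term, and the linear term for \<bar>z\<bar> < 1.\<close>
  define c :: "nat \<Rightarrow> real \<Rightarrow> complex" where
    "c n z = (\<i> * of_real z) ^ n /\<^sub>R fact n - (if n = 0 then 1 else if n = 1 then \<i> * of_real (z * ind z) else 0)" for n z
  have [measurable]: "c n \<in> borel_measurable borel" for n
    unfolding c_def by measurable
  have csum: "(\<lambda>n. c n z * of_real u ^ n) sums (iexp (u * z) - 1 - \<i> * of_real (u * z * ind z))" for z u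
  proof -
    have "(\<lambda>n. (\<i> * of_real (u * z)) ^ n /\<^sub>R fact n) sums iexp (u * z)"
      by (rule exp_converges)
    moreover have "(\<lambda>n. if n = 0 then 1 else if n = 1 then \<i> * of_real (u * z * ind z) else 0 :: complex)
        sums (\<Sum>n\<in>{0,1::nat}. if n = 0 then 1 else if n = 1 then \<i> * of_real (u * z * ind z) else 0)"
      by (rule sums_finite) auto
    ultimately have "(\<lambda>n. (\<i> * of_real (u * z)) ^ n /\<^sub>R fact n -
        (if n = 0 then 1 else if n = 1 then \<i> * of_real (u * z * ind z) else 0))
      sums (iexp (u * z) - (\<Sum>n\<in>{0,1::nat}. if n = 0 then 1 else if n = 1 then \<i> * of_real (u * z * ind z) else 0))"
      by (rule sums_diff)
    also have "(\<lambda>n. (\<i> * of_real (u * z)) ^ n /\<^sub>R fact n -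
        (if n = 0 then 1 else if n = 1 then \<i> * of_real (u * z * ind z) else 0)) = (\<lambda>n. c n z * of_real u ^ n)"
    proof
      fix n :: nat
      have "n = 0 \<or> n = 1 \<or> 2 \<le> n" by linarith
      then show "(\<i> * of_real (u * z)) ^ n /\<^sub>R fact n -
        (if n = 0 then 1 else if n = 1 then \<i> * of_real (u * z * ind z) else 0) = c n z * of_real u ^ n"
        by (elim disjE) (simp_all add: c_def power_mult_distrib left_diff_distrib)
    qed
    finally show ?thesis by (simp add: algebra_simps)
  qed
  \<comment> \<open>The n-th term of the series in absolute value at the radius of convergence that
    is wanted; \<open>esum\<close> sums it in closed form.\<close>
  define e where "e n z = norm (c n z) * r ^ n" for n z
  have e_nonneg: "0 \<le> e n z" for n z using r by (simp add: e_def)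
  have [measurable]: "e n \<in> borel_measurable borel" for n
    unfolding e_def by measurable
  have ind01: "ind z = 0 \<or> ind z = 1" for z by (simp add: ind_def indicator_def)
  have esum: "(\<lambda>n. e n z) sums (exp (r * \<bar>z\<bar>) - 1 - r * \<bar>z\<bar> * ind z)" for z
  proof -
    have "(\<lambda>n. (r * \<bar>z\<bar>) ^ n /\<^sub>R fact n) sums exp (r * \<bar>z\<bar>)"
      by (rule exp_converges)
    moreover have "(\<lambda>n. if n = 0 then 1 else if n = 1 then r * \<bar>z\<bar> * ind z else 0)
        sums (\<Sum>n\<in>{0,1::nat}. if n = 0 then 1 else if n = 1 then r * \<bar>z\<bar> * ind z else 0)"
      by (rule sums_finite) auto
    ultimately have "(\<lambda>n. (r * \<bar>z\<bar>) ^ n /\<^sub>R fact n - (if n = 0 then 1 else if n = 1 then r * \<bar>z\<bar> * ind z else 0))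
      sums (exp (r * \<bar>z\<bar>) - (\<Sum>n\<in>{0,1::nat}. if n = 0 then 1 else if n = 1 then r * \<bar>z\<bar> * ind z else 0))"
      by (rule sums_diff)
    also have "(\<lambda>n. (r * \<bar>z\<bar>) ^ n /\<^sub>R fact n - (if n = 0 then 1 else if n = 1 then r * \<bar>z\<bar> * ind z else 0)) = (\<lambda>n. e n z)"
    proof
      fix n :: nat
      have "n = 0 \<or> n = 1 \<or> 2 \<le> n" by linarith
      then show "(r * \<bar>z\<bar>) ^ n /\<^sub>R fact n - (if n = 0 then 1 else if n = 1 then r * \<bar>z\<bar> * ind z else 0) = e n z"
        using ind01[of z]
        by (elim disjE) (simp_all add: e_def c_def power_mult_distrib norm_mult norm_power)
    qed
    finally show ?thesis by (simp add: algebra_simps)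
  qed
  \<comment> \<open>For small jumps exp y \<le> 1 + y + y^2 leaves only the quadratic term, since
    the linear one is compensated; for large jumps the exponential alone is the bound.\<close>
  have ebound: "exp (r * \<bar>z\<bar>) - 1 - r * \<bar>z\<bar> * ind z
      \<le> min 1 (z\<^sup>2) + exp (\<theta> * \<bar>z\<bar>) * indicator (- {-1<..<1}) z" for z
  proof (cases "\<bar>z\<bar> < 1")
    case True
    have y: "r * \<bar>z\<bar> \<le> \<bar>z\<bar>" using r by (simp add: mult_left_le_one_le)
    have "exp (r * \<bar>z\<bar>) \<le> 1 + r * \<bar>z\<bar> + (r * \<bar>z\<bar>)\<^sup>2"
      by (rule exp_bound) (use r y True in auto)
    moreover have "(r * \<bar>z\<bar>)\<^sup>2 \<le> z\<^sup>2"
      using power_mono[OF y, of 2] r by simp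
    moreover have "z\<^sup>2 \<le> 1" using True by (simp add: abs_square_le_1)
    moreover have "ind z = 1" "indicator (- {-1<..<1}) z = (0::real)"
      using True by (auto simp: ind_def abs_less_iff indicator_def)
    ultimately show ?thesis by simp
  next
    case False
    then have "ind z = 0" "indicator (- {-1<..<1}) z = (1::real)"
      by (auto simp: ind_def indicator_def)
    moreover have "exp (r * \<bar>z\<bar>) \<le> exp (\<theta> * \<bar>z\<bar>)" using r by (simp add: mult_right_mono)
    then have "exp (r * \<bar>z\<bar>) - 1 \<le> min 1 (z\<^sup>2) + exp (\<theta> * \<bar>z\<bar>)"
      using zero_le_power2[of z] by linarith
    ultimately show ?thesis by simp
  qed
  \<comment> \<open>By Tonelli the integrated majorants are summable. Both the convergence of the
    power series and the termwise integration rest on this.\<close>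
  have sumfin: "(\<Sum>n. \<integral>\<^sup>+z. ennreal (e n z) \<partial>\<Lambda>) < \<infinity>"
  proof -
    have "(\<Sum>n. \<integral>\<^sup>+z. ennreal (e n z) \<partial>\<Lambda>) = (\<integral>\<^sup>+z. (\<Sum>n. ennreal (e n z)) \<partial>\<Lambda>)"
      by (simp add: nn_integral_suminf)
    also have "\<dots> = (\<integral>\<^sup>+z. ennreal (exp (r * \<bar>z\<bar>) - 1 - r * \<bar>z\<bar> * ind z) \<partial>\<Lambda>)"
    proof (rule nn_integral_cong)
      fix z
      have "(\<Sum>n. ennreal (e n z)) = ennreal (\<Sum>n. e n z)"
        using e_nonneg esum[of z] by (intro suminf_ennreal2) (auto simp: sums_iff)
      then show "(\<Sum>n. ennreal (e n z)) = ennreal (exp (r * \<bar>z\<bar>) - 1 - r * \<bar>z\<bar> * ind z)"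
        using esum[of z] by (simp add: sums_iff)
    qed
    also have "\<dots> \<le> (\<integral>\<^sup>+z. ennreal (min 1 (z\<^sup>2)) + ennreal (exp (\<theta> * \<bar>z\<bar>)) * indicator (- {-1<..<1}) z \<partial>\<Lambda>)"
    proof (rule nn_integral_mono)
      fix z
      have "ennreal (exp (r * \<bar>z\<bar>) - 1 - r * \<bar>z\<bar> * ind z)
          \<le> ennreal (min 1 (z\<^sup>2) + exp (\<theta> * \<bar>z\<bar>) * indicator (- {-1<..<1}) z)"
        by (rule ennreal_leI[OF ebound])
      also have "\<dots> = ennreal (min 1 (z\<^sup>2)) + ennreal (exp (\<theta> * \<bar>z\<bar>)) * indicator (- {-1<..<1}) z"
        by (auto simp: indicator_def ennreal_plus)
      finally show "ennreal (exp (r * \<bar>z\<bar>) - 1 - r * \<bar>z\<bar> * ind z)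
          \<le> ennreal (min 1 (z\<^sup>2)) + ennreal (exp (\<theta> * \<bar>z\<bar>)) * indicator (- {-1<..<1}) z" .
    qed
    also have "\<dots> < \<infinity>"
      using m2 mexp by (subst nn_integral_add) (auto simp: ennreal_add_less_top)
    finally show ?thesis .
  qed
  have eint: "integrable \<Lambda> (e n)" for n
  proof (rule integrableI_nonneg)
    have "(\<integral>\<^sup>+z. ennreal (e n z) \<partial>\<Lambda>) \<le> (\<Sum>n. \<integral>\<^sup>+z. ennreal (e n z) \<partial>\<Lambda>)"
      using sum_le_suminf[of "\<lambda>n. \<integral>\<^sup>+z. ennreal (e n z) \<partial>\<Lambda>" "{n}"] by simp
    then show "(\<integral>\<^sup>+z. ennreal (e n z) \<partial>\<Lambda>) < \<infinity>" using sumfin by (rule le_less_trans)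
  qed (use e_nonneg in auto)
  have esummable: "summable (\<lambda>n. LINT z|\<Lambda>. e n z)"
  proof (rule summable_suminf_not_top)
    show "(\<Sum>n. ennreal (LINT z|\<Lambda>. e n z)) \<noteq> \<top>"
      using sumfin by (simp add: nn_integral_eq_integral[OF eint] e_nonneg)
  qed (auto intro: integral_nonneg_AE simp: e_nonneg)
  define a where "a n = (CLINT z|\<Lambda>. c n z)" for n
  have a_le: "norm (a n) * r ^ n \<le> (LINT z|\<Lambda>. e n z)" for n
  proof -
    have "norm (a n) * r ^ n \<le> (LINT z|\<Lambda>. norm (c n z)) * r ^ n"
      unfolding a_def using r by (intro mult_right_mono integral_norm_bound) auto
    also have "\<dots> = (LINT z|\<Lambda>. e n z)" by (simp add: e_def)
    finally show ?thesis .
  qed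
  have asum: "summable (\<lambda>n. norm (a n * w ^ n))" if "norm w < r" for w
  proof (rule summable_comparison_test'[OF esummable])
    fix n :: nat
    have "norm (a n) * norm w ^ n \<le> norm (a n) * r ^ n"
      using that by (intro mult_left_mono power_mono) auto
    then show "norm (norm (a n * w ^ n)) \<le> (LINT z|\<Lambda>. e n z)"
      using a_le[of n] by (simp add: norm_mult norm_power)
  qed
  define \<Psi> where "\<Psi> w = (\<Sum>n. a n * w ^ n)" for w
  have "\<Psi> holomorphic_on ball 0 r"
    by (rule power_series_holomorphic[where a = a])
       (auto simp: \<Psi>_def intro!: summable_sums summable_norm_cancel[OF asum])
  moreover have "\<Psi> 0 = 0"
  proof -
    have "\<Psi> 0 = a 0" unfolding \<Psi>_def using powser_zero[of a] by simp
    also have "\<dots> = 0" by (simp add: a_def c_def)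
    finally show ?thesis .
  qed
  moreover have "(CLINT z|\<Lambda>. iexp (u * z) - 1 - \<i> * complex_of_real (u * z * indicator {-1<..<1} z))
       = \<Psi> (complex_of_real u)" if u: "\<bar>u\<bar> < r" for u
  proof -
    have le: "norm (c n z * of_real u ^ n) \<le> e n z" for n z
      unfolding e_def norm_mult norm_power norm_of_real
      using u by (intro mult_left_mono power_mono) auto
    have cint: "integrable \<Lambda> (\<lambda>z. c n z * of_real u ^ n)" for n
    proof (rule Bochner_Integration.integrable_bound[OF eint[of n]])
      show "AE z in \<Lambda>. norm (c n z * of_real u ^ n) \<le> norm (e n z)"
        unfolding real_norm_def abs_of_nonneg[OF e_nonneg] by (rule AE_I2[OF le])
    qed measurable
    have "(CLINT z|\<Lambda>. iexp (u * z) - 1 - \<i> * complex_of_real (u * z * ind z))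
       = (CLINT z|\<Lambda>. (\<Sum>n. c n z * of_real u ^ n))"
      using csum by (intro Bochner_Integration.integral_cong refl) (simp add: sums_iff)
    also have "\<dots> = (\<Sum>n. CLINT z|\<Lambda>. c n z * of_real u ^ n)"
    proof (rule integral_suminf[OF cint])
      have "summable (\<lambda>n. norm (c n z * of_real u ^ n))" for z
        by (rule summable_comparison_test'[OF sums_summable[OF esum[of z]]]) (metis abs_norm_cancel le real_norm_def)
      then show "AE z in \<Lambda>. summable (\<lambda>n. norm (c n z * of_real u ^ n))" by simp
      show "summable (\<lambda>n. LINT z|\<Lambda>. norm (c n z * of_real u ^ n))"
      proof (rule summable_comparison_test'[OF esummable])
        fix n :: nat
        have "(LINT z|\<Lambda>. norm (c n z * of_real u ^ n)) \<le> (LINT z|\<Lambda>. e n z)"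
          by (rule integral_mono[OF integrable_norm[OF cint] eint le])
        moreover have "0 \<le> (LINT z|\<Lambda>. norm (c n z * of_real u ^ n))"
          by (rule integral_nonneg_AE) simp
        ultimately show "norm (LINT z|\<Lambda>. norm (c n z * of_real u ^ n)) \<le> (LINT z|\<Lambda>. e n z)"
          by (simp only: real_norm_def abs_of_nonneg)
      qed
    qed
    also have "\<dots> = \<Psi> (of_real u)" by (simp add: \<Psi>_def a_def)
    finally show ?thesis by (simp add: ind_def)
  qed
  ultimately show ?thesis using that r by blast
qed

text \<open>The continued exponent \<open>P\<close> is continuous and vanishes at 0, so on a small
  disc Re P \<le> \<epsilon> and the continued characteristic function at time t is at most
  exp(\<epsilon> t) in norm. The disc depends on \<epsilon> but not on t, hence one constant
  \<open>K\<close> serves all times.\<close>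

lemma levy_even_moment:
  assumes lp: "levy_process M L" and lm: "levy_measure_of M L \<Lambda>" and "0 < \<theta>"
    and mexp: "(\<integral>\<^sup>+z\<in>- {-1<..<1}. ennreal (exp (\<theta> * \<bar>z\<bar>)) \<partial>\<Lambda>) < \<infinity>"
    and "0 < \<epsilon>"
  obtains K where "0 \<le> K" "\<And>t. 0 \<le> t \<Longrightarrow> (\<integral>\<^sup>+\<omega>. ennreal (L t \<omega> ^ (2 * m)) \<partial>M) \<le> ennreal (K * exp (\<epsilon> * t))"
proof -
  interpret prob_space M using lp by (simp add: levy_process_def)
  obtain \<gamma> \<sigma> where ch0: "\<forall>t\<ge>0. \<forall>\<theta>. char (distr M borel (L t)) \<theta> =
          exp (complex_of_real t *
            (\<i> * complex_of_real (\<gamma> * \<theta>) - complex_of_real (\<sigma>\<^sup>2 * \<theta>\<^sup>2 / 2)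
             + (CLINT z|\<Lambda>. iexp (\<theta> * z) - 1
                  - \<i> * complex_of_real (\<theta> * z * indicator {-1<..<1} z))))"
    and \<Lambda>: "sets \<Lambda> = sets borel" "(\<integral>\<^sup>+z. ennreal (min 1 (z\<^sup>2)) \<partial>\<Lambda>) < \<infinity>"
    using lm unfolding levy_measure_of_def by (elim conjE exE) (rule that)
  note ch = ch0[rule_format]
  obtain \<Psi> r where r: "0 < r" and hol: "\<Psi> holomorphic_on ball 0 r" and "\<Psi> 0 = 0"
    and \<Psi>: "\<And>u. \<bar>u\<bar> < r \<Longrightarrow> (CLINT z|\<Lambda>. iexp (u * z) - 1 - \<i> * complex_of_real (u * z * indicator {-1<..<1} z))
       = \<Psi> (complex_of_real u)"
    by (rule levy_exponent_holomorphic[OF \<Lambda> \<open>0 < \<theta>\<close> mexp], rule that)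
  define P where "P w = \<i> * \<gamma> * w - \<sigma>\<^sup>2 * w\<^sup>2 / 2 + \<Psi> w" for w :: complex
  have holP: "P holomorphic_on ball 0 r"
    unfolding P_def by (intro holomorphic_on_add holomorphic_on_diff hol) (intro holomorphic_intros, simp_all)+
  have "continuous_on (ball 0 r) P" by (rule holomorphic_on_imp_continuous_on[OF holP])
  then have "isCont P 0" using r continuous_on_eq_continuous_at[OF open_ball, of 0 r P] by simp
  have P0: "P 0 = 0" by (simp add: P_def \<open>\<Psi> 0 = 0\<close>)
  then have "P \<midarrow>0\<rightarrow> 0" using \<open>isCont P 0\<close> by (simp add: isCont_def)
  from LIM_D[OF this \<open>0 < \<epsilon>\<close>] obtain d where d: "0 < d" "\<And>w. w \<noteq> 0 \<Longrightarrow> norm w < d \<Longrightarrow> norm (P w) < \<epsilon>"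
    by (auto simp only: diff_zero)
  define s where "s = min r d"
  have s: "0 < s" "s \<le> r" "s \<le> d" using r d by (auto simp: s_def)
  define K where "K = fact (2 * m) / (s / 4) ^ (2 * m)"
  have "0 \<le> K" using s by (simp add: K_def)
  moreover have "(\<integral>\<^sup>+\<omega>. ennreal (L t \<omega> ^ (2 * m)) \<partial>M) \<le> ennreal (K * exp (\<epsilon> * t))" if t: "0 \<le> t" for t
  proof -
    have [measurable]: "L t \<in> borel_measurable M" using lp t by (simp add: levy_process_def)
    interpret D: real_distribution "distr M borel (L t)" by (rule real_distribution_distr) simp
    have "(\<integral>\<^sup>+\<omega>. ennreal (L t \<omega> ^ (2 * m)) \<partial>M) = (\<integral>\<^sup>+x. ennreal (x ^ (2 * m)) \<partial>distr M borel (L t))"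
      by (subst nn_integral_distr) auto
    also have "\<dots> \<le> ennreal (fact (2 * m) * exp (\<epsilon> * t) / (s / 4) ^ (2 * m))"
    proof (rule D.even_moment_le[where F = "\<lambda>w. exp (of_real t * P w)"])
      show "(\<lambda>w. exp (of_real t * P w)) holomorphic_on ball 0 s"
        by (intro holomorphic_intros holomorphic_on_subset[OF holP]) (use s in auto)
      show "norm (exp (of_real t * P z)) \<le> exp (\<epsilon> * t)" if "norm z < s" for z
      proof -
        have "Re (P z) \<le> \<epsilon>"
          using d(2)[of z] that s complex_Re_le_cmod[of "P z"] P0 \<open>0 < \<epsilon>\<close> by (cases "z = 0") auto
        then show ?thesis using t by (simp add: mult_left_mono mult.commute[of \<epsilon>])
      qed
      show "char (distr M borel (L t)) u = exp (of_real t * P (complex_of_real u))" if "\<bar>u\<bar> < s" for u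
      proof -
        have "\<bar>u\<bar> < r" using that s by simp
        then show ?thesis unfolding ch[OF t] P_def \<Psi>[OF \<open>\<bar>u\<bar> < r\<close>] by (simp add: mult.assoc)
      qed
    qed (use s in auto)
    also have "fact (2 * m) * exp (\<epsilon> * t) / (s / 4) ^ (2 * m) = K * exp (\<epsilon> * t)"
      by (simp only: K_def times_divide_eq_left)
    finally show ?thesis .
  qed
  ultimately show ?thesis using that by blast
qed

section \<open>Convex functions\<close>

text \<open>By convexity the difference quotients decrease as y falls to x, so they converge to
  their infimum over y > x, and the infimum is a subgradient. In particular the \<open>Lim\<close>
  in the definition of \<open>right_deriv\<close> is a genuine limit.\<close>

lemma right_deriv_tendsto_Inf:
  assumes f: "convex_on UNIV f"
  shows "((\<lambda>y. (f y - f x) / (y - x)) \<longlongrightarrow> right_deriv f x) (at_right x)"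
    and "f y \<ge> f x + right_deriv f x * (y - x)"
proof -
  define S where "S y = (f y - f x) / (y - x)" for y
  have flip: "(f x - f y) / (x - y) = S y" for y
    unfolding S_def by (subst minus_divide_divide[symmetric]) simp
  define m where "m = Inf (S ` {x<..})"
  have tangent: "f y \<ge> f x + m * (y - x)" for y
  proof -
    have "(\<lambda>t. (f x - f t) / (x - t)) ` ({x<..} \<inter> UNIV) = S ` {x<..}"
      by (simp add: flip)
    then show ?thesis
      using convex_le_Inf_differential[OF f, of x y] by (simp add: m_def)
  qed
  have m_le: "m \<le> S y" if "x < y" for y
    using tangent[of y] that by (simp add: S_def field_simps)
  have lim: "(S \<longlongrightarrow> m) (at_right x)"
  proof (rule order_tendstoI)
    fix a assume "a < m"
    then show "\<forall>\<^sub>F y in at_right x. a < S y"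
      unfolding eventually_at_right_field
      by (intro exI[of _ "x + 1"] conjI allI impI) (auto intro: less_le_trans[OF _ m_le])
  next
    fix a assume "m < a"
    then obtain y0 where y0: "x < y0" "S y0 < a"
      using cInf_lessD[of "S ` {x<..}" a] unfolding m_def by auto
    have "S y < a" if "x < y" "y < y0" for y
    proof -
      have "(f x - f y) / (x - y) \<le> (f x - f y0) / (x - y0)"
        using convex_on_slope_le(1)[OF f, of x y0 y] that by simp
      then have "S y \<le> S y0" by (simp only: flip)
      then show ?thesis using y0 by simp
    qed
    then show "\<forall>\<^sub>F y in at_right x. S y < a"
      using y0 by (auto simp: eventually_at_right_field)
  qed
  then have "right_deriv f x = m"
    unfolding right_deriv_def S_def[symmetric] by (intro tendsto_Lim) auto
  then show "((\<lambda>y. (f y - f x) / (y - x)) \<longlongrightarrow> right_deriv f x) (at_right x)"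
    and "f y \<ge> f x + right_deriv f x * (y - x)"
    using lim[unfolded S_def] tangent by simp_all
qed

text \<open>Add the subgradient inequalities at the two points.\<close>

lemma subgradient_mono:
  fixes f h :: "real \<Rightarrow> real"
  assumes "\<And>x y. f y \<ge> f x + h x * (y - x)"
  shows "mono h"
proof (rule monoI)
  fix x y :: real assume "x \<le> y"
  show "h x \<le> h y"
  proof (cases "x = y")
    case False
    then have "x < y" using \<open>x \<le> y\<close> by simp
    moreover have "h x * (y - x) \<le> h y * (y - x)"
      using assms[of x y] assms[of y x] by (simp add: algebra_simps)
    ultimately show ?thesis by simp
  qed simp
qed

lemma right_deriv_mono:
  assumes "convex_on UNIV f"
  shows "mono (right_deriv f)"
  using right_deriv_tendsto_Inf(2)[OF assms] by (rule subgradient_mono)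

text \<open>Monotonicity gives the lower estimate. For the upper one, fix y > x whose quotient from
  x is already below a: the quotient between z and y is continuous in z and dominates the right
  derivative at z.\<close>

lemma right_deriv_right_continuous:
  assumes f: "convex_on UNIV f"
  shows "(right_deriv f \<longlongrightarrow> right_deriv f x) (at_right x)"
proof (rule order_tendstoI)
  fix a assume "a < right_deriv f x"
  then show "\<forall>\<^sub>F y in at_right x. a < right_deriv f y"
    unfolding eventually_at_right_field
    by (intro exI[of _ "x + 1"] conjI allI impI)
       (auto intro: less_le_trans[OF _ monoD[OF right_deriv_mono[OF f]]])
next
  fix a assume "right_deriv f x < a"
  then have "\<forall>\<^sub>F y in at_right x. (f y - f x) / (y - x) < a"
    using right_deriv_tendsto_Inf(1)[OF f] by (rule order_tendstoD(2)[rotated])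
  then obtain c where c: "x < c" "\<And>y. x < y \<Longrightarrow> y < c \<Longrightarrow> (f y - f x) / (y - x) < a"
    unfolding eventually_at_right_field by auto
  obtain y where "x < y" "y < c" using dense[OF c(1)] by auto
  then have y: "x < y" "(f y - f x) / (y - x) < a" using c(2) by auto
  have "continuous_on UNIV f" by (rule convex_on_continuous[OF open_UNIV f])
  then have "isCont f x" by (simp add: continuous_on_eq_continuous_at)
  then have fr: "(f \<longlongrightarrow> f x) (at_right x)"
    unfolding isCont_def by (rule tendsto_within_subset) simp
  have "((\<lambda>z. (f y - f z) / (y - z)) \<longlongrightarrow> (f y - f x) / (y - x)) (at_right x)"
    using y fr by (intro tendsto_divide tendsto_diff tendsto_const tendsto_ident_at) auto
  then have "\<forall>\<^sub>F z in at_right x. (f y - f z) / (y - z) < a"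
    using y(2) by (rule order_tendstoD(2))
  moreover have "\<forall>\<^sub>F z in at_right x. z < y"
    using y by (auto simp: eventually_at_right_field)
  ultimately show "\<forall>\<^sub>F z in at_right x. right_deriv f z < a"
  proof eventually_elim
    case (elim z)
    have "right_deriv f z \<le> (f y - f z) / (y - z)"
      using right_deriv_tendsto_Inf(2)[OF f, of z y] elim by (simp add: field_simps)
    then show ?case using elim by simp
  qed
qed

text \<open>Monotonicity turns the limit at minus infinity into an infimum, and an infimum below a
  is witnessed by some value.\<close>

lemma right_deriv_neg_inf_less:
  assumes f: "convex_on UNIV f" and "right_deriv_neg_inf f < ereal a"
  obtains x where "right_deriv f x < a"
proof (rule ccontr)
  assume "\<not> thesis"
  then have ge: "a \<le> right_deriv f x" for x using that[of x] by linarith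
  have "((\<lambda>x. ereal (right_deriv f x)) \<longlongrightarrow> (INF x. ereal (right_deriv f x))) at_bot"
  proof (rule order_tendstoI)
    fix c assume "c < (INF x. ereal (right_deriv f x))"
    then show "\<forall>\<^sub>F x in at_bot. c < ereal (right_deriv f x)"
      by (intro always_eventually allI) (auto elim!: less_le_trans intro!: INF_lower)
  next
    fix c assume "(INF x. ereal (right_deriv f x)) < c"
    then obtain x0 where "ereal (right_deriv f x0) < c" by (auto simp: INF_less_iff)
    then show "\<forall>\<^sub>F x in at_bot. ereal (right_deriv f x) < c"
      unfolding eventually_at_bot_linorder
      by (intro exI[of _ x0] allI impI) (erule le_less_trans[rotated], simp add: monoD[OF right_deriv_mono[OF f]])
  qed
  then have "right_deriv_neg_inf f = (INF x. ereal (right_deriv f x))"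
    unfolding right_deriv_neg_inf_def by (intro tendsto_Lim) auto
  moreover have "ereal a \<le> (INF x. ereal (right_deriv f x))"
    using ge by (auto intro: INF_greatest)
  ultimately show False using assms(2) by simp
qed

lemma right_deriv_pos_inf_greater:
  assumes f: "convex_on UNIV f" and "ereal a < right_deriv_pos_inf f"
  obtains x where "a < right_deriv f x"
proof (rule ccontr)
  assume "\<not> thesis"
  then have le: "right_deriv f x \<le> a" for x using that[of x] by linarith
  have "((\<lambda>x. ereal (right_deriv f x)) \<longlongrightarrow> (SUP x. ereal (right_deriv f x))) at_top"
  proof (rule order_tendstoI)
    fix c assume "(SUP x. ereal (right_deriv f x)) < c"
    then show "\<forall>\<^sub>F x in at_top. ereal (right_deriv f x) < c"
      by (intro always_eventually allI) (auto elim!: le_less_trans[rotated] intro!: SUP_upper)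
  next
    fix c assume "c < (SUP x. ereal (right_deriv f x))"
    then obtain x0 where "c < ereal (right_deriv f x0)" by (auto simp: less_SUP_iff)
    then show "\<forall>\<^sub>F x in at_top. c < ereal (right_deriv f x)"
      unfolding eventually_at_top_linorder
      by (intro exI[of _ x0] allI impI) (erule less_le_trans, simp add: monoD[OF right_deriv_mono[OF f]])
  qed
  then have "right_deriv_pos_inf f = (SUP x. ereal (right_deriv f x))"
    unfolding right_deriv_pos_inf_def by (intro tendsto_Lim) auto
  moreover have "(SUP x. ereal (right_deriv f x)) \<le> ereal a"
    using le by (auto intro: SUP_least)
  ultimately show False using assms(2) by simp
qed

text \<open>For \<open>h = right_deriv f\<close> with f convex this is the left derivative. Monotone
  \<open>h\<close> need only be followed along one sequence, and a sequence suits dominated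
  convergence.\<close>

definition left_limit :: "(real \<Rightarrow> real) \<Rightarrow> real \<Rightarrow> real" where
  "left_limit h x = lim (\<lambda>n. h (x - 1 / Suc n))"

lemma left_limit_tendsto:
  assumes "mono h"
  shows "(\<lambda>n. h (x - 1 / Suc n)) \<longlonglongrightarrow> left_limit h x"
proof -
  have "incseq (\<lambda>n. h (x - 1 / Suc n))"
    by (intro monoI monoD[OF assms]) (simp add: frac_le)
  moreover have "\<forall>n. h (x - 1 / Suc n) \<le> h x"
    by (intro allI monoD[OF assms]) simp
  ultimately have "convergent (\<lambda>n. h (x - 1 / Suc n))"
    using incseq_convergent convergent_def by metis
  then show ?thesis
    unfolding left_limit_def by (simp add: convergent_LIMSEQ_iff)
qed

text \<open>The subgradient inequality at the points x - 1/n passes to the limit because f is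
  continuous.\<close>

lemma left_limit_subgradient:
  assumes f: "convex_on UNIV f" and h: "\<And>x y. f y \<ge> f x + h x * (y - x)"
  shows "f y \<ge> f x + left_limit h x * (y - x)"
proof -
  have "mono h" using h by (rule subgradient_mono)
  have "continuous_on UNIV f" by (rule convex_on_continuous[OF open_UNIV f])
  then have cont: "isCont f x" by (simp add: continuous_on_eq_continuous_at)
  have x: "(\<lambda>n. x - 1 / Suc n) \<longlonglongrightarrow> x"
    using tendsto_diff[OF tendsto_const LIMSEQ_inverse_real_of_nat, of x] by (simp add: inverse_eq_divide)
  have "(\<lambda>n. f (x - 1 / Suc n) + h (x - 1 / Suc n) * (y - (x - 1 / Suc n)))
      \<longlonglongrightarrow> f x + left_limit h x * (y - x)"
    by (intro tendsto_intros left_limit_tendsto \<open>mono h\<close> isCont_tendsto_compose[OF cont] x)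
  then show ?thesis
    by (rule LIMSEQ_le_const2) (use h in auto)
qed

section \<open>Barrier controls and arrival times\<close>

text \<open>The value \<open>c 0\<close> is ignored because arrivals are numbered from 1.\<close>

primrec rmax :: "(nat \<Rightarrow> real) \<Rightarrow> nat \<Rightarrow> real" where
  "rmax c 0 = 0"
| "rmax c (Suc n) = max (rmax c n) (c (Suc n))"

lemma rmax_nonneg: "0 \<le> rmax c n"
  by (induction n) auto

lemma rmax_mono: "m \<le> n \<Longrightarrow> rmax c m \<le> rmax c n"
  by (rule lift_Suc_mono_le[of "rmax c"]) auto

lemma rmax_ge: "1 \<le> k \<Longrightarrow> k \<le> n \<Longrightarrow> c k \<le> rmax c n"
  by (induction n) (auto simp: le_Suc_eq)

lemma Max_eq_rmax: "0 < n \<Longrightarrow> Max ((\<lambda>k. max (c k) 0) ` {1..n}) = rmax c n"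
proof (induction n)
  case (Suc n)
  show ?case
  proof (cases "n = 0")
    case True
    then show ?thesis by (simp add: max.commute)
  next
    case False
    have eq: "{1..Suc n} = insert (Suc n) {1..n}" by auto
    have "Max ((\<lambda>k. max (c k) 0) ` {1..Suc n}) = max (max (c (Suc n)) 0) (Max ((\<lambda>k. max (c k) 0) ` {1..n}))"
      unfolding eq image_insert using False by (subst Max_insert) auto
    also have "\<dots> = rmax c (Suc n)"
      using Suc.IH False rmax_nonneg[of c n] by auto
    finally show ?thesis .
  qed
qed simp

lemma rmax_cong: "(\<And>k. 1 \<le> k \<Longrightarrow> k \<le> n \<Longrightarrow> c k = d k) \<Longrightarrow> rmax c n = rmax d n"
  by (induction n) auto

text \<open>The restart identity: after k entries, only the excess over the maximum reached so far
  counts. It is the algebraic source of the flow property of barrier control.\<close>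

lemma rmax_add: "rmax c (k + j) = rmax c k + rmax (\<lambda>i. c (k + i) - rmax c k) j"
  by (induction j) auto

text \<open>Moving y inside the maximum gives max(y, b - w 1, ..., b - w n), which is nondecreasing
  in y.\<close>

lemma rmax_shift_mono:
  fixes y :: real
  assumes "y \<le> y'"
  shows "y + rmax (\<lambda>k. b - y - w k) n \<le> y' + rmax (\<lambda>k. b - y' - w k) n"
  using assms by (induction n) auto

lemma rmax_eq_sum: "rmax c n = (\<Sum>k\<in>{1..n}. rmax c k - rmax c (k - 1))"
proof (induction n)
  case (Suc n)
  then show ?case by (simp add: atLeastAtMostSuc_conv)
qed simp

text \<open>Trades the maximum for a sum over arrivals; a sum is again a control made of jumps and
  can be integrated jump by jump.\<close>

lemma rmax_power_le:
  assumes "even e" "0 < e"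
  shows "rmax c n ^ e \<le> (\<Sum>k\<in>{1..n}. c k ^ e)"
proof (induction n)
  case 0
  then show ?case using assms(2) by (simp only: rmax.simps zero_power) simp
next
  case (Suc n)
  have "max (rmax c n) (c (Suc n)) ^ e \<le> rmax c n ^ e + c (Suc n) ^ e"
    using assms(1) by (auto simp: max_def zero_le_even_power)
  with Suc show ?case by (simp add: atLeastAtMostSuc_conv)
qed

section \<open>The counting function of a sequence of arrival times\<close>

definition cnt :: "(nat \<Rightarrow> real) \<Rightarrow> real \<Rightarrow> nat" where
  "cnt \<tau> t = card {k. 1 \<le> k \<and> \<tau> k \<le> t}"

lemma counting_eq_cnt: "counting T t \<omega> = cnt (\<lambda>k. T k \<omega>) t"
  by (simp add: counting_def arrivals_def cnt_def)

locale arrival_times =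
  fixes \<tau> :: "nat \<Rightarrow> real"
  assumes zero: "\<tau> 0 = 0" and strict: "strict_mono \<tau>" and lim: "filterlim \<tau> at_top sequentially"
begin

lemma nonneg: "0 \<le> \<tau> k"
  using strict_mono_less_eq[OF strict, of 0 k] zero by simp

lemma pos: "1 \<le> k \<Longrightarrow> 0 < \<tau> k"
  using strict_monoD[OF strict, of 0 k] zero by simp

lemma finite_arrivals: "finite {k. 1 \<le> k \<and> \<tau> k \<le> t}"
proof -
  have "\<forall>\<^sub>F k in sequentially. t < \<tau> k"
    using lim by (simp add: filterlim_at_top_dense)
  then obtain N where "\<And>k. N \<le> k \<Longrightarrow> t < \<tau> k"
    by (auto simp: eventually_sequentially)
  then have "{k. 1 \<le> k \<and> \<tau> k \<le> t} \<subseteq> {..N}"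
    by (force simp: not_less[symmetric])
  then show ?thesis by (rule finite_subset) simp
qed

lemma arrivals_eq: "{k. 1 \<le> k \<and> \<tau> k \<le> t} = {1..cnt \<tau> t}"
proof -
  let ?A = "{k. 1 \<le> k \<and> \<tau> k \<le> t}"
  have "\<exists>n. ?A = {1..n}"
  proof (cases "?A = {}")
    case True
    then show ?thesis by (intro exI[of _ 0]) auto
  next
    case False
    have 1: "Max ?A \<in> ?A" by (rule Max_in[OF finite_arrivals False])
    have "?A = {1..Max ?A}"
    proof
      show "?A \<subseteq> {1..Max ?A}" using Max_ge[OF finite_arrivals] by auto
      show "{1..Max ?A} \<subseteq> ?A"
      proof
        fix k assume k: "k \<in> {1..Max ?A}"
        then have "\<tau> k \<le> \<tau> (Max ?A)" by (simp add: strict_mono_less_eq[OF strict])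
        also have "\<dots> \<le> t" using 1 by simp
        finally show "k \<in> ?A" using k by simp
      qed
    qed
    then show ?thesis ..
  qed
  then obtain n where n: "?A = {1..n}" ..
  then have "cnt \<tau> t = n" by (simp add: cnt_def)
  with n show ?thesis by simp
qed

lemma le_cnt_iff: "1 \<le> k \<Longrightarrow> k \<le> cnt \<tau> t \<longleftrightarrow> \<tau> k \<le> t"
  using arrivals_eq[of t] by (auto simp: set_eq_iff)

lemma cnt_bounds: "0 \<le> t \<Longrightarrow> \<tau> (cnt \<tau> t) \<le> t" "t < \<tau> (Suc (cnt \<tau> t))"
proof -
  show "\<tau> (cnt \<tau> t) \<le> t" if "0 \<le> t"
    using le_cnt_iff[of "cnt \<tau> t" t] zero that by (cases "cnt \<tau> t") auto
  show "t < \<tau> (Suc (cnt \<tau> t))"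
    using le_cnt_iff[of "Suc (cnt \<tau> t)" t] by simp
qed

lemma cnt_mono: "s \<le> t \<Longrightarrow> cnt \<tau> s \<le> cnt \<tau> t"
  using le_cnt_iff[of "cnt \<tau> s" s] le_cnt_iff[of "cnt \<tau> s" t] by (cases "cnt \<tau> s") auto

lemma cnt_eqI: "\<tau> n \<le> t \<Longrightarrow> t < \<tau> (Suc n) \<Longrightarrow> cnt \<tau> t = n"
  using le_cnt_iff[of n t] le_cnt_iff[of "Suc n" t] by (cases n) auto

lemma cnt_neg: "t < 0 \<Longrightarrow> cnt \<tau> t = 0"
  using le_cnt_iff[of "Suc 0" t] nonneg[of "Suc 0"] by (cases "cnt \<tau> t") auto

lemma cnt_eq_right:
  assumes "t \<le> s" "s < \<tau> (Suc (cnt \<tau> t))"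
  shows "cnt \<tau> s = cnt \<tau> t"
proof (rule antisym)
  show "cnt \<tau> t \<le> cnt \<tau> s" by (rule cnt_mono[OF assms(1)])
  show "cnt \<tau> s \<le> cnt \<tau> t"
    using le_cnt_iff[of "Suc (cnt \<tau> t)" s] assms(2) by linarith
qed

lemma cnt_arrival: "cnt \<tau> (\<tau> k) = k"
  by (rule cnt_eqI) (auto simp: strict_mono_less[OF strict])

lemma cnt_right_const: "0 \<le> t \<Longrightarrow> \<exists>d>0. \<forall>s. t \<le> s \<and> s < t + d \<longrightarrow> cnt \<tau> s = cnt \<tau> t"
  using cnt_bounds[of t]
  by (intro exI[of _ "\<tau> (Suc (cnt \<tau> t)) - t"]) (auto intro!: cnt_eqI)

lemma cnt_left_const: "0 < t \<Longrightarrow> \<exists>n. \<exists>d>0. \<forall>s. t - d < s \<and> s < t \<longrightarrow> cnt \<tau> s = n"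
proof -
  assume t: "0 < t"
  let ?n = "cnt \<tau> t"
  show ?thesis
  proof (cases "\<tau> ?n = t")
    case False
    then have "\<tau> ?n < t" using cnt_bounds(1)[of t] t by simp
    then show ?thesis
      using cnt_bounds(2)[of t] by (intro exI[of _ ?n] exI[of _ "t - \<tau> ?n"]) (auto intro!: cnt_eqI)
  next
    case True
    have "?n \<noteq> 0"
    proof
      assume "?n = 0"
      with True have "\<tau> 0 = t" by simp
      with zero t show False by simp
    qed
    then obtain m where m: "?n = Suc m" using not0_implies_Suc by blast
    have "\<tau> m < t" using strict_monoD[OF strict, of m ?n] True m by simp
    then show ?thesis
      using True m by (intro exI[of _ m] exI[of _ "t - \<tau> m"]) (auto intro!: cnt_eqI)
  qed
qed

lemma shift: "arrival_times (\<lambda>j. \<tau> (k + j) - \<tau> k)"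
proof
  show "strict_mono (\<lambda>j. \<tau> (k + j) - \<tau> k)"
    using strict by (auto simp: strict_mono_def)
  have "filterlim (\<lambda>j. \<tau> (j + k)) at_top sequentially"
    using lim by (rule filterlim_compose) (rule filterlim_add_const_nat_at_top)
  then have "filterlim (\<lambda>j. - \<tau> k + \<tau> (j + k)) at_top sequentially"
    by (rule filterlim_tendsto_add_at_top[OF tendsto_const])
  then show "filterlim (\<lambda>j. \<tau> (k + j) - \<tau> k) at_top sequentially"
    by (simp add: add.commute)
qed simp

lemma cnt_shift:
  assumes "0 \<le> s"
  shows "cnt \<tau> (\<tau> k + s) = k + cnt (\<lambda>j. \<tau> (k + j) - \<tau> k) s"
proof -
  interpret S: arrival_times "\<lambda>j. \<tau> (k + j) - \<tau> k" by (rule shift)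
  show ?thesis
    using S.cnt_bounds(1)[OF assms] S.cnt_bounds(2)[of s] by (intro cnt_eqI) auto
qed

end

lemma barrier_strategy_eq_rmax:
  "barrier_strategy L T b x t \<omega> = rmax (\<lambda>k. b - (x + L (T k \<omega>) \<omega>)) (cnt (\<lambda>k. T k \<omega>) t)"
  unfolding barrier_strategy_def counting_eq_cnt
  using Max_eq_rmax[of "cnt (\<lambda>k. T k \<omega>) t" "\<lambda>k. b - (x + L (T k \<omega>) \<omega>)"] by auto

section \<open>Discounted time as a finite measure\<close>

definition discounting :: "real \<Rightarrow> real measure" where
  "discounting q = density lborel (\<lambda>t. ennreal (indicator {0..} t * exp (- q * t)))"

lemma sets_discounting [simp, measurable_cong]: "sets (discounting q) = sets borel"
  by (simp add: discounting_def)

lemma space_discounting [simp]: "space (discounting q) = UNIV"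
  by (simp add: discounting_def)

lemma nn_integral_discounting:
  assumes [measurable]: "f \<in> borel_measurable borel"
  shows "(\<integral>\<^sup>+t. f t \<partial>discounting q) = (\<integral>\<^sup>+t\<in>{0..}. ennreal (exp (- q * t)) * f t \<partial>lborel)"
  unfolding discounting_def
  by (subst nn_integral_density) (auto intro!: nn_integral_cong simp: indicator_def)

lemma lintegral_discounting:
  fixes f :: "real \<Rightarrow> real"
  assumes [measurable]: "f \<in> borel_measurable borel"
  shows "(LINT t|discounting q. f t) = (LINT t:{0..}|lborel. exp (- q * t) * f t)"
  unfolding discounting_def set_lebesgue_integral_def
  by (subst integral_density) (auto simp: mult.assoc)

lemma AE_discounting: "AE t in discounting q. 0 \<le> t"
  unfolding discounting_def by (subst AE_density) (auto simp: indicator_def)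

lemma nn_integral_exp_Ici:
  assumes "0 < a"
  shows "(\<integral>\<^sup>+t\<in>{s..}. ennreal (a * exp (- a * t)) \<partial>lborel) = ennreal (exp (- a * s))"
proof -
  have "(\<integral>\<^sup>+t. ennreal (a * exp (- a * t)) * indicator {s..} t \<partial>lborel) = ennreal (0 - (- exp (- a * s)))"
  proof (rule nn_integral_FTC_atLeast)
    show "DERIV (\<lambda>t. - exp (- a * t)) t :> a * exp (- a * t)" for t
      by (auto intro!: derivative_eq_intros)
    have "((\<lambda>t. exp (- a * t)) \<longlongrightarrow> 0) at_top"
      using assms by real_asymp
    from tendsto_minus[OF this] show "((\<lambda>t. - exp (- a * t)) \<longlongrightarrow> 0) at_top" by simp
  qed (use assms in auto)
  then show ?thesis by simp
qed

lemma ennreal_exp_mult: "ennreal (exp a) * ennreal (exp b) = ennreal (exp (a + b))"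
  by (simp add: ennreal_mult' exp_add)

lemma emeasure_discounting_Ici:
  assumes "0 < q" "0 \<le> s"
  shows "(\<integral>\<^sup>+t. indicator {s..} t \<partial>discounting q) = ennreal (exp (- q * s) / q)"
proof -
  have "(\<integral>\<^sup>+t. indicator {s..} t \<partial>discounting q)
      = (\<integral>\<^sup>+t. ennreal (1 / q) * (ennreal (q * exp (- q * t)) * indicator {s..} t) \<partial>lborel)"
  proof (subst nn_integral_discounting)
    have "ennreal (exp (- q * t)) = ennreal (1 / q) * ennreal (q * exp (- q * t))" for t
      using assms by (simp add: ennreal_mult'[symmetric])
    then show "(\<integral>\<^sup>+t\<in>{0..}. ennreal (exp (- q * t)) * indicator {s..} t \<partial>lborel)
      = (\<integral>\<^sup>+t. ennreal (1 / q) * (ennreal (q * exp (- q * t)) * indicator {s..} t) \<partial>lborel)"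
      using assms by (intro nn_integral_cong) (auto simp: indicator_def)
  qed measurable
  also have "\<dots> = ennreal (1 / q) * ennreal (exp (- q * s))"
    using nn_integral_exp_Ici[OF assms(1), of s] by (subst nn_integral_cmult) auto
  finally show ?thesis using assms by (simp add: ennreal_mult'[symmetric])
qed

lemma nn_integral_discounting_exp:
  assumes "a < q"
  shows "(\<integral>\<^sup>+t. ennreal (exp (a * t)) \<partial>discounting q) = ennreal (1 / (q - a))"
proof -
  have "(\<integral>\<^sup>+t. ennreal (exp (a * t)) \<partial>discounting q)
      = (\<integral>\<^sup>+t. indicator {0..} t \<partial>discounting (q - a))"
  proof -
    have "ennreal (exp (- q * t)) * ennreal (exp (a * t)) = ennreal (exp (- (q - a) * t)) * 1" for t
      unfolding ennreal_exp_mult by (simp add: left_diff_distrib)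
    then show ?thesis
      by (subst nn_integral_discounting, measurable, subst nn_integral_discounting, measurable)
         (auto intro!: nn_integral_cong simp: indicator_def)
  qed
  then show ?thesis using assms by (subst (asm) emeasure_discounting_Ici) auto
qed

lemma finite_measure_discounting: "0 < q \<Longrightarrow> finite_measure (discounting q)"
  using nn_integral_discounting_exp[of 0 q] by (intro finite_measureI) auto

text \<open>The exponential discount is memoryless: restarting the clock at s costs exactly the
  factor exp(-q s).\<close>

lemma nn_integral_discounting_shift:
  assumes [measurable]: "f \<in> borel_measurable borel" and "0 \<le> s"
  shows "(\<integral>\<^sup>+t. f t * indicator {s..} t \<partial>discounting q)
    = ennreal (exp (- q * s)) * (\<integral>\<^sup>+t. f (s + t) \<partial>discounting q)"
proof -
  have "(\<integral>\<^sup>+t. f t * indicator {s..} t \<partial>discounting q)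
      = (\<integral>\<^sup>+t. ennreal (exp (- q * t)) * (f t * indicator {s..} t) * indicator {0..} t \<partial>lborel)"
    by (rule nn_integral_discounting) measurable
  also have "\<dots> = (\<integral>\<^sup>+t. ennreal (exp (- q * (s + t))) * (f (s + t) * indicator {s..} (s + t)) * indicator {0..} (s + t) \<partial>lborel)"
    by (subst nn_integral_real_affine[where c = 1 and t = s]) auto
  also have "\<dots> = (\<integral>\<^sup>+t. ennreal (exp (- q * s)) * (ennreal (exp (- q * t)) * f (s + t) * indicator {0..} t) \<partial>lborel)"
  proof (rule nn_integral_cong)
    fix t
    have "ennreal (exp (- q * (s + t))) = ennreal (exp (- q * s)) * ennreal (exp (- q * t))"
      unfolding ennreal_exp_mult by (simp add: distrib_left)
    then show "ennreal (exp (- q * (s + t))) * (f (s + t) * indicator {s..} (s + t)) * indicator {0..} (s + t)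
      = ennreal (exp (- q * s)) * (ennreal (exp (- q * t)) * f (s + t) * indicator {0..} t)"
      using \<open>0 \<le> s\<close> by (simp only:) (auto simp: indicator_def mult.assoc)
  qed
  also have "\<dots> = ennreal (exp (- q * s)) * (\<integral>\<^sup>+t. f (s + t) \<partial>discounting q)"
    by (subst nn_integral_cmult, measurable, subst nn_integral_discounting) auto
  finally show ?thesis .
qed

text \<open>Write exp(-q t) as the integral of q exp(-q s) over s \<ge> t and exchange the
  integrals; the inner one becomes the mass of [0, s], which is F s. This makes control costs linear
  in R dt.\<close>

lemma nn_integral_exp_interval_measure:
  fixes F :: "real \<Rightarrow> real"
  assumes q: "0 < q" and F0: "\<And>t. t < 0 \<Longrightarrow> F t = 0" and mono: "\<And>s t. s \<le> t \<Longrightarrow> F s \<le> F t"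
    and rc: "\<And>t. continuous (at_right t) F"
  shows "(\<integral>\<^sup>+t\<in>{0..}. ennreal (exp (- q * t)) \<partial>interval_measure F) = (\<integral>\<^sup>+t. ennreal (q * F t) \<partial>discounting q)"
proof -
  let ?m = "interval_measure F"
  interpret sigma_finite_measure ?m by (rule sigma_finite_interval_measure) (use mono rc in auto)
  interpret pair_sigma_finite ?m lborel ..
  have Fnn: "0 \<le> F t" for t
    using mono[of "min t (-1)" t] F0[of "min t (-1)"] by simp
  have [measurable]: "F \<in> borel_measurable borel"
    using mono by (intro borel_measurable_mono) (auto simp: mono_def)
  \<comment> \<open>Interval measures are evaluated on half-open intervals. Removing the null set
    (-1, 0) from (-1, s] leaves [0, s] and keeps a possible atom at 0.\<close>
  have neg: "emeasure ?m {-1<..<0} = 0"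
  proof -
    have "{-1<..<0} = (\<Union>n. {-1<..- 1 / Suc n} :: real set)"
    proof (intro set_eqI iffI)
      fix x :: real assume x: "x \<in> {-1<..<0}"
      then obtain n where "inverse (real (Suc n)) < - x" using reals_Archimedean[of "- x"] by auto
      then show "x \<in> (\<Union>n. {-1<..- 1 / Suc n})"
        using x by (auto simp: inverse_eq_divide intro!: exI[of _ n])
    next
      fix x :: real assume "x \<in> (\<Union>n. {-1<..- 1 / Suc n})"
      then obtain n where n: "-1 < x" "x \<le> - 1 / Suc n" by auto
      have "- 1 / real (Suc n) < 0" by (simp add: divide_neg_pos)
      from le_less_trans[OF n(2) this] show "x \<in> {-1<..<0}" using n(1) by simp
    qed
    moreover have "emeasure ?m {-1<..- 1 / Suc n} = 0" for n
      by (subst emeasure_interval_measure_Ioc_eq) (use mono rc F0 in \<open>auto simp: divide_neg_pos\<close>)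
    ultimately show ?thesis by (simp only:) (rule emeasure_UN_eq_0, auto)
  qed
  have Icc: "emeasure ?m {0..s} = ennreal (F s)" if "0 \<le> s" for s
  proof -
    have "{-1<..s} = {-1<..<0} \<union> {0..s}" using that by auto
    then have "emeasure ?m {-1<..s} = emeasure ?m {-1<..<0} + emeasure ?m {0..s}"
      by (simp add: plus_emeasure[symmetric] disjoint_iff)
    moreover have "emeasure ?m {-1<..s} = ennreal (F s)"
      using that F0[of "-1"] by (subst emeasure_interval_measure_Ioc_eq) (use mono rc in auto)
    ultimately show ?thesis by (simp add: neg)
  qed
  have "(\<integral>\<^sup>+t\<in>{0..}. ennreal (exp (- q * t)) \<partial>?m)
      = (\<integral>\<^sup>+t. (\<integral>\<^sup>+s. ennreal (q * exp (- q * s)) * (indicator {t..} s * indicator {0..} t) \<partial>lborel) \<partial>?m)"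
  proof (rule nn_integral_cong)
    fix t
    show "ennreal (exp (- q * t)) * indicator {0..} t
        = (\<integral>\<^sup>+s. ennreal (q * exp (- q * s)) * (indicator {t..} s * indicator {0..} t) \<partial>lborel)"
      unfolding mult.assoc[symmetric]
      by (subst nn_integral_multc, measurable, subst nn_integral_exp_Ici[OF q]) simp
  qed
  also have "\<dots> = (\<integral>\<^sup>+s. (\<integral>\<^sup>+t. ennreal (q * exp (- q * s)) * (indicator {t..} s * indicator {0..} t) \<partial>?m) \<partial>lborel)"
  proof (rule Fubini'[symmetric])
    have "(\<lambda>(t, s). ennreal (q * exp (- q * s)) * (indicator {t..} s * indicator {0..} t))
        = (\<lambda>p. ennreal (q * exp (- q * snd p)) * (indicator {p. fst p \<le> snd p} p * indicator {0..} (fst p)))"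
      by (auto simp: indicator_def)
    also have "\<dots> \<in> borel_measurable (borel \<Otimes>\<^sub>M borel)" by measurable
    finally show "(\<lambda>(t, s). ennreal (q * exp (- q * s)) * (indicator {t..} s * indicator {0..} t))
      \<in> borel_measurable (?m \<Otimes>\<^sub>M lborel)"
      by (simp cong: measurable_cong_sets)
  qed
  also have "\<dots> = (\<integral>\<^sup>+s. ennreal (exp (- q * s)) * ennreal (q * F s) * indicator {0..} s \<partial>lborel)"
  proof (rule nn_integral_cong)
    fix s
    have "(\<integral>\<^sup>+t. ennreal (q * exp (- q * s)) * (indicator {t..} s * indicator {0..} t) \<partial>?m)
        = (\<integral>\<^sup>+t. ennreal (q * exp (- q * s)) * indicator {0..s} t \<partial>?m)"
      by (intro nn_integral_cong) (auto simp: indicator_def)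
    also have "\<dots> = ennreal (q * exp (- q * s)) * emeasure ?m {0..s}"
      by (simp add: nn_integral_cmult)
    also have "\<dots> = ennreal (exp (- q * s)) * ennreal (q * F s) * indicator {0..} s"
    proof (cases "0 \<le> s")
      case True
      have "ennreal (q * exp (- q * s)) * ennreal (F s) = ennreal (exp (- q * s)) * ennreal (q * F s)"
        using q Fnn[of s] by (subst (1 2) ennreal_mult'[symmetric]) (auto simp: mult_ac)
      then show ?thesis using True Icc[of s] by simp
    qed simp
    finally show "(\<integral>\<^sup>+t. ennreal (q * exp (- q * s)) * (indicator {t..} s * indicator {0..} t) \<partial>?m) = \<dots>" .
  qed
  also have "\<dots> = (\<integral>\<^sup>+t. ennreal (q * F t) \<partial>discounting q)"
    by (rule nn_integral_discounting[symmetric]) measurable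
  finally show ?thesis .
qed

section \<open>The Markov property of Levy processes\<close>

definition right_grid :: "nat \<Rightarrow> real \<Rightarrow> real" where
  "right_grid n t = real_of_int (max 0 \<lfloor>real (Suc n) * max 0 t\<rfloor> + 1) / real (Suc n)"

lemma right_grid_bounds: "max 0 t < right_grid n t" "right_grid n t \<le> max 0 t + 1 / Suc n"
proof -
  have "0 \<le> Suc n * max 0 t" by simp
  then have eq: "max 0 \<lfloor>Suc n * max 0 t\<rfloor> = \<lfloor>Suc n * max 0 t\<rfloor>" by (intro max_absorb2) simp
  have 1: "max 0 t * Suc n < real_of_int (\<lfloor>Suc n * max 0 t\<rfloor> + 1)"
    by (simp only: mult.commute[of "max 0 t"]) linarith
  have 2: "real_of_int (\<lfloor>Suc n * max 0 t\<rfloor> + 1) \<le> Suc n * max 0 t + 1"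
    by linarith
  show "max 0 t < right_grid n t"
    unfolding right_grid_def eq by (subst pos_less_divide_eq) (simp, rule 1)
  have "right_grid n t \<le> (Suc n * max 0 t + 1) / Suc n"
    unfolding right_grid_def eq by (rule divide_right_mono[OF 2]) simp
  also have "\<dots> = max 0 t + 1 / Suc n"
    by (subst add_divide_distrib) simp
  finally show "right_grid n t \<le> max 0 t + 1 / Suc n" .
qed

lemma right_grid_filterlim: "filterlim (\<lambda>n. right_grid n t) (at_right (max 0 t)) sequentially"
  unfolding filterlim_at
proof
  show "\<forall>\<^sub>F n in sequentially. right_grid n t \<in> {max 0 t<..} \<and> right_grid n t \<noteq> max 0 t"
    using right_grid_bounds(1)[of t] by (intro always_eventually allI) (metis greaterThan_iff less_irrefl)
  have upper: "(\<lambda>n. max 0 t + 1 / Suc n) \<longlonglongrightarrow> max 0 t"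
    using tendsto_add[OF tendsto_const LIMSEQ_inverse_real_of_nat, of "max 0 t"] by (simp add: inverse_eq_divide)
  show "(\<lambda>n. right_grid n t) \<longlonglongrightarrow> max 0 t"
    by (rule tendsto_sandwich[OF always_eventually always_eventually tendsto_const upper])
       (simp_all only: less_imp_le[OF right_grid_bounds(1)] right_grid_bounds(2) simp_thms)
qed

lemma measurable_right_grid:
  assumes "\<And>t. 0 \<le> t \<Longrightarrow> X t \<in> measurable N K" and [measurable]: "\<tau> \<in> borel_measurable N"
  shows "(\<lambda>p. X (right_grid n (\<tau> p)) p) \<in> measurable N K"
proof -
  have "X (real_of_int (max 0 i + 1) / Suc n) \<in> measurable N K" for i
    by (rule assms) simp
  moreover have "(\<lambda>p. \<lfloor>Suc n * max 0 (\<tau> p)\<rfloor>) \<in> measurable N (count_space UNIV)"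
    by measurable
  ultimately show ?thesis
    unfolding right_grid_def by (rule measurable_compose_countable)
qed

text \<open>Sampling at \<open>right_grid\<close> takes countably many times, so it is measurable
  piecewise; the grid points lie strictly to the right of the time, so right-continuity alone gives
  convergence.\<close>

lemma right_continuous_joint_measurable:
  fixes X :: "real \<Rightarrow> 'a \<Rightarrow> real"
  assumes X: "\<And>t. 0 \<le> t \<Longrightarrow> X t \<in> borel_measurable N"
    and rc: "\<And>\<omega> t. \<omega> \<in> space N \<Longrightarrow> 0 \<le> t \<Longrightarrow> ((\<lambda>s. X s \<omega>) \<longlongrightarrow> X t \<omega>) (at_right t)"
  shows "(\<lambda>p. X (max 0 (fst p)) (snd p)) \<in> borel_measurable (borel \<Otimes>\<^sub>M N)"
proof (rule borel_measurable_LIMSEQ_real)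
  fix p :: "real \<times> 'a" assume "p \<in> space (borel \<Otimes>\<^sub>M N)"
  then have "snd p \<in> space N" by (auto simp: space_pair_measure)
  from filterlim_compose[OF rc[OF this] right_grid_filterlim]
  show "(\<lambda>n. X (right_grid n (fst p)) (snd p)) \<longlonglongrightarrow> X (max 0 (fst p)) (snd p)" by simp
next
  fix n :: nat
  have "(\<lambda>p. X t (snd p)) \<in> borel_measurable (borel \<Otimes>\<^sub>M N)" if "0 \<le> t" for t
    by (rule measurable_compose[OF measurable_snd X[OF that]])
  then show "(\<lambda>p. X (right_grid n (fst p)) (snd p)) \<in> borel_measurable (borel \<Otimes>\<^sub>M N)"
    by (rule measurable_right_grid[OF _ measurable_fst])
qed

lemma finite_set_grid:
  fixes F :: "real set"
  assumes "finite F" "F \<noteq> {}"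
  obtains n :: nat and t :: "nat \<Rightarrow> real" where "\<And>i j. i < j \<Longrightarrow> j \<le> n \<Longrightarrow> t i < t j" "t ` {..n} = F"
proof
  let ?xs = "sorted_list_of_set F"
  have len: "0 < length ?xs" using assms by (auto simp: length_sorted_list_of_set card_gt_0_iff)
  show "?xs ! i < ?xs ! j" if "i < j" "j \<le> length ?xs - 1" for i j
    by (rule sorted_wrt_nth_less[OF strict_sorted_list_of_set that(1)]) (use that len in linarith)
  have "{..length ?xs - 1} = {..<length ?xs}" using len by auto
  then show "(!) ?xs ` {..length ?xs - 1} = F"
    using set_sorted_list_of_set[OF assms(1)] by (auto simp: set_conv_nth simp del: set_sorted_list_of_set)
qed

text \<open>Path values on a grid are partial sums of increments, so cylinder events of paths pull
  back to sets of this form.\<close>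

lemma partial_sums_in_sets_PiM:
  assumes "finite J" "\<And>r. r \<in> J \<Longrightarrow> I r \<subseteq> A" "\<And>r. r \<in> J \<Longrightarrow> B r \<in> sets borel"
  shows "{d \<in> space (PiM A (\<lambda>_. borel)). \<forall>r\<in>J. (\<Sum>i\<in>I r. d i :: real) \<in> B r} \<in> sets (PiM A (\<lambda>_. borel))"
proof (rule sets.sets_Collect_finite_All[OF _ \<open>finite J\<close>])
  fix r assume r: "r \<in> J"
  have "(\<lambda>d. \<Sum>i\<in>I r. d i :: real) \<in> borel_measurable (PiM A (\<lambda>_. borel))"
    using assms(2)[OF r] by (intro borel_measurable_sum measurable_component_singleton) auto
  then show "{d \<in> space (PiM A (\<lambda>_. borel)). (\<Sum>i\<in>I r. d i) \<in> B r} \<in> sets (PiM A (\<lambda>_. borel))"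
    using assms(3)[OF r] unfolding pred_def[symmetric] by (rule pred_sets2[rotated])
qed

section \<open>The Levy path before and after a fixed time\<close>

abbreviation path_space :: "(real \<Rightarrow> real) measure" where
  "path_space \<equiv> PiM {0..} (\<lambda>_. borel)"

locale levy = prob_space M for M :: "'a measure" +
  fixes L :: "real \<Rightarrow> 'a \<Rightarrow> real"
  assumes levy: "levy_process M L"
begin

lemma L_measurable [measurable]: "0 \<le> t \<Longrightarrow> L t \<in> borel_measurable M"
  using levy by (simp add: levy_process_def)

lemma L_zero: "\<omega> \<in> space M \<Longrightarrow> L 0 \<omega> = 0"
  using levy by (simp add: levy_process_def)

lemma L_right: "\<omega> \<in> space M \<Longrightarrow> 0 \<le> t \<Longrightarrow> ((\<lambda>s. L s \<omega>) \<longlongrightarrow> L t \<omega>) (at_right t)"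
  using levy by (simp add: levy_process_def cadlag_def)

lemma L_left: "\<omega> \<in> space M \<Longrightarrow> 0 < t \<Longrightarrow> \<exists>l. ((\<lambda>s. L s \<omega>) \<longlongrightarrow> l) (at_left t)"
  using levy by (simp add: levy_process_def cadlag_def)

lemma indep_increments:
  fixes n :: nat
  assumes "0 \<le> t 0" "\<And>i. i < n \<Longrightarrow> t i \<le> t (Suc i)"
  shows "indep_vars (\<lambda>_. borel) (\<lambda>i \<omega>. L (t (Suc i)) \<omega> - L (t i) \<omega>) {..<n}"
proof -
  have "\<forall>(n::nat) t. 0 \<le> t 0 \<and> (\<forall>i<n. t i \<le> t (Suc i)) \<longrightarrow>
        indep_vars (\<lambda>_. borel) (\<lambda>i \<omega>. L (t (Suc i)) \<omega> - L (t i) \<omega>) {..<n}"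
    using levy unfolding levy_process_def by (elim conjE)
  with assms show ?thesis by simp
qed

lemma stationary: "0 \<le> s \<Longrightarrow> 0 \<le> h \<Longrightarrow> distr M borel (\<lambda>\<omega>. L (s + h) \<omega> - L s \<omega>) = distr M borel (L h)"
  using levy by (simp add: levy_process_def)

definition path :: "'a \<Rightarrow> real \<Rightarrow> real" where
  "path \<omega> = (\<lambda>t\<in>{0..}. L t \<omega>)"

text \<open>The parameter \<open>s\<close> will be an arrival time, which as a coordinate of the sequence space may be
  negative; hence the truncation at 0.\<close>

definition pre :: "real \<Rightarrow> 'a \<Rightarrow> real \<Rightarrow> real" where
  "pre s \<omega> = (\<lambda>r\<in>{0..}. L (min r (max 0 s)) \<omega>)"

definition post :: "real \<Rightarrow> 'a \<Rightarrow> real \<Rightarrow> real" where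
  "post s \<omega> = (\<lambda>r\<in>{0..}. L (max 0 s + r) \<omega> - L (max 0 s) \<omega>)"

lemma path_measurable [measurable]: "path \<in> measurable M path_space"
  unfolding path_def by (rule measurable_restrict) simp

lemma pre_measurable [measurable]: "pre s \<in> measurable M path_space"
  unfolding pre_def by (rule measurable_restrict) simp

lemma post_measurable [measurable]: "post s \<in> measurable M path_space"
  unfolding post_def by (rule measurable_restrict) simp

lemma telescope: "j \<le> k \<Longrightarrow> (\<Sum>i=j..<k. L (t (Suc i)) \<omega> - L (t i) \<omega>) = L (t k) \<omega> - L (t j) \<omega>"
  by (rule sum_Suc_diff')

text \<open>Cylinder events determine the law. On a grid through the relevant times, the increments
  after any u are independent and their laws depend only on the spacing, so the event has the same
  probability for every u, in particular for u = 0.\<close>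

lemma distr_post: "distr M path_space (post s) = distr M path_space path"
proof (rule measure_eqI_PiM_infinite)
  fix A J assume J: "finite J" "J \<subseteq> {0::real..}" and A: "\<And>i. i \<in> J \<Longrightarrow> A i \<in> sets (borel :: real measure)"
  \<comment> \<open>The point 0 is the base of the telescoping sums; the point 1 guarantees at least
    one increment, so that the product of laws is over a nonempty index set.\<close>
  obtain n :: nat and t :: "nat \<Rightarrow> real" where mono: "\<And>i j. i < j \<Longrightarrow> j \<le> n \<Longrightarrow> t i < t j" and F: "t ` {..n} = {0,1} \<union> J"
    by (rule finite_set_grid[of "{0,1} \<union> J"]) (use J in auto)
  have t_nonneg: "0 \<le> t i" if "i \<le> n" for i
  proof -
    have "t i \<in> {0,1} \<union> J" using that F by blast
    then show ?thesis using J by auto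
  qed
  have t0: "t 0 = 0"
  proof -
    obtain i where i: "i \<le> n" "t i = 0" using F by (metis Un_iff atMost_iff imageE insertI1)
    show ?thesis
    proof (cases "i = 0")
      case False
      then have "t 0 < 0" using mono[of 0 i] i by simp
      then show ?thesis using t_nonneg[of 0] by simp
    qed (use i in simp)
  qed
  have n: "0 < n"
  proof (rule ccontr)
    assume "\<not> 0 < n"
    moreover have "1 \<in> t ` {..n}" using F by blast
    ultimately show False using t0 by simp
  qed
  have "\<exists>i\<le>n. t i = r" if "r \<in> J" for r using F that by (metis Un_iff atMost_iff imageE)
  then obtain idx where idx: "\<And>r. r \<in> J \<Longrightarrow> idx r \<le> n" "\<And>r. r \<in> J \<Longrightarrow> t (idx r) = r" by metis
  define S where "S = {d \<in> space (PiM {..<n} (\<lambda>_. borel)). \<forall>r\<in>J. (\<Sum>i=0..<idx r. d i :: real) \<in> A r}"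
  have "{0..<idx r} \<subseteq> {..<n}" if "r \<in> J" for r using idx(1)[OF that] by auto
  then have S: "S \<in> sets (PiM {..<n} (\<lambda>_. borel))"
    unfolding S_def using J(1) A by (intro partial_sums_in_sets_PiM)
  define E where "E = prod_emb {0..} (\<lambda>_. borel) J (Pi\<^sub>E J A)"
  have E: "E \<in> sets path_space" unfolding E_def by (rule sets_PiM_I) (use J A in auto)
  have vec: "distr M (PiM {..<n} (\<lambda>_. borel)) (\<lambda>\<omega>. \<lambda>i\<in>{..<n}. L (u + t (Suc i)) \<omega> - L (u + t i) \<omega>)
    = PiM {..<n} (\<lambda>i. distr M borel (L (t (Suc i) - t i)))" if u: "0 \<le> u" for u
  proof -
    have "indep_vars (\<lambda>_. borel) (\<lambda>i \<omega>. L (u + t (Suc i)) \<omega> - L (u + t i) \<omega>) {..<n}"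
      using indep_increments[of "\<lambda>i. u + t i" n] u t0 mono by (simp add: less_imp_le)
    then have "distr M (PiM {..<n} (\<lambda>_. borel)) (\<lambda>\<omega>. \<lambda>i\<in>{..<n}. L (u + t (Suc i)) \<omega> - L (u + t i) \<omega>)
      = PiM {..<n} (\<lambda>i. distr M borel (\<lambda>\<omega>. L (u + t (Suc i)) \<omega> - L (u + t i) \<omega>))"
      using n u t_nonneg by (subst (asm) indep_vars_iff_distr_eq_PiM') auto
    also have "\<dots> = PiM {..<n} (\<lambda>i. distr M borel (L (t (Suc i) - t i)))"
    proof (rule PiM_cong[OF refl])
      fix i assume "i \<in> {..<n}"
      then show "distr M borel (\<lambda>\<omega>. L (u + t (Suc i)) \<omega> - L (u + t i) \<omega>) = distr M borel (L (t (Suc i) - t i))"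
        using stationary[of "u + t i" "t (Suc i) - t i"] u t_nonneg[of i] mono[of i "Suc i"] by simp
    qed
    finally show ?thesis .
  qed
  have key: "emeasure M {\<omega> \<in> space M. \<forall>r\<in>J. L (u + r) \<omega> - L u \<omega> \<in> A r}
      = emeasure (PiM {..<n} (\<lambda>i. distr M borel (L (t (Suc i) - t i)))) S" if u: "0 \<le> u" for u
  proof -
    have "{\<omega> \<in> space M. \<forall>r\<in>J. L (u + r) \<omega> - L u \<omega> \<in> A r}
      = (\<lambda>\<omega>. \<lambda>i\<in>{..<n}. L (u + t (Suc i)) \<omega> - L (u + t i) \<omega>) -` S \<inter> space M"
    proof -
      have "(\<Sum>i=0..<idx r. (\<lambda>i\<in>{..<n}. L (u + t (Suc i)) \<omega> - L (u + t i) \<omega>) i) = L (u + r) \<omega> - L u \<omega>"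
        if "r \<in> J" for r \<omega>
      proof -
        have "(\<Sum>i=0..<idx r. (\<lambda>i\<in>{..<n}. L (u + t (Suc i)) \<omega> - L (u + t i) \<omega>) i)
          = (\<Sum>i=0..<idx r. L (u + t (Suc i)) \<omega> - L (u + t i) \<omega>)"
          using idx(1)[OF that] by (intro sum.cong) auto
        also have "\<dots> = L (u + r) \<omega> - L u \<omega>"
          using telescope[of 0 "idx r" "\<lambda>i. u + t i" \<omega>] idx(2)[OF that] t0 by simp
        finally show ?thesis .
      qed
      then show ?thesis by (auto simp: S_def space_PiM)
    qed
    then show ?thesis
      unfolding vec[OF u, symmetric]
      using u t_nonneg S by (subst emeasure_distr) auto
  qed
  have "post s -` E \<inter> space M = {\<omega> \<in> space M. \<forall>r\<in>J. L (max 0 s + r) \<omega> - L (max 0 s) \<omega> \<in> A r}"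
    using J unfolding E_def prod_emb_def post_def by (auto simp: PiE_iff subset_iff)
  moreover have "path -` E \<inter> space M = {\<omega> \<in> space M. \<forall>r\<in>J. L (0 + r) \<omega> - L 0 \<omega> \<in> A r}"
    using J unfolding E_def prod_emb_def path_def by (auto simp: PiE_iff subset_iff L_zero)
  ultimately show "emeasure (distr M path_space (post s)) (prod_emb {0..} (\<lambda>_. borel) J (Pi\<^sub>E J A))
      = emeasure (distr M path_space path) (prod_emb {0..} (\<lambda>_. borel) J (Pi\<^sub>E J A))"
    unfolding E_def[symmetric] using E by (simp add: emeasure_distr key del: add_0)
qed (simp_all add: finite_measure_distr)

text \<open>On a common grid containing s, the stopped values are sums of increments before s and
  the shifted values are sums of increments after s: two disjoint blocks of independent
  variables.\<close>

lemma indep_pre_post_cylinder: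
  assumes s: "0 \<le> s" and J: "finite J" "J \<subseteq> {0::real..}" "\<And>r. r \<in> J \<Longrightarrow> A r \<in> sets borel"
    and K: "finite K" "K \<subseteq> {0::real..}" "\<And>r. r \<in> K \<Longrightarrow> B r \<in> sets borel"
  shows "prob ({\<omega> \<in> space M. \<forall>r\<in>J. L (min r s) \<omega> \<in> A r} \<inter> {\<omega> \<in> space M. \<forall>r\<in>K. L (s + r) \<omega> - L s \<omega> \<in> B r})
    = prob {\<omega> \<in> space M. \<forall>r\<in>J. L (min r s) \<omega> \<in> A r} * prob {\<omega> \<in> space M. \<forall>r\<in>K. L (s + r) \<omega> - L s \<omega> \<in> B r}"
proof -
  define F where "F = {0, s} \<union> (\<lambda>r. min r s) ` J \<union> (\<lambda>r. s + r) ` K"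
  obtain n :: nat and t :: "nat \<Rightarrow> real" where mono: "\<And>i j. i < j \<Longrightarrow> j \<le> n \<Longrightarrow> t i < t j" and F: "t ` {..n} = F"
    by (rule finite_set_grid[of F]) (use J K in \<open>auto simp: F_def\<close>)
  have t_nonneg: "0 \<le> t i" if "i \<le> n" for i
  proof -
    have "t i \<in> F" using that F by blast
    then show ?thesis using J K s by (auto simp: F_def subset_iff)
  qed
  have in_F: "\<exists>i\<le>n. t i = r" if "r \<in> F" for r using F that by (metis atMost_iff imageE)
  have le_iff: "t i \<le> t j \<longleftrightarrow> i \<le> j" if "i \<le> n" "j \<le> n" for i j
    using mono[of i j] mono[of j i] that by (cases i j rule: linorder_cases) auto
  have t0: "t 0 = 0"
  proof -
    obtain i where i: "i \<le> n" "t i = 0" using in_F[of 0] by (auto simp: F_def)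
    then have "t 0 \<le> t i" using le_iff[of 0 i] by simp
    then show ?thesis using t_nonneg[of 0] i by simp
  qed
  obtain m where m: "m \<le> n" "t m = s" using in_F[of s] by (auto simp: F_def)
  have "\<exists>i\<le>m. t i = min r s" if "r \<in> J" for r
  proof -
    obtain i where "i \<le> n" "t i = min r s" using in_F[of "min r s"] \<open>r \<in> J\<close> by (auto simp: F_def)
    then show ?thesis using le_iff[of i m] m by (intro exI[of _ i]) auto
  qed
  then obtain idx where idx: "\<And>r. r \<in> J \<Longrightarrow> idx r \<le> m" "\<And>r. r \<in> J \<Longrightarrow> t (idx r) = min r s" by metis
  have "\<exists>i\<ge>m. i \<le> n \<and> t i = s + r" if "r \<in> K" for r
  proof -
    obtain i where "i \<le> n" "t i = s + r" using in_F[of "s + r"] \<open>r \<in> K\<close> by (auto simp: F_def)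
    then show ?thesis using le_iff[of m i] m K \<open>r \<in> K\<close> by (intro exI[of _ i]) auto
  qed
  then obtain idy where idy: "\<And>r. r \<in> K \<Longrightarrow> m \<le> idy r" "\<And>r. r \<in> K \<Longrightarrow> idy r \<le> n" "\<And>r. r \<in> K \<Longrightarrow> t (idy r) = s + r" by metis
  define D where "D i \<omega> = L (t (Suc i)) \<omega> - L (t i) \<omega>" for i \<omega>
  have "indep_vars (\<lambda>_. borel) D {..<n}"
    unfolding D_def by (rule indep_increments) (use t0 mono in \<open>auto intro: less_imp_le\<close>)
  then have ind: "indep_var (PiM {..<m} (\<lambda>_. borel)) (\<lambda>\<omega>. \<lambda>i\<in>{..<m}. D i \<omega>) (PiM {m..<n} (\<lambda>_. borel)) (\<lambda>\<omega>. \<lambda>i\<in>{m..<n}. D i \<omega>)"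
    by (rule indep_var_restrict) (use m in auto)
  define SA where "SA = {d \<in> space (PiM {..<m} (\<lambda>_. borel)). \<forall>r\<in>J. (\<Sum>i=0..<idx r. d i :: real) \<in> A r}"
  define SB where "SB = {d \<in> space (PiM {m..<n} (\<lambda>_. borel)). \<forall>r\<in>K. (\<Sum>i=m..<idy r. d i :: real) \<in> B r}"
  have "{0..<idx r} \<subseteq> {..<m}" if "r \<in> J" for r using idx(1)[OF that] by auto
  then have SA: "SA \<in> sets (PiM {..<m} (\<lambda>_. borel))"
    unfolding SA_def using J by (intro partial_sums_in_sets_PiM)
  have "{m..<idy r} \<subseteq> {m..<n}" if "r \<in> K" for r using idy(2)[OF that] by auto
  then have SB: "SB \<in> sets (PiM {m..<n} (\<lambda>_. borel))"
    unfolding SB_def using K by (intro partial_sums_in_sets_PiM)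
  have a: "(\<Sum>i=0..<idx r. (\<lambda>i\<in>{..<m}. D i \<omega>) i) = L (min r s) \<omega>" if "r \<in> J" "\<omega> \<in> space M" for r \<omega>
  proof -
    have "(\<Sum>i=0..<idx r. (\<lambda>i\<in>{..<m}. D i \<omega>) i) = (\<Sum>i=0..<idx r. L (t (Suc i)) \<omega> - L (t i) \<omega>)"
      using idx(1)[OF that(1)] by (intro sum.cong) (auto simp: D_def)
    also have "\<dots> = L (min r s) \<omega>"
      using telescope[of 0 "idx r" t \<omega>] idx(2)[OF that(1)] t0 L_zero[OF that(2)] by simp
    finally show ?thesis .
  qed
  have b: "(\<Sum>i=m..<idy r. (\<lambda>i\<in>{m..<n}. D i \<omega>) i) = L (s + r) \<omega> - L s \<omega>" if "r \<in> K" for r \<omega>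
  proof -
    have "(\<Sum>i=m..<idy r. (\<lambda>i\<in>{m..<n}. D i \<omega>) i) = (\<Sum>i=m..<idy r. L (t (Suc i)) \<omega> - L (t i) \<omega>)"
      using idy(2)[OF that] by (intro sum.cong) (auto simp: D_def)
    also have "\<dots> = L (s + r) \<omega> - L s \<omega>"
      using telescope[of m "idy r" t \<omega>] idy(1,3)[OF that] m by simp
    finally show ?thesis .
  qed
  have eqA: "{\<omega> \<in> space M. \<forall>r\<in>J. L (min r s) \<omega> \<in> A r} = (\<lambda>\<omega>. \<lambda>i\<in>{..<m}. D i \<omega>) -` SA \<inter> space M"
    using a by (auto simp: SA_def space_PiM)
  have eqB: "{\<omega> \<in> space M. \<forall>r\<in>K. L (s + r) \<omega> - L s \<omega> \<in> B r} = (\<lambda>\<omega>. \<lambda>i\<in>{m..<n}. D i \<omega>) -` SB \<inter> space M"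
    using b by (auto simp: SB_def space_PiM)
  have "(\<lambda>\<omega>. \<lambda>i\<in>{..<m}. D i \<omega>) -` SA \<inter> space M \<inter> ((\<lambda>\<omega>. \<lambda>i\<in>{m..<n}. D i \<omega>) -` SB \<inter> space M)
      = (\<lambda>\<omega>. (\<lambda>i\<in>{..<m}. D i \<omega>, \<lambda>i\<in>{m..<n}. D i \<omega>)) -` (SA \<times> SB) \<inter> space M"
    by auto
  then show ?thesis
    unfolding eqA eqB using indep_varD[OF ind SA SB] by simp
qed

lemma sigma_vimage_path_space:
  assumes "X \<in> measurable M path_space"
  shows "sigma_sets (space M) {X -` A \<inter> space M | A. A \<in> sets path_space}
    = sigma_sets (space M) {X -` A \<inter> space M | A. A \<in> prod_algebra {0..} (\<lambda>_. borel)}" (is "?l = ?r")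
proof -
  have X: "X \<in> space M \<rightarrow> (\<Pi>\<^sub>E i\<in>{0..}. space borel)"
    using measurable_space[OF assms] by (auto simp: space_PiM)
  have eq: "{X -` A \<inter> space M | A. A \<in> sets path_space} = ?r"
    unfolding sets_PiM by (rule sigma_sets_vimage_commute[OF X])
  show ?thesis
    unfolding eq by (rule sigma_sets_sigma_sets_eq) auto
qed

text \<open>The cylinder sets are an intersection-stable generator, so independence on them extends
  to the generated sigma-algebras.\<close>

lemma indep_pre_post: "indep_var path_space (pre s) path_space (post s)"
proof -
  define u where "u = max 0 s"
  have u: "0 \<le> u" by (simp add: u_def)
  let ?G = "\<lambda>X. {X -` A \<inter> space M | A. A \<in> prod_algebra {0..} (\<lambda>_. borel :: real measure)}"
  have stable: "Int_stable (?G X)" for X :: "'a \<Rightarrow> real \<Rightarrow> real"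
  proof (rule Int_stableI)
    fix a b assume "a \<in> ?G X" "b \<in> ?G X"
    then obtain A B where AB: "a = X -` A \<inter> space M" "b = X -` B \<inter> space M"
      "A \<in> prod_algebra {0..} (\<lambda>_. borel :: real measure)" "B \<in> prod_algebra {0..} (\<lambda>_. borel :: real measure)" by blast
    have "A \<inter> B \<in> prod_algebra {0..} (\<lambda>_. borel :: real measure)"
      using Int_stable_prod_algebra AB(3,4) by (rule Int_stableD)
    moreover have "a \<inter> b = X -` (A \<inter> B) \<inter> space M" unfolding AB(1,2) by auto
    ultimately show "a \<inter> b \<in> ?G X" by (intro CollectI exI[of _ "A \<inter> B"] conjI)
  qed
  have "indep_set (?G (pre s)) (?G (post s))"
  proof (rule indep_setI)
    have "A \<in> sets path_space" if "A \<in> prod_algebra {0..} (\<lambda>_. borel :: real measure)" for A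
      using that by (auto simp: sets_PiM)
    then show "?G (pre s) \<subseteq> events" "?G (post s) \<subseteq> events"
      by (auto intro!: measurable_sets[OF pre_measurable] measurable_sets[OF post_measurable])
  next
    fix a b assume "a \<in> ?G (pre s)" "b \<in> ?G (post s)"
    then obtain A' B' where A': "A' \<in> prod_algebra {0..} (\<lambda>_. borel :: real measure)" and a: "a = pre s -` A' \<inter> space M"
      and B': "B' \<in> prod_algebra {0..} (\<lambda>_. borel :: real measure)" and b: "b = post s -` B' \<inter> space M" by blast
    from A' obtain J A where J: "finite J" "J \<subseteq> {0..}" "\<And>r. r \<in> J \<Longrightarrow> A r \<in> sets borel"
      and A: "A' = prod_emb {0..} (\<lambda>_. borel) J (Pi\<^sub>E J A)"
      by (elim prod_algebraE) auto
    from B' obtain K B where K: "finite K" "K \<subseteq> {0..}" "\<And>r. r \<in> K \<Longrightarrow> B r \<in> sets borel"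
      and B: "B' = prod_emb {0..} (\<lambda>_. borel) K (Pi\<^sub>E K B)"
      by (elim prod_algebraE) auto
    have "a = {\<omega> \<in> space M. \<forall>r\<in>J. L (min r u) \<omega> \<in> A r}"
      unfolding a A prod_emb_def pre_def u_def using J by (auto simp: PiE_iff subset_iff)
    moreover have "b = {\<omega> \<in> space M. \<forall>r\<in>K. L (u + r) \<omega> - L u \<omega> \<in> B r}"
      unfolding b B prod_emb_def post_def u_def using K by (auto simp: PiE_iff subset_iff)
    ultimately show "prob (a \<inter> b) = prob a * prob b"
      using indep_pre_post_cylinder[OF u J K] by simp
  qed
  from indep_set_sigma_sets[OF this stable stable]
  show ?thesis
    unfolding indep_var_eq sigma_vimage_path_space[OF pre_measurable] sigma_vimage_path_space[OF post_measurable]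
    by simp
qed

lemma distr_pre_post:
  "distr M (path_space \<Otimes>\<^sub>M path_space) (\<lambda>\<omega>. (pre s \<omega>, post s \<omega>))
    = distr M path_space (pre s) \<Otimes>\<^sub>M distr M path_space path"
  using indep_pre_post[of s] unfolding indep_var_distribution_eq distr_post by simp

end

section \<open>The strong Markov property at arrival times\<close>

abbreviation seq_space :: "(nat \<Rightarrow> real) measure" where
  "seq_space \<equiv> PiM UNIV (\<lambda>_. borel)"

lemma measurable_seq_spaceI:
  "(\<And>j. (\<lambda>\<omega>. X \<omega> j) \<in> borel_measurable N) \<Longrightarrow> X \<in> measurable N seq_space"
  by (rule measurable_PiM_single') (auto simp: PiE_def)

lemma measurable_cnt:
  "(\<lambda>p. cnt (fst p) (snd p)) \<in> measurable (seq_space \<Otimes>\<^sub>M borel) (count_space UNIV)"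
  unfolding cnt_def
proof (rule measurable_card)
  fix i :: nat
  let ?N = "seq_space \<Otimes>\<^sub>M (borel :: real measure)"
  have 1: "(\<lambda>p. fst p i) \<in> borel_measurable ?N"
    by (rule measurable_compose[OF measurable_fst measurable_component_singleton]) simp
  have "{p \<in> space ?N. fst p i \<le> snd p} \<in> sets ?N"
    by (rule borel_measurable_le[OF 1]) simp
  then show "{p \<in> space ?N. i \<in> {k. 1 \<le> k \<and> fst p k \<le> snd p}} \<in> sets ?N"
    by (cases "1 \<le> i") simp_all
qed

section \<open>Poisson arrivals, their renewal and their independence of the path\<close>

locale levy_poisson = levy M L for M :: "'a measure" and L :: "real \<Rightarrow> 'a \<Rightarrow> real" +
  fixes T :: "nat \<Rightarrow> 'a \<Rightarrow> real" and \<eta> :: real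
  assumes poisson: "poisson_process M \<eta> T" and indep: "independent_processes M L T" and \<eta>: "0 < \<eta>"
begin

definition arr :: "'a \<Rightarrow> nat \<Rightarrow> real" where
  "arr \<omega> = (\<lambda>k. T k \<omega>)"

definition arr_pre :: "nat \<Rightarrow> 'a \<Rightarrow> nat \<Rightarrow> real" where
  "arr_pre k \<omega> = (\<lambda>j. T (min j k) \<omega>)"

definition arr_post :: "nat \<Rightarrow> 'a \<Rightarrow> nat \<Rightarrow> real" where
  "arr_post k \<omega> = (\<lambda>j. T (k + j) \<omega> - T k \<omega>)"

definition gap :: "nat \<Rightarrow> 'a \<Rightarrow> real" where
  "gap i \<omega> = T (Suc i) \<omega> - T i \<omega>"

lemma arrival_times: "\<omega> \<in> space M \<Longrightarrow> arrival_times (\<lambda>k. T k \<omega>)"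
  using poisson by (simp add: poisson_process_def arrival_times_def)

lemma T_zero: "\<omega> \<in> space M \<Longrightarrow> T 0 \<omega> = 0"
  by (rule arrival_times.zero[OF arrival_times])

lemma T_nonneg: "\<omega> \<in> space M \<Longrightarrow> 0 \<le> T k \<omega>"
  by (rule arrival_times.nonneg[OF arrival_times])

lemma indep_gaps: "indep_vars (\<lambda>_. borel) gap UNIV"
  using poisson by (simp add: poisson_process_def gap_def[abs_def])

lemma gap_measurable [measurable]: "gap i \<in> borel_measurable M"
  using indep_gaps by (simp add: indep_vars_def)

lemma T_eq_sum: "\<omega> \<in> space M \<Longrightarrow> T k \<omega> = (\<Sum>i<k. gap i \<omega>)"
  unfolding gap_def by (subst sum_lessThan_telescope) (simp add: T_zero)

lemma T_measurable [measurable]: "T k \<in> borel_measurable M"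
proof -
  have "(\<lambda>\<omega>. \<Sum>i<k. gap i \<omega>) \<in> borel_measurable M" by measurable
  then show ?thesis by (subst measurable_cong[OF T_eq_sum])
qed

lemma gap_distributed: "distributed M lborel (gap k) (exponential_density \<eta>)"
  using poisson by (simp add: poisson_process_def gap_def[abs_def])

lemma distr_gap: "distr M borel (gap k) = density lborel (exponential_density \<eta>)"
proof -
  have "distr M lborel (gap k) = density lborel (exponential_density \<eta>)"
    using gap_distributed by (rule distributed_distr_eq_density)
  moreover have "distr M borel (gap k) = distr M lborel (gap k)"
    by (rule distr_cong) simp_all
  ultimately show ?thesis by simp
qed

lemma arr_measurable [measurable]: "arr \<in> measurable M seq_space"
  unfolding arr_def by (rule measurable_seq_spaceI) measurable

lemma arr_pre_measurable [measurable]: "arr_pre k \<in> measurable M seq_space"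
  unfolding arr_pre_def by (rule measurable_seq_spaceI) measurable

lemma arr_post_measurable [measurable]: "arr_post k \<in> measurable M seq_space"
  unfolding arr_post_def by (rule measurable_seq_spaceI) measurable

text \<open>The times elapsed since the k-th arrival are partial sums of the gaps from k on, and the
  shifted gap sequence has the same product law as the original one.\<close>

lemma distr_arr_post: "distr M seq_space (arr_post k) = distr M seq_space arr"
proof -
  define S where "S d = (\<lambda>j::nat. \<Sum>i<j. d i)" for d :: "nat \<Rightarrow> real"
  have [measurable]: "S \<in> measurable seq_space seq_space"
    unfolding S_def by (rule measurable_seq_spaceI) measurable
  have law: "distr M seq_space (\<lambda>\<omega>. \<lambda>i\<in>UNIV. gap (m + i) \<omega>) = PiM UNIV (\<lambda>_. density lborel (exponential_density \<eta>))" for m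
  proof -
    have "indep_vars (\<lambda>_. borel) (\<lambda>i. gap (m + i)) UNIV"
      unfolding indep_vars_def2
    proof (intro conjI ballI indep_setsI)
      fix A J assume J: "J \<noteq> {}" "finite J" and A: "\<forall>j\<in>J. A j \<in> {gap (m + j) -` B \<inter> space M |B. B \<in> sets borel}"
      have "indep_sets (\<lambda>i. {gap i -` B \<inter> space M |B. B \<in> sets borel}) UNIV"
        using indep_gaps unfolding indep_vars_def2 by simp
      from indep_setsD[OF this, of "(+) m ` J" "\<lambda>i. A (i - m)"]
      have "prob (\<Inter>j\<in>(+) m ` J. A (j - m)) = (\<Prod>j\<in>(+) m ` J. prob (A (j - m)))"
        using J A by auto
      then show "prob (\<Inter>j\<in>J. A j) = (\<Prod>j\<in>J. prob (A j))"
        by (simp add: prod.reindex)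
    qed auto
    then show ?thesis by (subst (asm) indep_vars_iff_distr_eq_PiM') (simp_all add: distr_gap)
  qed
  have eq: "distr M seq_space (\<lambda>\<omega>. S (\<lambda>i\<in>UNIV. gap (m + i) \<omega>))
      = distr (PiM UNIV (\<lambda>_. density lborel (exponential_density \<eta>))) seq_space S" for m
  proof -
    have "(\<lambda>\<omega>. \<lambda>i\<in>UNIV. gap (m + i) \<omega>) \<in> measurable M seq_space"
      by (rule measurable_restrict) measurable
    then show ?thesis unfolding law[of m, symmetric] by (subst distr_distr) (simp_all add: o_def)
  qed
  have "distr M seq_space (arr_post k) = distr M seq_space (\<lambda>\<omega>. S (\<lambda>i\<in>UNIV. gap (k + i) \<omega>))"
  proof (rule distr_cong[OF refl refl])
    fix \<omega> assume w: "\<omega> \<in> space M"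
    have "(\<Sum>i<j. gap (k + i) \<omega>) = T (k + j) \<omega> - T k \<omega>" for j
      unfolding gap_def using sum_lessThan_telescope[of "\<lambda>i. T (k + i) \<omega>" j] by simp
    then show "arr_post k \<omega> = S (\<lambda>i\<in>UNIV. gap (k + i) \<omega>)"
      by (simp add: arr_post_def S_def fun_eq_iff)
  qed
  also have "\<dots> = distr M seq_space (\<lambda>\<omega>. S (\<lambda>i\<in>UNIV. gap (0 + i) \<omega>))"
    by (simp only: eq)
  also have "\<dots> = distr M seq_space arr"
    by (rule distr_cong[OF refl refl]) (simp add: arr_def S_def fun_eq_iff T_eq_sum)
  finally show ?thesis .
qed

text \<open>The first k arrivals and the times elapsed after the k-th are functions of disjoint
  blocks of independent gaps.\<close>

lemma distr_arr_pre_post: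
  "distr M (seq_space \<Otimes>\<^sub>M seq_space) (\<lambda>\<omega>. (arr_pre k \<omega>, arr_post k \<omega>))
    = distr M seq_space (arr_pre k) \<Otimes>\<^sub>M distr M seq_space arr"
proof -
  define S1 where "S1 d = (\<lambda>j::nat. \<Sum>i<min j k. d i)" for d :: "nat \<Rightarrow> real"
  define S2 where "S2 d = (\<lambda>j::nat. \<Sum>i=k..<k+j. d i)" for d :: "nat \<Rightarrow> real"
  have m1: "S1 \<in> measurable (PiM {..<k} (\<lambda>_. borel)) seq_space"
    unfolding S1_def by (intro measurable_seq_spaceI borel_measurable_sum measurable_component_singleton) auto
  have m2: "S2 \<in> measurable (PiM {k..} (\<lambda>_. borel)) seq_space"
    unfolding S2_def by (intro measurable_seq_spaceI borel_measurable_sum measurable_component_singleton) auto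
  have "indep_var (PiM {..<k} (\<lambda>_. borel)) (\<lambda>\<omega>. \<lambda>i\<in>{..<k}. gap i \<omega>) (PiM {k..} (\<lambda>_. borel)) (\<lambda>\<omega>. \<lambda>i\<in>{k..}. gap i \<omega>)"
    by (rule indep_var_restrict[OF indep_gaps]) auto
  from indep_var_compose[OF this m1 m2]
  have ind: "indep_var seq_space (\<lambda>\<omega>. S1 (\<lambda>i\<in>{..<k}. gap i \<omega>)) seq_space (\<lambda>\<omega>. S2 (\<lambda>i\<in>{k..}. gap i \<omega>))"
    by (simp add: o_def)
  have pre: "S1 (\<lambda>i\<in>{..<k}. gap i \<omega>) = arr_pre k \<omega>" if "\<omega> \<in> space M" for \<omega>
    using that by (auto simp: S1_def arr_pre_def T_eq_sum fun_eq_iff intro!: sum.cong)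
  have post: "S2 (\<lambda>i\<in>{k..}. gap i \<omega>) = arr_post k \<omega>" for \<omega>
  proof
    fix j
    have "S2 (\<lambda>i\<in>{k..}. gap i \<omega>) j = (\<Sum>i=k..<k+j. gap i \<omega>)"
      unfolding S2_def by (intro sum.cong) auto
    also have "\<dots> = arr_post k \<omega> j"
      unfolding gap_def arr_post_def by (rule sum_Suc_diff') simp
    finally show "S2 (\<lambda>i\<in>{k..}. gap i \<omega>) j = arr_post k \<omega> j" .
  qed
  have "distr M (seq_space \<Otimes>\<^sub>M seq_space) (\<lambda>\<omega>. (arr_pre k \<omega>, arr_post k \<omega>))
      = distr M (seq_space \<Otimes>\<^sub>M seq_space) (\<lambda>\<omega>. (S1 (\<lambda>i\<in>{..<k}. gap i \<omega>), S2 (\<lambda>i\<in>{k..}. gap i \<omega>)))"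
    by (rule distr_cong[OF refl refl]) (simp add: pre post)
  also have "\<dots> = distr M seq_space (\<lambda>\<omega>. S1 (\<lambda>i\<in>{..<k}. gap i \<omega>)) \<Otimes>\<^sub>M distr M seq_space (\<lambda>\<omega>. S2 (\<lambda>i\<in>{k..}. gap i \<omega>))"
    using ind unfolding indep_var_distribution_eq by simp
  also have "distr M seq_space (\<lambda>\<omega>. S1 (\<lambda>i\<in>{..<k}. gap i \<omega>)) = distr M seq_space (arr_pre k)"
    by (rule distr_cong[OF refl refl]) (simp add: pre)
  finally show ?thesis unfolding post distr_arr_post .
qed

text \<open>The arrival times are independent of this \<open>\<sigma>\<close>-algebra, so in integrals over \<open>(\<omega>, arr \<omega>)\<close> the
  second component may be replaced by an independent copy (\<open>nn_integral_freeze\<close>).\<close>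

definition FL :: "'a measure" where
  "FL = vimage_algebra (space M) path path_space"

lemma space_FL [simp]: "space FL = space M"
  by (simp add: FL_def)

lemma path_in: "path \<in> space M \<rightarrow> space path_space"
  using measurable_space[OF path_measurable] by auto

lemma sets_FL: "sets FL = {path -` A \<inter> space M | A. A \<in> sets path_space}"
  unfolding FL_def by (rule sets_vimage_algebra2[OF path_in])

lemma path_measurable_FL [measurable]: "path \<in> measurable FL path_space"
  unfolding FL_def by (rule measurable_vimage_algebra1[OF path_in])

lemma measurable_FL_imp: "X \<in> measurable FL N \<Longrightarrow> X \<in> measurable M N"
proof -
  have "sets FL \<subseteq> sets M" using measurable_sets[OF path_measurable] by (auto simp: sets_FL)
  then show "X \<in> measurable FL N \<Longrightarrow> X \<in> measurable M N"
    by (auto simp: measurable_def)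
qed

lemma id_measurable_FL [measurable]: "(\<lambda>\<omega>. \<omega>) \<in> measurable M FL"
  by (rule measurable_FL_imp) simp

lemma L_measurable_FL [measurable]: "0 \<le> t \<Longrightarrow> L t \<in> borel_measurable FL"
proof -
  assume t: "0 \<le> t"
  have "(\<lambda>\<omega>. path \<omega> t) \<in> borel_measurable FL"
    by (rule measurable_compose[OF path_measurable_FL measurable_component_singleton]) (use t in simp)
  then show ?thesis using t by (simp add: path_def)
qed

lemma L_joint_measurable [measurable]: "(\<lambda>p. L (max 0 (fst p)) (snd p)) \<in> borel_measurable (borel \<Otimes>\<^sub>M FL)"
  by (rule right_continuous_joint_measurable) (auto intro: L_right)

lemma pre_joint_measurable [measurable]: "(\<lambda>p. pre (fst p) (snd p)) \<in> measurable (borel \<Otimes>\<^sub>M FL) path_space"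
  unfolding pre_def
proof (rule measurable_restrict)
  fix r :: real assume r: "r \<in> {0..}"
  have *: "(\<lambda>p. (\<lambda>p. L (max 0 (fst p)) (snd p)) (min r (max 0 (fst p)), snd p)) \<in> borel_measurable (borel \<Otimes>\<^sub>M FL)"
    by (rule measurable_compose[OF _ L_joint_measurable]) measurable
  show "(\<lambda>p. L (min r (max 0 (fst p))) (snd p)) \<in> borel_measurable (borel \<Otimes>\<^sub>M FL)"
  proof -
    have "max 0 (min r (max 0 x)) = min r (max 0 x)" for x using r by simp
    with * show ?thesis by (simp only: fst_conv snd_conv)
  qed
qed

lemma post_joint_measurable [measurable]: "(\<lambda>p. post (fst p) (snd p)) \<in> measurable (borel \<Otimes>\<^sub>M FL) path_space"
  unfolding post_def
proof (rule measurable_restrict)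
  fix r :: real assume r: "r \<in> {0..}"
  have "(\<lambda>p. (\<lambda>p. L (max 0 (fst p)) (snd p)) (max 0 (fst p) + r, snd p)) \<in> borel_measurable (borel \<Otimes>\<^sub>M FL)"
    by (rule measurable_compose[OF _ L_joint_measurable]) measurable
  then have "(\<lambda>p. L (max 0 (fst p) + r) (snd p)) \<in> borel_measurable (borel \<Otimes>\<^sub>M FL)"
    using r by (simp add: max_absorb2)
  then show "(\<lambda>p. L (max 0 (fst p) + r) (snd p) - L (max 0 (fst p)) (snd p)) \<in> borel_measurable (borel \<Otimes>\<^sub>M FL)"
    by measurable
qed

definition cpath :: "'a \<Rightarrow> real \<Rightarrow> real" where
  "cpath \<omega> = (\<lambda>t\<in>{0..}. real (counting T t \<omega>))"

lemma indep_path_cpath: "indep_var path_space path path_space cpath"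
  using indep unfolding independent_processes_def path_def cpath_def .

text \<open>Independence is assumed for the counting process. Since the k-th arrival is at most a
  exactly if the count at a is at least k, events about arrivals are events about counting paths,
  and independence carries over.\<close>

lemma arr_vimage_cpath:
  assumes "B \<in> sets seq_space"
  obtains B' where "B' \<in> sets path_space" "arr -` B \<inter> space M = cpath -` B' \<inter> space M"
proof -
  define FC where "FC = vimage_algebra (space M) cpath path_space"
  have cin: "cpath \<in> space M \<rightarrow> space path_space"
    using indep_path_cpath unfolding indep_var_eq by (auto dest: measurable_space)
  have cm: "cpath \<in> measurable FC path_space"
    unfolding FC_def by (rule measurable_vimage_algebra1[OF cin])
  have sp: "space FC = space M" by (simp add: FC_def)
  have "T k \<in> borel_measurable FC" for k
  proof (cases "k = 0")
    case True
    have "(\<lambda>\<omega>. 0 :: real) \<in> borel_measurable FC" by simp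
    then show ?thesis using True T_zero sp by (subst measurable_cong[of _ _ "\<lambda>_. 0"]) auto
  next
    case False
    show ?thesis
    proof (subst borel_measurable_iff_le, rule allI)
      fix a :: real
      show "{\<omega> \<in> space FC. T k \<omega> \<le> a} \<in> sets FC"
      proof (cases "0 \<le> a")
        case True
        have "(\<lambda>\<omega>. cpath \<omega> a) \<in> borel_measurable FC"
          by (rule measurable_compose[OF cm measurable_component_singleton]) (use True in simp)
        then have "{\<omega> \<in> space FC. real k \<le> cpath \<omega> a} \<in> sets FC" by measurable
        moreover have "T k \<omega> \<le> a \<longleftrightarrow> real k \<le> cpath \<omega> a" if "\<omega> \<in> space M" for \<omega>
          using arrival_times.le_cnt_iff[OF arrival_times[OF that], of k a] False True
          by (simp add: cpath_def counting_eq_cnt)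
        ultimately show ?thesis by (simp add: sp cong: conj_cong)
      next
        case False
        then have "{\<omega> \<in> space FC. T k \<omega> \<le> a} = {}" using T_nonneg[of _ k] by (force simp: sp)
        then show ?thesis by (simp only: sets.empty_sets)
      qed
    qed
  qed
  then have "arr \<in> measurable FC seq_space" unfolding arr_def by (rule measurable_seq_spaceI)
  from measurable_sets[OF this assms] have "arr -` B \<inter> space M \<in> sets FC" by (simp add: sp)
  then show ?thesis using that unfolding FC_def sets_vimage_algebra2[OF cin] by auto
qed

lemma distr_freeze:
  "distr M (FL \<Otimes>\<^sub>M seq_space) (\<lambda>\<omega>. (\<omega>, arr \<omega>)) = distr M FL (\<lambda>\<omega>. \<omega>) \<Otimes>\<^sub>M distr M seq_space arr"
proof (rule pair_measure_eqI[symmetric])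
  show "sigma_finite_measure (distr M FL (\<lambda>\<omega>. \<omega>))" "sigma_finite_measure (distr M seq_space arr)"
    by (auto intro!: prob_space_imp_sigma_finite prob_space_distr)
  show "sets (distr M FL (\<lambda>\<omega>. \<omega>) \<Otimes>\<^sub>M distr M seq_space arr) = sets (distr M (FL \<Otimes>\<^sub>M seq_space) (\<lambda>\<omega>. (\<omega>, arr \<omega>)))"
    by (simp cong: sets_pair_measure_cong)
  fix A B assume "A \<in> sets (distr M FL (\<lambda>\<omega>. \<omega>))" and "B \<in> sets (distr M seq_space arr)"
  then have A: "A \<in> sets FL" and B: "B \<in> sets seq_space" by simp_all
  obtain A' where A': "A' \<in> sets path_space" "A = path -` A' \<inter> space M" using A unfolding sets_FL by auto
  obtain B' where B': "B' \<in> sets path_space" "arr -` B \<inter> space M = cpath -` B' \<inter> space M"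
    using B by (rule arr_vimage_cpath)
  have "(\<lambda>\<omega>. \<omega>) -` A \<inter> space M = A" using sets.sets_into_space[OF A] by auto
  then have A_M: "A \<in> events" using measurable_sets[OF id_measurable_FL A] by (simp only:)
  have "prob (A \<inter> (arr -` B \<inter> space M)) = prob A * prob (arr -` B \<inter> space M)"
  proof -
    have "A \<inter> (arr -` B \<inter> space M) = (\<lambda>x. (path x, cpath x)) -` (A' \<times> B') \<inter> space M"
      unfolding A'(2) B'(2) by auto
    then show ?thesis
      unfolding A'(2) B'(2) using indep_varD[OF indep_path_cpath A'(1) B'(1)] by simp
  qed
  then have "emeasure M A * emeasure M (arr -` B \<inter> space M) = emeasure M (A \<inter> (arr -` B \<inter> space M))"
    by (simp add: emeasure_eq_measure ennreal_mult'[symmetric])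
  moreover have "(\<lambda>\<omega>. (\<omega>, arr \<omega>)) -` (A \<times> B) \<inter> space M = A \<inter> (arr -` B \<inter> space M)"
    using sets.sets_into_space[OF A_M] by auto
  ultimately show "emeasure (distr M FL (\<lambda>\<omega>. \<omega>)) A * emeasure (distr M seq_space arr) B
      = emeasure (distr M (FL \<Otimes>\<^sub>M seq_space) (\<lambda>\<omega>. (\<omega>, arr \<omega>))) (A \<times> B)"
    using A B sets.sets_into_space[OF A_M] by (simp add: emeasure_distr Int_absorb2)
qed

lemma nn_integral_freeze:
  assumes H[measurable]: "H \<in> borel_measurable (FL \<Otimes>\<^sub>M seq_space)"
  shows "(\<integral>\<^sup>+\<omega>. H (\<omega>, arr \<omega>) \<partial>M) = (\<integral>\<^sup>+\<omega>'. (\<integral>\<^sup>+\<omega>. H (\<omega>, arr \<omega>') \<partial>M) \<partial>M)"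
proof -
  interpret PL: prob_space "distr M FL (\<lambda>\<omega>. \<omega>)" by (rule prob_space_distr) simp
  interpret PT: prob_space "distr M seq_space arr" by (rule prob_space_distr) simp
  interpret P: pair_sigma_finite "distr M FL (\<lambda>\<omega>. \<omega>)" "distr M seq_space arr" ..
  have "(\<integral>\<^sup>+\<omega>. H (\<omega>, arr \<omega>) \<partial>M) = (\<integral>\<^sup>+p. H p \<partial>distr M (FL \<Otimes>\<^sub>M seq_space) (\<lambda>\<omega>. (\<omega>, arr \<omega>)))"
    by (subst nn_integral_distr) auto
  also have "\<dots> = (\<integral>\<^sup>+\<tau>. (\<integral>\<^sup>+\<omega>. H (\<omega>, \<tau>) \<partial>distr M FL (\<lambda>\<omega>. \<omega>)) \<partial>distr M seq_space arr)"
    unfolding distr_freeze by (rule P.nn_integral_snd[symmetric]) (simp cong: measurable_cong_sets sets_pair_measure_cong)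
  also have "\<dots> = (\<integral>\<^sup>+\<tau>. (\<integral>\<^sup>+\<omega>. H (\<omega>, \<tau>) \<partial>M) \<partial>distr M seq_space arr)"
    by (intro nn_integral_cong nn_integral_distr) auto
  also have "\<dots> = (\<integral>\<^sup>+\<omega>'. (\<integral>\<^sup>+\<omega>. H (\<omega>, arr \<omega>') \<partial>M) \<partial>M)"
    by (rule nn_integral_distr) measurable
  finally show ?thesis .
qed

end

text \<open>The cadlag paths are not a measurable subset of the product space \<open>path_space\<close>, where evaluation
  at a random time is not measurable either. \<open>rc_ext\<close> recovers a right-continuous path from countably
  many coordinates, jointly measurably in path and time.\<close>

definition rc_ext :: "(real \<Rightarrow> real) \<Rightarrow> real \<Rightarrow> real" where
  "rc_ext w t = lim (\<lambda>n. w (right_grid n t))"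

lemma rc_ext_measurable:
  assumes w: "w \<in> measurable N path_space" and t: "t \<in> borel_measurable N"
  shows "(\<lambda>x. rc_ext (w x) (t x)) \<in> borel_measurable N"
  unfolding rc_ext_def
proof (rule borel_measurable_lim_metric)
  fix n
  show "(\<lambda>x. w x (right_grid n (t x))) \<in> borel_measurable N"
  proof (rule measurable_right_grid[OF _ t])
    show "(\<lambda>x. w x s) \<in> borel_measurable N" if "0 \<le> s" for s
      by (rule measurable_compose[OF w measurable_component_singleton]) (use that in simp)
  qed
qed

lemma rc_ext_eq:
  assumes "\<And>s. 0 \<le> s \<Longrightarrow> w s = g s" "(g \<longlongrightarrow> g t) (at_right t)" "0 \<le> t"
  shows "rc_ext w t = g t"
proof -
  have "(\<lambda>n. g (right_grid n t)) \<longlonglongrightarrow> g t"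
    using filterlim_compose[OF _ right_grid_filterlim[of t]] assms(2,3) by (simp add: max_absorb2)
  moreover have "w (right_grid n t) = g (right_grid n t)" for n
    using right_grid_bounds(1)[of t n] by (intro assms(1)) simp
  ultimately show ?thesis unfolding rc_ext_def by (simp add: limI)
qed

section \<open>The barrier flow as a functional of start, path and arrivals\<close>

lemma rmax_measurable:
  "(\<And>k. c k \<in> borel_measurable N) \<Longrightarrow> (\<lambda>x. rmax (\<lambda>k. c k x) n) \<in> borel_measurable N"
  by (induction n) auto

text \<open>A deterministic functional, so that it can be fed either with the original path and
  arrivals or with those restarted at an arrival. Monotonicity in the start and the restart identity
  then hold path by path.\<close>

definition barrier_flow :: "real \<Rightarrow> real \<Rightarrow> (real \<Rightarrow> real) \<Rightarrow> (nat \<Rightarrow> real) \<Rightarrow> real \<Rightarrow> real" where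
  "barrier_flow b y w \<tau> s = y + rc_ext w s + rmax (\<lambda>k. b - y - rc_ext w (\<tau> k)) (cnt \<tau> s)"

lemma barrier_flow_measurable:
  assumes y[measurable]: "y \<in> borel_measurable N" and w: "w \<in> measurable N path_space"
    and t: "\<tau> \<in> measurable N seq_space" and s[measurable]: "s \<in> borel_measurable N"
  shows "(\<lambda>x. barrier_flow b (y x) (w x) (\<tau> x) (s x)) \<in> borel_measurable N"
proof -
  have tk: "(\<lambda>x. \<tau> x k) \<in> borel_measurable N" for k
    by (rule measurable_compose[OF t measurable_component_singleton]) simp
  note [measurable] = rc_ext_measurable[OF w s] rc_ext_measurable[OF w tk]
  have c: "(\<lambda>x. cnt (\<tau> x) (s x)) \<in> measurable N (count_space UNIV)"
    using measurable_compose[OF measurable_Pair[OF t s] measurable_cnt] by simp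
  have "(\<lambda>x. rmax (\<lambda>k. b - y x - rc_ext (w x) (\<tau> x k)) n) \<in> borel_measurable N" for n
    by (rule rmax_measurable) measurable
  from measurable_compose_countable[OF this c]
  have "(\<lambda>x. rmax (\<lambda>k. b - y x - rc_ext (w x) (\<tau> x k)) (cnt (\<tau> x) (s x))) \<in> borel_measurable N" .
  then show ?thesis unfolding barrier_flow_def by measurable
qed

lemma barrier_flow_mono: "y \<le> y' \<Longrightarrow> barrier_flow b y w \<tau> s \<le> barrier_flow b y' w \<tau> s"
  unfolding barrier_flow_def using rmax_shift_mono[of y y' b "\<lambda>k. rc_ext w (\<tau> k)"] by simp

context levy_poisson
begin

lemma rc_ext_path: "\<omega> \<in> space M \<Longrightarrow> 0 \<le> t \<Longrightarrow> rc_ext (path \<omega>) t = L t \<omega>"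
  by (rule rc_ext_eq[where g = "\<lambda>t. L t \<omega>"]) (auto simp: path_def intro: L_right)

lemma rc_ext_post:
  assumes "\<omega> \<in> space M" "0 \<le> s" "0 \<le> t"
  shows "rc_ext (post s \<omega>) t = L (s + t) \<omega> - L s \<omega>"
proof (rule rc_ext_eq[where g = "\<lambda>t. L (s + t) \<omega> - L s \<omega>"])
  have "filterlim (\<lambda>r. s + r) (at_right (s + t)) (at_right t)"
    by (simp add: filterlim_at eventually_at_right_less tendsto_intros)
       (auto intro!: tendsto_intros eventually_mono[OF eventually_at_right_less])
  from filterlim_compose[OF L_right this] assms
  show "((\<lambda>t. L (s + t) \<omega> - L s \<omega>) \<longlongrightarrow> L (s + t) \<omega> - L s \<omega>) (at_right t)"
    by (intro tendsto_diff tendsto_const) auto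
qed (use assms in \<open>auto simp: post_def\<close>)

definition U :: "real \<Rightarrow> real \<Rightarrow> real \<Rightarrow> 'a \<Rightarrow> real" where
  "U b x t \<omega> = x + L t \<omega> + barrier_strategy L T b x t \<omega>"

lemma barrier_eq: "barrier_strategy L T b x t \<omega> = rmax (\<lambda>k. b - (x + L (T k \<omega>) \<omega>)) (cnt (arr \<omega>) t)"
  unfolding barrier_strategy_eq_rmax arr_def ..

lemma U_eq_flow: "\<omega> \<in> space M \<Longrightarrow> 0 \<le> t \<Longrightarrow> U b x t \<omega> = barrier_flow b x (path \<omega>) (arr \<omega>) t"
  by (simp add: U_def barrier_eq barrier_flow_def rc_ext_path arr_def T_nonneg diff_diff_eq)

lemma U_arrival: "\<omega> \<in> space M \<Longrightarrow> U b x (T k \<omega>) \<omega> = x + L (T k \<omega>) \<omega> + rmax (\<lambda>k. b - (x + L (T k \<omega>) \<omega>)) k"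
  using arrival_times.cnt_arrival[OF arrival_times, of \<omega> k] by (simp add: U_def barrier_eq arr_def)

lemma U_arrival_ge: "\<omega> \<in> space M \<Longrightarrow> 1 \<le> k \<Longrightarrow> b \<le> U b x (T k \<omega>) \<omega>"
  using rmax_ge[of k k "\<lambda>k. b - (x + L (T k \<omega>) \<omega>)"] by (simp add: U_arrival)

text \<open>\<open>rmax_add\<close> for paths: the control exerted so far is absorbed into the
  current position, and only the shortfall measured from there matters afterwards.\<close>

lemma U_restart:
  assumes w: "\<omega> \<in> space M" and s: "0 \<le> s"
  shows "U b x (T k \<omega> + s) \<omega> = barrier_flow b (U b x (T k \<omega>) \<omega>) (post (T k \<omega>) \<omega>) (arr_post k \<omega>) s"
proof -
  interpret A: arrival_times "\<lambda>k. T k \<omega>" by (rule arrival_times[OF w])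
  let ?c = "\<lambda>k. b - (x + L (T k \<omega>) \<omega>)"
  have n: "cnt (arr \<omega>) (T k \<omega> + s) = k + cnt (arr_post k \<omega>) s"
    using A.cnt_shift[OF s, of k] by (simp add: arr_def arr_post_def)
  have post: "rc_ext (post (T k \<omega>) \<omega>) (arr_post k \<omega> i) = L (T (k + i) \<omega>) \<omega> - L (T k \<omega>) \<omega>" for i
    using rc_ext_post[OF w T_nonneg[OF w, of k], of "arr_post k \<omega> i"] monoD[OF strict_mono_mono[OF A.strict], of k "k + i"]
    by (simp add: arr_post_def)
  show ?thesis
    unfolding barrier_flow_def post rc_ext_post[OF w T_nonneg[OF w] s] U_arrival[OF w]
    unfolding U_def barrier_eq n rmax_add by (simp add: algebra_simps)
qed

text \<open>Freezing the arrivals turns the random time into a deterministic one, where the path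
  splits into independent parts. Then the arrival sequence itself is split, and finally past and
  future are each recombined with their arrivals.\<close>

lemma strong_markov_nn:
  assumes F[measurable]: "F \<in> borel_measurable ((path_space \<Otimes>\<^sub>M seq_space) \<Otimes>\<^sub>M (path_space \<Otimes>\<^sub>M seq_space))"
  shows "(\<integral>\<^sup>+\<omega>. F ((pre (T k \<omega>) \<omega>, arr_pre k \<omega>), (post (T k \<omega>) \<omega>, arr_post k \<omega>)) \<partial>M)
    = (\<integral>\<^sup>+\<omega>. (\<integral>\<^sup>+\<omega>'. F ((pre (T k \<omega>) \<omega>, arr_pre k \<omega>), (path \<omega>', arr \<omega>')) \<partial>M) \<partial>M)"
proof -
  interpret MM: pair_sigma_finite M M ..
  have c: "(\<lambda>\<tau>. \<tau> j) \<in> borel_measurable seq_space" for j :: nat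
    by (rule measurable_component_singleton) simp
  have s1[measurable]: "(\<lambda>\<tau> j. \<tau> (min j k)) \<in> measurable seq_space seq_space"
    by (rule measurable_seq_spaceI) (rule c)
  have s2[measurable]: "(\<lambda>\<tau> j. \<tau> (k + j) - \<tau> k) \<in> measurable seq_space seq_space"
    by (rule measurable_seq_spaceI) (intro borel_measurable_diff c)
  have pre1: "(\<lambda>p. pre (snd p k) (fst p)) \<in> measurable (FL \<Otimes>\<^sub>M seq_space) path_space"
  proof -
    have "(\<lambda>p. (snd p k, fst p)) \<in> measurable (FL \<Otimes>\<^sub>M seq_space) (borel \<Otimes>\<^sub>M FL)"
      by (intro measurable_Pair measurable_compose[OF measurable_snd c] measurable_fst)
    from measurable_compose[OF this pre_joint_measurable] show ?thesis by simp
  qed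
  have post1: "(\<lambda>p. post (snd p k) (fst p)) \<in> measurable (FL \<Otimes>\<^sub>M seq_space) path_space"
  proof -
    have "(\<lambda>p. (snd p k, fst p)) \<in> measurable (FL \<Otimes>\<^sub>M seq_space) (borel \<Otimes>\<^sub>M FL)"
      by (intro measurable_Pair measurable_compose[OF measurable_snd c] measurable_fst)
    from measurable_compose[OF this post_joint_measurable] show ?thesis by simp
  qed
  have preM: "(\<lambda>p. pre (fst p) (snd p)) \<in> measurable (borel \<Otimes>\<^sub>M M) path_space"
  proof -
    have "(\<lambda>p. (fst p, snd p)) \<in> measurable (borel \<Otimes>\<^sub>M M) (borel \<Otimes>\<^sub>M FL)"
      by (intro measurable_Pair measurable_fst measurable_compose[OF measurable_snd id_measurable_FL])
    from measurable_compose[OF this pre_joint_measurable] show ?thesis by simp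
  qed
  define H where "H p = F ((pre (snd p k) (fst p), \<lambda>j. snd p (min j k)), (post (snd p k) (fst p), \<lambda>j. snd p (k + j) - snd p k))" for p
  have H: "H \<in> borel_measurable (FL \<Otimes>\<^sub>M seq_space)"
    unfolding H_def
    by (intro measurable_compose[OF _ F] measurable_Pair pre1 post1 measurable_compose[OF measurable_snd s1] measurable_compose[OF measurable_snd s2])
  \<comment> \<open>\<open>I\<close> averages over a fresh path with the future arrivals held fixed;
    \<open>J\<close> below averages in addition over the past path with the past arrivals held
    fixed.\<close>
  define I where "I X t = (\<integral>\<^sup>+\<omega>2. F (X, (path \<omega>2, t)) \<partial>M)" for X t
  have I: "(\<lambda>p. I (fst p) (snd p)) \<in> borel_measurable ((path_space \<Otimes>\<^sub>M seq_space) \<Otimes>\<^sub>M seq_space)"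
    unfolding I_def by measurable
  define J where "J p = (\<integral>\<^sup>+\<omega>1. I (pre (fst p k) \<omega>1, fst p) (snd p) \<partial>M)" for p
  have preJ: "(\<lambda>q. pre (fst (fst q) k) (snd q)) \<in> measurable ((seq_space \<Otimes>\<^sub>M seq_space) \<Otimes>\<^sub>M M) path_space"
  proof -
    have "(\<lambda>q. (fst (fst q) k, snd q)) \<in> measurable ((seq_space \<Otimes>\<^sub>M seq_space) \<Otimes>\<^sub>M M) (borel \<Otimes>\<^sub>M M)"
      by (intro measurable_Pair measurable_compose[OF measurable_fst measurable_compose[OF measurable_fst c]] measurable_snd)
    from measurable_compose[OF this preM] show ?thesis by simp
  qed
  have IJ: "(\<lambda>q. I (pre (fst (fst q) k) (snd q), fst (fst q)) (snd (fst q)))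
      \<in> borel_measurable ((seq_space \<Otimes>\<^sub>M seq_space) \<Otimes>\<^sub>M M)"
  proof -
    have "(\<lambda>q. ((pre (fst (fst q) k) (snd q), fst (fst q)), snd (fst q)))
      \<in> measurable ((seq_space \<Otimes>\<^sub>M seq_space) \<Otimes>\<^sub>M M) ((path_space \<Otimes>\<^sub>M seq_space) \<Otimes>\<^sub>M seq_space)"
      by (intro measurable_Pair preJ measurable_compose[OF measurable_fst measurable_fst] measurable_compose[OF measurable_fst measurable_snd])
    from measurable_compose[OF this I] show ?thesis by simp
  qed
  have J[measurable]: "J \<in> borel_measurable (seq_space \<Otimes>\<^sub>M seq_space)"
    unfolding J_def by (rule borel_measurable_nn_integral) (use IJ in \<open>simp add: split_beta'\<close>)
  have "(\<integral>\<^sup>+\<omega>. F ((pre (T k \<omega>) \<omega>, arr_pre k \<omega>), (post (T k \<omega>) \<omega>, arr_post k \<omega>)) \<partial>M) = (\<integral>\<^sup>+\<omega>. H (\<omega>, arr \<omega>) \<partial>M)"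
    by (simp add: H_def arr_def arr_pre_def[abs_def] arr_post_def[abs_def])
  also have "\<dots> = (\<integral>\<^sup>+\<omega>'. (\<integral>\<^sup>+\<omega>. H (\<omega>, arr \<omega>') \<partial>M) \<partial>M)"
    by (rule nn_integral_freeze[OF H])
  \<comment> \<open>With frozen arrivals the k-th one is a constant, so
    \<open>distr_pre_post\<close> replaces the path after it by an independent fresh path.\<close>
  also have "\<dots> = (\<integral>\<^sup>+\<omega>'. J (arr_pre k \<omega>', arr_post k \<omega>') \<partial>M)"
  proof (rule nn_integral_cong)
    fix \<omega>'
    interpret P1: prob_space "distr M path_space (pre (T k \<omega>'))" by (rule prob_space_distr) simp
    interpret P2: prob_space "distr M path_space path" by (rule prob_space_distr) simp
    define f where "f p = F ((fst p, arr_pre k \<omega>'), (snd p, arr_post k \<omega>'))" for p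
    have f[measurable]: "f \<in> borel_measurable (path_space \<Otimes>\<^sub>M path_space)"
      unfolding f_def
      by (intro measurable_compose[OF _ F] measurable_Pair measurable_fst measurable_snd measurable_const)
         (auto simp: space_PiM)
    have "(\<integral>\<^sup>+\<omega>. H (\<omega>, arr \<omega>') \<partial>M) = (\<integral>\<^sup>+\<omega>. f (pre (T k \<omega>') \<omega>, post (T k \<omega>') \<omega>) \<partial>M)"
      by (simp add: H_def f_def arr_def arr_pre_def[abs_def] arr_post_def[abs_def])
    also have "\<dots> = (\<integral>\<^sup>+p. f p \<partial>distr M (path_space \<Otimes>\<^sub>M path_space) (\<lambda>\<omega>. (pre (T k \<omega>') \<omega>, post (T k \<omega>') \<omega>)))"
      by (subst nn_integral_distr) auto
    also have "\<dots> = (\<integral>\<^sup>+x. (\<integral>\<^sup>+y. f (x, y) \<partial>distr M path_space path) \<partial>distr M path_space (pre (T k \<omega>')))"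
      unfolding distr_pre_post by (rule P2.nn_integral_fst[symmetric]) (simp cong: measurable_cong_sets sets_pair_measure_cong)
    also have "\<dots> = (\<integral>\<^sup>+x. (\<integral>\<^sup>+\<omega>2. f (x, path \<omega>2) \<partial>M) \<partial>distr M path_space (pre (T k \<omega>')))"
      by (intro nn_integral_cong nn_integral_distr) auto
    also have "\<dots> = (\<integral>\<^sup>+\<omega>1. (\<integral>\<^sup>+\<omega>2. f (pre (T k \<omega>') \<omega>1, path \<omega>2) \<partial>M) \<partial>M)"
      by (rule nn_integral_distr) measurable
    also have "\<dots> = J (arr_pre k \<omega>', arr_post k \<omega>')"
      by (simp add: J_def I_def f_def arr_pre_def)
    finally show "(\<integral>\<^sup>+\<omega>. H (\<omega>, arr \<omega>') \<partial>M) = J (arr_pre k \<omega>', arr_post k \<omega>')" .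
  qed
  also have "\<dots> = (\<integral>\<^sup>+\<omega>'. (\<integral>\<^sup>+\<omega>''. J (arr_pre k \<omega>', arr \<omega>'') \<partial>M) \<partial>M)"
  proof -
    interpret P1: prob_space "distr M seq_space (arr_pre k)" by (rule prob_space_distr) simp
    interpret P2: prob_space "distr M seq_space arr" by (rule prob_space_distr) simp
    have "(\<integral>\<^sup>+\<omega>'. J (arr_pre k \<omega>', arr_post k \<omega>') \<partial>M)
        = (\<integral>\<^sup>+p. J p \<partial>distr M (seq_space \<Otimes>\<^sub>M seq_space) (\<lambda>\<omega>. (arr_pre k \<omega>, arr_post k \<omega>)))"
      by (subst nn_integral_distr) auto
    also have "\<dots> = (\<integral>\<^sup>+x. (\<integral>\<^sup>+y. J (x, y) \<partial>distr M seq_space arr) \<partial>distr M seq_space (arr_pre k))"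
      unfolding distr_arr_pre_post by (rule P2.nn_integral_fst[symmetric]) (simp cong: measurable_cong_sets sets_pair_measure_cong)
    also have "\<dots> = (\<integral>\<^sup>+x. (\<integral>\<^sup>+\<omega>''. J (x, arr \<omega>'') \<partial>M) \<partial>distr M seq_space (arr_pre k))"
      by (intro nn_integral_cong nn_integral_distr) auto
    also have "\<dots> = (\<integral>\<^sup>+\<omega>'. (\<integral>\<^sup>+\<omega>''. J (arr_pre k \<omega>', arr \<omega>'') \<partial>M) \<partial>M)"
      by (rule nn_integral_distr) measurable
    finally show ?thesis .
  qed
  also have "\<dots> = (\<integral>\<^sup>+\<omega>'. (\<integral>\<^sup>+\<omega>1. (\<integral>\<^sup>+\<omega>''. F ((pre (T k \<omega>') \<omega>1, arr_pre k \<omega>'), (path \<omega>'', arr \<omega>'')) \<partial>M) \<partial>M) \<partial>M)"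
  proof (rule nn_integral_cong)
    fix \<omega>'
    have hk: "arr_pre k \<omega>' k = T k \<omega>'" by (simp add: arr_pre_def)
    have "(\<integral>\<^sup>+\<omega>''. J (arr_pre k \<omega>', arr \<omega>'') \<partial>M)
        = (\<integral>\<^sup>+\<omega>''. (\<integral>\<^sup>+\<omega>1. I (pre (T k \<omega>') \<omega>1, arr_pre k \<omega>') (arr \<omega>'') \<partial>M) \<partial>M)"
      by (simp add: J_def hk)
    \<comment> \<open>The exchange puts the fresh path next to the fresh arrivals, so that freezing,
      read backwards, merges them into one sample point.\<close>
    also have "\<dots> = (\<integral>\<^sup>+\<omega>1. (\<integral>\<^sup>+\<omega>''. I (pre (T k \<omega>') \<omega>1, arr_pre k \<omega>') (arr \<omega>'') \<partial>M) \<partial>M)"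
    proof (rule MM.Fubini')
      have "(\<lambda>p. ((pre (T k \<omega>') (fst p), arr_pre k \<omega>'), arr (snd p)))
          \<in> measurable (M \<Otimes>\<^sub>M M) ((path_space \<Otimes>\<^sub>M seq_space) \<Otimes>\<^sub>M seq_space)"
        by (intro measurable_Pair measurable_compose[OF measurable_fst pre_measurable] measurable_compose[OF measurable_snd arr_measurable] measurable_const)
           (auto simp: space_PiM)
      from measurable_compose[OF this I]
      show "(\<lambda>(\<omega>1, \<omega>''). I (pre (T k \<omega>') \<omega>1, arr_pre k \<omega>') (arr \<omega>'')) \<in> borel_measurable (M \<Otimes>\<^sub>M M)"
        by (simp add: split_beta')
    qed
    also have "\<dots> = (\<integral>\<^sup>+\<omega>1. (\<integral>\<^sup>+\<omega>''. F ((pre (T k \<omega>') \<omega>1, arr_pre k \<omega>'), (path \<omega>'', arr \<omega>'')) \<partial>M) \<partial>M)"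
    proof (rule nn_integral_cong)
      fix \<omega>1 assume w1: "\<omega>1 \<in> space M"
      have "(\<lambda>p. F ((pre (T k \<omega>') \<omega>1, arr_pre k \<omega>'), (path (fst p), snd p))) \<in> borel_measurable (FL \<Otimes>\<^sub>M seq_space)"
        by (intro measurable_compose[OF _ F] measurable_Pair measurable_compose[OF measurable_fst path_measurable_FL] measurable_snd measurable_const)
           (use w1 measurable_space[OF pre_measurable w1] in \<open>auto simp: space_PiM\<close>)
      from nn_integral_freeze[OF this]
      show "(\<integral>\<^sup>+\<omega>''. I (pre (T k \<omega>') \<omega>1, arr_pre k \<omega>') (arr \<omega>'') \<partial>M)
          = (\<integral>\<^sup>+\<omega>''. F ((pre (T k \<omega>') \<omega>1, arr_pre k \<omega>'), (path \<omega>'', arr \<omega>'')) \<partial>M)"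
        by (simp add: I_def)
    qed
    finally show "(\<integral>\<^sup>+\<omega>''. J (arr_pre k \<omega>', arr \<omega>'') \<partial>M)
        = (\<integral>\<^sup>+\<omega>1. (\<integral>\<^sup>+\<omega>''. F ((pre (T k \<omega>') \<omega>1, arr_pre k \<omega>'), (path \<omega>'', arr \<omega>'')) \<partial>M) \<partial>M)" .
  qed
  also have "\<dots> = (\<integral>\<^sup>+\<omega>. (\<integral>\<^sup>+\<omega>'. F ((pre (T k \<omega>) \<omega>, arr_pre k \<omega>), (path \<omega>', arr \<omega>')) \<partial>M) \<partial>M)"
  proof -
    define Q where "Q X = (\<integral>\<^sup>+\<omega>''. F (X, (path \<omega>'', arr \<omega>'')) \<partial>M)" for X
    have Q: "Q \<in> borel_measurable (path_space \<Otimes>\<^sub>M seq_space)"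
      unfolding Q_def by measurable
    have "(\<lambda>p. Q (pre (snd p k) (fst p), \<lambda>j. snd p (min j k))) \<in> borel_measurable (FL \<Otimes>\<^sub>M seq_space)"
      by (intro measurable_compose[OF _ Q] measurable_Pair pre1 measurable_compose[OF measurable_snd s1])
    from nn_integral_freeze[OF this] show ?thesis
      by (simp add: Q_def arr_def arr_pre_def[abs_def])
  qed
  finally show ?thesis .
qed

end

context levy_poisson
begin

section \<open>Information available at an arrival time\<close>

definition info :: "nat \<Rightarrow> 'a \<Rightarrow> (real \<Rightarrow> real) \<times> (nat \<Rightarrow> real)" where
  "info k \<omega> = (pre (T k \<omega>) \<omega>, arr_pre k \<omega>)"

definition fut :: "nat \<Rightarrow> 'a \<Rightarrow> (real \<Rightarrow> real) \<times> (nat \<Rightarrow> real)" where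
  "fut k \<omega> = (post (T k \<omega>) \<omega>, arr_post k \<omega>)"

text \<open>\<open>G k\<close> is the information available at the \<open>k\<close>-th arrival time.\<close>

definition G :: "nat \<Rightarrow> 'a measure" where
  "G k = vimage_algebra (space M) (info k) (path_space \<Otimes>\<^sub>M seq_space)"

lemma T_pair_measurable: "(\<lambda>\<omega>. (T k \<omega>, \<omega>)) \<in> measurable M (borel \<Otimes>\<^sub>M FL)"
  by (intro measurable_Pair T_measurable id_measurable_FL)

lemma info_measurable [measurable]: "info k \<in> measurable M (path_space \<Otimes>\<^sub>M seq_space)"
  unfolding info_def
  using measurable_compose[OF T_pair_measurable pre_joint_measurable]
  by (intro measurable_Pair arr_pre_measurable) simp

lemma fut_measurable [measurable]: "fut k \<in> measurable M (path_space \<Otimes>\<^sub>M seq_space)"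
  unfolding fut_def
  using measurable_compose[OF T_pair_measurable post_joint_measurable]
  by (intro measurable_Pair arr_post_measurable) simp

lemma space_G [simp]: "space (G k) = space M"
  by (simp add: G_def)

lemma info_in: "info k \<in> space M \<rightarrow> space (path_space \<Otimes>\<^sub>M seq_space)"
  using measurable_space[OF info_measurable] by auto

lemma sets_G: "sets (G k) = {info k -` A \<inter> space M | A. A \<in> sets (path_space \<Otimes>\<^sub>M seq_space)}"
  unfolding G_def by (rule sets_vimage_algebra2[OF info_in])

lemma info_measurable_G: "info k \<in> measurable (G k) (path_space \<Otimes>\<^sub>M seq_space)"
  unfolding G_def by (rule measurable_vimage_algebra1[OF info_in])

lemma sets_G_subset: "sets (G k) \<subseteq> sets M"
  using measurable_sets[OF info_measurable] by (auto simp: sets_G)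

lemma measurable_G_imp: "X \<in> measurable (G k) N \<Longrightarrow> X \<in> measurable M N"
  using sets_G_subset[of k] by (auto simp: measurable_def)

lemma id_measurable_G [measurable]: "(\<lambda>\<omega>. \<omega>) \<in> measurable M (G k)"
  by (rule measurable_G_imp[of _ k]) simp

text \<open>Independence of the future from \<open>G k\<close>, obtained from
  \<open>strong_markov_nn\<close> for indicators of rectangles: sets of \<open>G k\<close> are
  preimages under \<open>info k\<close>.\<close>

lemma distr_fut:
  "distr M (G k \<Otimes>\<^sub>M (path_space \<Otimes>\<^sub>M seq_space)) (\<lambda>\<omega>. (\<omega>, fut k \<omega>))
    = distr M (G k) (\<lambda>\<omega>. \<omega>) \<Otimes>\<^sub>M distr M (path_space \<Otimes>\<^sub>M seq_space) (\<lambda>\<omega>. (path \<omega>, arr \<omega>))"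
proof (rule pair_measure_eqI[symmetric])
  let ?N = "path_space \<Otimes>\<^sub>M seq_space"
  have pa: "(\<lambda>\<omega>. (path \<omega>, arr \<omega>)) \<in> measurable M ?N" by measurable
  show "sigma_finite_measure (distr M (G k) (\<lambda>\<omega>. \<omega>))" "sigma_finite_measure (distr M ?N (\<lambda>\<omega>. (path \<omega>, arr \<omega>)))"
    by (auto intro!: prob_space_imp_sigma_finite prob_space_distr)
  show "sets (distr M (G k) (\<lambda>\<omega>. \<omega>) \<Otimes>\<^sub>M distr M ?N (\<lambda>\<omega>. (path \<omega>, arr \<omega>)))
      = sets (distr M (G k \<Otimes>\<^sub>M ?N) (\<lambda>\<omega>. (\<omega>, fut k \<omega>)))"
    by (simp cong: sets_pair_measure_cong)
  fix A B assume "A \<in> sets (distr M (G k) (\<lambda>\<omega>. \<omega>))" and "B \<in> sets (distr M ?N (\<lambda>\<omega>. (path \<omega>, arr \<omega>)))"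
  then have A: "A \<in> sets (G k)" and B: "B \<in> sets ?N" by simp_all
  then obtain A' where A': "A' \<in> sets ?N" "A = info k -` A' \<inter> space M" unfolding sets_G by auto
  have A_M: "A \<in> events" using A sets_G_subset by auto
  define F where "F p = (indicator A' (fst p) * indicator B (snd p) :: ennreal)" for p
  have F: "F \<in> borel_measurable (?N \<Otimes>\<^sub>M ?N)"
    unfolding F_def using A' B by measurable
  have "(\<integral>\<^sup>+\<omega>. indicator A \<omega> * indicator (fut k -` B \<inter> space M) \<omega> \<partial>M) = (\<integral>\<^sup>+\<omega>. F (info k \<omega>, fut k \<omega>) \<partial>M)"
    by (intro nn_integral_cong) (auto simp: F_def A'(2) indicator_def)
  also have "\<dots> = (\<integral>\<^sup>+\<omega>. (\<integral>\<^sup>+\<omega>'. F (info k \<omega>, (path \<omega>', arr \<omega>')) \<partial>M) \<partial>M)"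
    unfolding info_def fut_def by (rule strong_markov_nn[OF F])
  also have "\<dots> = (\<integral>\<^sup>+\<omega>. indicator A \<omega> * emeasure M ((\<lambda>\<omega>. (path \<omega>, arr \<omega>)) -` B \<inter> space M) \<partial>M)"
  proof (rule nn_integral_cong)
    fix \<omega> assume w: "\<omega> \<in> space M"
    have "(\<integral>\<^sup>+\<omega>'. F (info k \<omega>, (path \<omega>', arr \<omega>')) \<partial>M)
        = (\<integral>\<^sup>+\<omega>'. indicator A \<omega> * indicator ((\<lambda>\<omega>. (path \<omega>, arr \<omega>)) -` B \<inter> space M) \<omega>' \<partial>M)"
      using w by (intro nn_integral_cong) (auto simp: F_def A'(2) indicator_def)
    also have "\<dots> = indicator A \<omega> * emeasure M ((\<lambda>\<omega>. (path \<omega>, arr \<omega>)) -` B \<inter> space M)"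
      using measurable_sets[OF pa B] by (rule nn_integral_cmult_indicator)
    finally show "(\<integral>\<^sup>+\<omega>'. F (info k \<omega>, (path \<omega>', arr \<omega>')) \<partial>M)
        = indicator A \<omega> * emeasure M ((\<lambda>\<omega>. (path \<omega>, arr \<omega>)) -` B \<inter> space M)" .
  qed
  also have "\<dots> = emeasure M A * emeasure M ((\<lambda>\<omega>. (path \<omega>, arr \<omega>)) -` B \<inter> space M)"
    using A_M by (subst nn_integral_multc) auto
  finally have *: "(\<integral>\<^sup>+\<omega>. indicator A \<omega> * indicator (fut k -` B \<inter> space M) \<omega> \<partial>M)
      = emeasure M A * emeasure M ((\<lambda>\<omega>. (path \<omega>, arr \<omega>)) -` B \<inter> space M)" .
  have "(\<integral>\<^sup>+\<omega>. indicator A \<omega> * indicator (fut k -` B \<inter> space M) \<omega> \<partial>M) = emeasure M (A \<inter> (fut k -` B \<inter> space M))"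
    using A_M measurable_sets[OF fut_measurable B] by (simp add: indicator_inter_arith[symmetric])
  moreover have "(\<lambda>\<omega>. (\<omega>, fut k \<omega>)) -` (A \<times> B) \<inter> space M = A \<inter> (fut k -` B \<inter> space M)"
    using sets.sets_into_space[OF A_M] by auto
  moreover have "(\<lambda>\<omega>. \<omega>) -` A \<inter> space M = A" using sets.sets_into_space[OF A_M] by auto
  ultimately show "emeasure (distr M (G k) (\<lambda>\<omega>. \<omega>)) A * emeasure (distr M ?N (\<lambda>\<omega>. (path \<omega>, arr \<omega>))) B
      = emeasure (distr M (G k \<Otimes>\<^sub>M ?N) (\<lambda>\<omega>. (\<omega>, fut k \<omega>))) (A \<times> B)"
    using A B * pa by (simp add: emeasure_distr)
qed

text \<open>Stated for integrands on \<omega> itself, so that it applies to any quantity known at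
  the k-th arrival, such as a jump of an arbitrary strategy, without writing it as a function of
  \<open>info k\<close>.\<close>

lemma strong_markov:
  assumes H[measurable]: "H \<in> borel_measurable (G k \<Otimes>\<^sub>M (path_space \<Otimes>\<^sub>M seq_space))"
  shows "(\<integral>\<^sup>+\<omega>. H (\<omega>, fut k \<omega>) \<partial>M) = (\<integral>\<^sup>+\<omega>. (\<integral>\<^sup>+\<omega>'. H (\<omega>, (path \<omega>', arr \<omega>')) \<partial>M) \<partial>M)"
proof -
  let ?N = "path_space \<Otimes>\<^sub>M seq_space"
  have pa[measurable]: "(\<lambda>\<omega>. (path \<omega>, arr \<omega>)) \<in> measurable M ?N" by measurable
  interpret P1: prob_space "distr M (G k) (\<lambda>\<omega>. \<omega>)" by (rule prob_space_distr) simp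
  interpret P2: prob_space "distr M ?N (\<lambda>\<omega>. (path \<omega>, arr \<omega>))" by (rule prob_space_distr) simp
  have "(\<integral>\<^sup>+\<omega>. H (\<omega>, fut k \<omega>) \<partial>M) = (\<integral>\<^sup>+p. H p \<partial>distr M (G k \<Otimes>\<^sub>M ?N) (\<lambda>\<omega>. (\<omega>, fut k \<omega>)))"
    by (subst nn_integral_distr) auto
  also have "\<dots> = (\<integral>\<^sup>+\<omega>. (\<integral>\<^sup>+y. H (\<omega>, y) \<partial>distr M ?N (\<lambda>\<omega>. (path \<omega>, arr \<omega>))) \<partial>distr M (G k) (\<lambda>\<omega>. \<omega>))"
    unfolding distr_fut by (rule P2.nn_integral_fst[symmetric]) (simp cong: measurable_cong_sets sets_pair_measure_cong)
  also have "\<dots> = (\<integral>\<^sup>+\<omega>. (\<integral>\<^sup>+\<omega>'. H (\<omega>, (path \<omega>', arr \<omega>')) \<partial>M) \<partial>distr M (G k) (\<lambda>\<omega>. \<omega>))"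
    by (intro nn_integral_cong nn_integral_distr[OF pa]) auto
  also have "\<dots> = (\<integral>\<^sup>+\<omega>. (\<integral>\<^sup>+\<omega>'. H (\<omega>, (path \<omega>', arr \<omega>')) \<partial>M) \<partial>M)"
  proof -
    have "(\<lambda>p. H (fst p, (path (snd p), arr (snd p)))) \<in> borel_measurable (G k \<Otimes>\<^sub>M M)"
      by measurable
    then have "(\<lambda>\<omega>. \<integral>\<^sup>+\<omega>'. H (\<omega>, (path \<omega>', arr \<omega>')) \<partial>M) \<in> borel_measurable (G k)"
      by (intro borel_measurable_nn_integral) (simp add: split_beta')
    then show ?thesis by (subst nn_integral_distr) simp_all
  qed
  finally show ?thesis .
qed

lemma L_stopped_right:
  assumes w: "\<omega> \<in> space M" and "0 \<le> t" "0 \<le> c"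
  shows "((\<lambda>s. L (min s c) \<omega>) \<longlongrightarrow> L (min t c) \<omega>) (at_right t)"
proof (cases "t < c")
  case True
  have "\<forall>\<^sub>F s in at_right t. L s \<omega> = L (min s c) \<omega>"
    using eventually_at_right_real[OF True] by eventually_elim simp
  then have "((\<lambda>s. L (min s c) \<omega>) \<longlongrightarrow> L t \<omega>) (at_right t)"
    by (rule Lim_transform_eventually[OF L_right[OF w \<open>0 \<le> t\<close>]])
  then show ?thesis using True by (simp add: min_absorb1)
next
  case False
  have "\<forall>\<^sub>F s in at_right t. L (min t c) \<omega> = L (min s c) \<omega>"
    using eventually_at_right_less[of t] by eventually_elim (use False in \<open>simp add: min_absorb2\<close>)
  then show ?thesis
    by (rule Lim_transform_eventually[OF tendsto_const])
qed

lemma arr_pre_measurable_G: "arr_pre k \<in> measurable (G k) seq_space"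
  using measurable_compose[OF info_measurable_G measurable_snd] by (simp add: info_def)

lemma T_measurable_G: "j \<le> k \<Longrightarrow> T j \<in> borel_measurable (G k)"
  using measurable_compose[OF arr_pre_measurable_G[of k] measurable_component_singleton[of j]]
  by (simp add: arr_pre_def min_absorb1)

lemma L_stopped_measurable_G: "0 \<le> r \<Longrightarrow> (\<lambda>\<omega>. L (min r (T k \<omega>)) \<omega>) \<in> borel_measurable (G k)"
proof -
  assume r: "0 \<le> r"
  have "(\<lambda>\<omega>. fst (info k \<omega>) r) \<in> borel_measurable (G k)"
    by (rule measurable_compose[OF measurable_compose[OF info_measurable_G measurable_fst] measurable_component_singleton])
       (use r in simp)
  moreover have "fst (info k \<omega>) r = L (min r (T k \<omega>)) \<omega>" if "\<omega> \<in> space (G k)" for \<omega>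
    using r that T_nonneg[of \<omega> k] by (simp add: info_def pre_def max_absorb2)
  ultimately show ?thesis by (subst measurable_cong[of _ _ "\<lambda>\<omega>. fst (info k \<omega>) r"]) simp_all
qed

text \<open>The path stopped at the k-th arrival is right-continuous with values known at that
  arrival, hence can be evaluated at the earlier or equal random time \<open>T j\<close>.\<close>

lemma L_arrival_measurable_G:
  assumes "j \<le> k"
  shows "(\<lambda>\<omega>. L (T j \<omega>) \<omega>) \<in> borel_measurable (G k)"
proof -
  have "(\<lambda>p. (\<lambda>r \<omega>. L (min r (T k \<omega>)) \<omega>) (max 0 (fst p)) (snd p)) \<in> borel_measurable (borel \<Otimes>\<^sub>M G k)"
    by (rule right_continuous_joint_measurable)
       (simp_all add: L_stopped_measurable_G L_stopped_right T_nonneg)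
  from measurable_compose[OF measurable_Pair[OF T_measurable_G[OF assms] measurable_ident] this]
  have "(\<lambda>\<omega>. L (min (max 0 (T j \<omega>)) (T k \<omega>)) \<omega>) \<in> borel_measurable (G k)"
    by (simp add: id_def)
  moreover have "L (min (max 0 (T j \<omega>)) (T k \<omega>)) \<omega> = L (T j \<omega>) \<omega>" if "\<omega> \<in> space (G k)" for \<omega>
  proof -
    have "\<omega> \<in> space M" using that by simp
    then have "0 \<le> T j \<omega>" "T j \<omega> \<le> T k \<omega>"
      using T_nonneg monoD[OF strict_mono_mono[OF arrival_times.strict[OF arrival_times]] assms] by auto
    then show ?thesis by (simp add: max_absorb2 min_absorb1)
  qed
  ultimately show ?thesis by (subst (asm) measurable_cong) simp_all
qed

lemma rmax_arrivals_measurable_G: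
  assumes "j \<le> k"
  shows "(\<lambda>\<omega>. rmax (\<lambda>i. b - (x + L (T i \<omega>) \<omega>)) j) \<in> borel_measurable (G k)"
  using assms
proof (induction j)
  case (Suc j)
  note [measurable] = L_arrival_measurable_G[OF Suc.prems] Suc.IH[OF Suc_leD[OF Suc.prems]]
  show ?case unfolding rmax.simps by measurable
qed simp

lemma U_arrival_measurable_G: "(\<lambda>\<omega>. U b x (T k \<omega>) \<omega>) \<in> borel_measurable (G k)"
proof -
  note [measurable] = L_arrival_measurable_G[OF order_refl] rmax_arrivals_measurable_G[OF order_refl]
  have "(\<lambda>\<omega>. x + L (T k \<omega>) \<omega> + rmax (\<lambda>i. b - (x + L (T i \<omega>) \<omega>)) k) \<in> borel_measurable (G k)"
    by measurable
  then show ?thesis by (subst measurable_cong[OF U_arrival]) simp_all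
qed

text \<open>While s lies before the k-th arrival, stopping the path and the arrival sequence there
  changes nothing that is visible up to s. The sets with the stated trace property are closed under
  complements and countable unions and contain the generators.\<close>

lemma filtration_trace:
  assumes "0 \<le> s" and F: "F \<in> sets (natural_filtration M L T s)"
  shows "F \<inter> {\<omega> \<in> space M. s < T k \<omega>} \<in> sets (G k)"
proof -
  let ?S = "{\<omega> \<in> space M. s < T k \<omega>}"
  note [measurable] = T_measurable_G[OF order_refl, of k]
  have S: "?S \<in> sets (G k)"
    using borel_measurable_less[of "\<lambda>_. s" "G k" "T k"] by simp
  let ?A = "{L r -` B \<inter> space M | r B. 0 \<le> r \<and> r \<le> s \<and> B \<in> sets borel} \<union>
      {counting T r -` B \<inter> space M | r B. 0 \<le> r \<and> r \<le> s}"
  have "F \<in> sigma_sets (space M) ?A"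
    using F unfolding natural_filtration_def by (subst (asm) sets_measure_of) auto
  then show ?thesis
  proof (induction rule: sigma_sets.induct)
    case (Basic a)
    then show ?case
    proof
      assume "a \<in> {L r -` B \<inter> space M | r B. 0 \<le> r \<and> r \<le> s \<and> B \<in> sets borel}"
      then obtain r B where a: "a = L r -` B \<inter> space M" "0 \<le> r" "r \<le> s" "B \<in> sets borel" by auto
      have "a \<inter> ?S = ((\<lambda>\<omega>. L (min r (T k \<omega>)) \<omega>) -` B \<inter> space (G k)) \<inter> ?S"
        using a by (auto simp: min_def)
      then show ?thesis
        using S measurable_sets[OF L_stopped_measurable_G[OF a(2)] a(4)] by (simp only: sets.Int)
    next
      assume "a \<in> {counting T r -` B \<inter> space M | r B. 0 \<le> r \<and> r \<le> s}"
      then obtain r B where a: "a = counting T r -` B \<inter> space M" "0 \<le> r" "r \<le> s" by auto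
      have c: "(\<lambda>\<omega>. cnt (arr_pre k \<omega>) r) \<in> measurable (G k) (count_space UNIV)"
        using measurable_compose[OF measurable_Pair[OF arr_pre_measurable_G measurable_const] measurable_cnt, of r] by simp
      \<comment> \<open>Strictness matters: for r at or beyond the k-th arrival, all later entries
        of the stopped sequence would count as arrivals and the set being counted would be
        infinite.\<close>
      have "counting T r \<omega> = cnt (arr_pre k \<omega>) r" if "\<omega> \<in> space M" "s < T k \<omega>" for \<omega>
      proof -
        have "T j \<omega> \<le> r \<longleftrightarrow> T (min j k) \<omega> \<le> r" for j
          using monoD[OF strict_mono_mono[OF arrival_times.strict[OF arrival_times[OF that(1)]]], of k j] a(3) that(2)
          by (cases "j \<le> k") (auto simp: min_def)
        then show ?thesis by (simp add: counting_def arrivals_def cnt_def arr_pre_def)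
      qed
      then have "a \<inter> ?S = ((\<lambda>\<omega>. cnt (arr_pre k \<omega>) r) -` B \<inter> space (G k)) \<inter> ?S"
        using a by auto
      then show ?thesis
        using S measurable_sets[OF c, of B] by (simp only: sets.Int sets_count_space Pow_UNIV UNIV_I)
    qed
  next
    case Empty
    then show ?case by simp
  next
    case (Compl a)
    have "(space M - a) \<inter> ?S = ?S - (a \<inter> ?S)" by auto
    then show ?case using S Compl.IH by (simp only: sets.Diff)
  next
    case (Union a)
    have "(\<Union>i. a i) \<inter> ?S = (\<Union>i. a i \<inter> ?S)" by auto
    then show ?case using Union.IH by (simp only:) (rule sets.countable_UN, auto)
  qed
qed

text \<open>By left-continuity the value at the arrival is the limit of values at grid times
  strictly before it, and each of those is known by \<open>filtration_trace\<close>.\<close>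

lemma adapted_arrival_measurable_G:
  assumes cag: "\<And>\<omega>. \<omega> \<in> space M \<Longrightarrow> caglad (\<lambda>t. \<nu> t \<omega>)"
    and ad: "\<And>t. 0 \<le> t \<Longrightarrow> \<nu> t \<in> borel_measurable (natural_filtration M L T t)" and k: "1 \<le> k"
  shows "(\<lambda>\<omega>. \<nu> (T k \<omega>) \<omega>) \<in> borel_measurable (G k)"
proof -
  note [measurable] = T_measurable_G[OF order_refl, of k]
  \<comment> \<open>The indicator restricts to the event that s precedes the k-th arrival, where the
    filtration at s is contained in \<open>G k\<close> by the trace property.\<close>
  have cut: "(\<lambda>\<omega>. \<nu> s \<omega> * indicator {s<..} (T k \<omega>)) \<in> borel_measurable (G k)" if s: "0 \<le> s" for s
  proof (subst borel_measurable_iff_greater, rule allI)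
    fix a :: real
    have sp: "space (natural_filtration M L T s) = space M"
      unfolding natural_filtration_def by (rule space_measure_of) auto
    have "{\<omega> \<in> space M. a < \<nu> s \<omega>} \<in> sets (natural_filtration M L T s)"
      using ad[OF s] unfolding borel_measurable_iff_greater sp by simp
    from filtration_trace[OF s this]
    have 1: "{\<omega> \<in> space M. a < \<nu> s \<omega>} \<inter> {\<omega> \<in> space M. s < T k \<omega>} \<in> sets (G k)" .
    have 2: "{\<omega> \<in> space M. T k \<omega> \<le> s} \<in> sets (G k)"
      using borel_measurable_le[of "T k" "G k" "\<lambda>_. s"] by simp
    have "{\<omega> \<in> space (G k). a < \<nu> s \<omega> * indicator {s<..} (T k \<omega>)}
        = ({\<omega> \<in> space M. a < \<nu> s \<omega>} \<inter> {\<omega> \<in> space M. s < T k \<omega>}) \<union> (if a < 0 then {\<omega> \<in> space M. T k \<omega> \<le> s} else {})"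
      by (auto simp: indicator_def)
    then show "{\<omega> \<in> space (G k). a < \<nu> s \<omega> * indicator {s<..} (T k \<omega>)} \<in> sets (G k)"
      using 1 2 by (simp split: if_splits)
  qed
  \<comment> \<open>The mirror image of \<open>right_grid\<close>: the largest grid point of mesh
    1/(n+1) strictly below t > 0. The maximum with 1 keeps the time nonnegative for every integer
    index.\<close>
  define d where "d n t = real_of_int (max 1 \<lceil>real (Suc n) * t\<rceil> - 1) / real (Suc n)" for n :: nat and t :: real
  have d: "d n t < t" "t - 1 / real (Suc n) \<le> d n t" if t: "0 < t" for n t
  proof -
    have "0 < real (Suc n) * t" using t by simp
    then have eq: "max 1 \<lceil>real (Suc n) * t\<rceil> = \<lceil>real (Suc n) * t\<rceil>" by (intro max_absorb2) linarith
    have 1: "real_of_int (\<lceil>real (Suc n) * t\<rceil> - 1) < t * real (Suc n)"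
      by (simp only: mult.commute[of t]) linarith
    have 2: "real (Suc n) * t - 1 \<le> real_of_int (\<lceil>real (Suc n) * t\<rceil> - 1)"
      by linarith
    show "d n t < t"
      unfolding d_def eq by (subst pos_divide_less_eq) (simp, rule 1)
    have "t - 1 / real (Suc n) = (real (Suc n) * t - 1) / real (Suc n)"
      by (subst diff_divide_distrib) simp
    also have "\<dots> \<le> d n t"
      unfolding d_def eq by (rule divide_right_mono[OF 2]) simp
    finally show "t - 1 / real (Suc n) \<le> d n t" .
  qed
  have dlim: "filterlim (\<lambda>n. d n t) (at_left t) sequentially" if t: "0 < t" for t
    unfolding filterlim_at
  proof
    show "\<forall>\<^sub>F n in sequentially. d n t \<in> {..<t} \<and> d n t \<noteq> t"
      using d(1)[OF t] by (intro always_eventually allI) (metis lessThan_iff less_irrefl)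
    have lower: "(\<lambda>n. t - 1 / Suc n) \<longlonglongrightarrow> t"
      using tendsto_diff[OF tendsto_const LIMSEQ_inverse_real_of_nat, of t] by (simp add: inverse_eq_divide)
    show "(\<lambda>n. d n t) \<longlonglongrightarrow> t"
      by (rule tendsto_sandwich[OF always_eventually always_eventually lower tendsto_const])
         (simp_all only: less_imp_le[OF d(1)[OF t]] d(2)[OF t] simp_thms)
  qed
  show ?thesis
  proof (rule borel_measurable_LIMSEQ_real)
    fix \<omega> assume "\<omega> \<in> space (G k)"
    then have w: "\<omega> \<in> space M" by simp
    have t: "0 < T k \<omega>" using arrival_times.pos[OF arrival_times[OF w] k] .
    have "((\<lambda>s. \<nu> s \<omega>) \<longlongrightarrow> \<nu> (T k \<omega>) \<omega>) (at_left (T k \<omega>))"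
      using cag[OF w] t by (simp add: caglad_def)
    from filterlim_compose[OF this dlim[OF t]]
    show "(\<lambda>n. \<nu> (d n (T k \<omega>)) \<omega> * indicator {d n (T k \<omega>)<..} (T k \<omega>)) \<longlonglongrightarrow> \<nu> (T k \<omega>) \<omega>"
      using d(1)[OF t] by simp
  next
    fix n
    have "(\<lambda>\<omega>. \<nu> (real_of_int (max 1 i - 1) / real (Suc n)) \<omega> * indicator {real_of_int (max 1 i - 1) / real (Suc n)<..} (T k \<omega>))
        \<in> borel_measurable (G k)" for i :: int
      by (rule cut) simp
    moreover have "(\<lambda>\<omega>. \<lceil>real (Suc n) * T k \<omega>\<rceil>) \<in> measurable (G k) (count_space UNIV)"
      by measurable
    ultimately show "(\<lambda>\<omega>. \<nu> (d n (T k \<omega>)) \<omega> * indicator {d n (T k \<omega>)<..} (T k \<omega>)) \<in> borel_measurable (G k)"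
      unfolding d_def by (rule measurable_compose_countable)
  qed
qed

end

section \<open>Comparison with the barrier control\<close>

lemma flow_nn_integral_measurable:
  assumes [measurable]: "\<phi> \<in> borel_measurable borel" and y: "y \<in> borel_measurable N"
    and w: "w \<in> measurable N path_space" and t: "\<tau> \<in> measurable N seq_space" and q: "0 < q"
  shows "(\<lambda>x. \<integral>\<^sup>+s. \<phi> (barrier_flow b (y x) (w x) (\<tau> x) s) \<partial>discounting q) \<in> borel_measurable N"
proof -
  interpret finite_measure "discounting q" using q by (rule finite_measure_discounting)
  have "(\<lambda>p. barrier_flow b (y (fst p)) (w (fst p)) (\<tau> (fst p)) (snd p)) \<in> borel_measurable (N \<Otimes>\<^sub>M discounting q)"
    by (intro barrier_flow_measurable measurable_compose[OF measurable_fst y] measurable_compose[OF measurable_fst w]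
        measurable_compose[OF measurable_fst t]) (simp cong: measurable_cong_sets)
  then have "(\<lambda>p. \<phi> (barrier_flow b (y (fst p)) (w (fst p)) (\<tau> (fst p)) (snd p))) \<in> borel_measurable (N \<Otimes>\<^sub>M discounting q)"
    by (rule measurable_compose) measurable
  then show ?thesis
    by (intro borel_measurable_nn_integral) (simp add: split_beta')
qed

locale barrier_problem = levy_poisson M L T \<eta>
  for M :: "'a measure" and L :: "real \<Rightarrow> 'a \<Rightarrow> real" and T :: "nat \<Rightarrow> 'a \<Rightarrow> real" and \<eta> :: real +
  fixes q b :: real
  assumes q: "0 < q"
begin

sublocale disc: finite_measure "discounting q"
  using q by (rule finite_measure_discounting)

sublocale PN: pair_sigma_finite M "discounting q" ..

text \<open>For \<open>\<phi>\<close> the positive or the negative part of g this is the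
  corresponding half of the \<open>\<Gamma> y\<close> of the overview; with extended values it
  exists without integrability.\<close>

definition V :: "(real \<Rightarrow> ennreal) \<Rightarrow> real \<Rightarrow> ennreal" where
  "V \<phi> y = (\<integral>\<^sup>+\<omega>. (\<integral>\<^sup>+t. \<phi> (barrier_flow b y (path \<omega>) (arr \<omega>) t) \<partial>discounting q) \<partial>M)"

text \<open>Agrees with \<open>U b x\<close> at times t \<ge> 0; written through the flow it is
  jointly measurable in \<omega> and t.\<close>

definition Y :: "real \<Rightarrow> real \<Rightarrow> 'a \<Rightarrow> real" where
  "Y x t \<omega> = barrier_flow b x (path \<omega>) (arr \<omega>) t"

text \<open>The control that jumps by \<open>a k\<close> at the k-th arrival. The barrier control
  and, almost surely, every strategy have this form.\<close>

definition ctrl :: "(nat \<Rightarrow> 'a \<Rightarrow> real) \<Rightarrow> real \<Rightarrow> 'a \<Rightarrow> real" where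
  "ctrl a t \<omega> = (\<Sum>k\<in>{1..cnt (arr \<omega>) t}. a k \<omega>)"

lemma Y_measurable: "(\<lambda>p. Y x (snd p) (fst p)) \<in> borel_measurable (M \<Otimes>\<^sub>M discounting q)"
  unfolding Y_def
  by (intro barrier_flow_measurable measurable_compose[OF measurable_fst path_measurable] measurable_compose[OF measurable_fst arr_measurable])
     (simp_all cong: measurable_cong_sets)

lemma ctrl_measurable:
  assumes "\<And>k. 1 \<le> k \<Longrightarrow> a k \<in> borel_measurable M"
  shows "(\<lambda>p. ctrl a (snd p) (fst p)) \<in> borel_measurable (M \<Otimes>\<^sub>M discounting q)"
proof -
  have "(\<lambda>p. \<Sum>k\<in>{1..n}. a k (fst p)) \<in> borel_measurable (M \<Otimes>\<^sub>M discounting q)" for n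
    by (intro borel_measurable_sum measurable_compose[OF measurable_fst assms]) simp
  moreover have "(\<lambda>p. cnt (arr (fst p)) (snd p)) \<in> measurable (M \<Otimes>\<^sub>M discounting q) (count_space UNIV)"
  proof -
    have "(\<lambda>p. (arr (fst p), snd p)) \<in> measurable (M \<Otimes>\<^sub>M discounting q) (seq_space \<Otimes>\<^sub>M borel)"
      by (intro measurable_Pair measurable_compose[OF measurable_fst arr_measurable]) (simp cong: measurable_cong_sets)
    from measurable_compose[OF this measurable_cnt] show ?thesis by simp
  qed
  ultimately show ?thesis
    unfolding ctrl_def by (rule measurable_compose_countable)
qed

lemma ctrl_suminf:
  assumes w: "\<omega> \<in> space M" and nn: "\<And>k. 1 \<le> k \<Longrightarrow> 0 \<le> a k \<omega>"
  shows "ennreal (ctrl a t \<omega>) = (\<Sum>k. ennreal (a (Suc k) \<omega>) * indicator {T (Suc k) \<omega>..} t)"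
proof -
  have iff: "Suc k \<le> cnt (arr \<omega>) t \<longleftrightarrow> T (Suc k) \<omega> \<le> t" for k
    using arrival_times.le_cnt_iff[OF arrival_times[OF w], of "Suc k" t] by (simp add: arr_def)
  have "(\<Sum>k. ennreal (a (Suc k) \<omega>) * indicator {T (Suc k) \<omega>..} t)
      = (\<Sum>k<cnt (arr \<omega>) t. ennreal (a (Suc k) \<omega>) * indicator {T (Suc k) \<omega>..} t)"
    by (rule suminf_finite) (auto simp: indicator_def iff[symmetric])
  also have "\<dots> = (\<Sum>k<cnt (arr \<omega>) t. ennreal (a (Suc k) \<omega>))"
    using iff by (intro sum.cong) (auto simp: indicator_def Suc_le_eq)
  also have "\<dots> = ennreal (\<Sum>k<cnt (arr \<omega>) t. a (Suc k) \<omega>)"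
    using nn by (intro sum_ennreal) simp
  also have "(\<Sum>k<cnt (arr \<omega>) t. a (Suc k) \<omega>) = ctrl a t \<omega>"
    unfolding ctrl_def by (simp add: sum.atLeast1_atMost_eq)
  finally show ?thesis ..
qed

text \<open>Infinite sums start at 0 while arrivals start at 1, so index k belongs to arrival k +
  1.\<close>

definition jump_weight :: "(nat \<Rightarrow> 'a \<Rightarrow> real) \<Rightarrow> nat \<Rightarrow> 'a \<Rightarrow> ennreal" where
  "jump_weight a k \<omega> = ennreal (a (Suc k) \<omega>) * ennreal (exp (- q * T (Suc k) \<omega>))"

text \<open>The control only enters through its jumps, and at each arrival time the controlled process
  starts afresh: this is the strong Markov property in integrated form.\<close>

lemma nn_integral_ctrl:
  assumes \<phi>[measurable]: "\<phi> \<in> borel_measurable borel"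
    and a: "\<And>k. 1 \<le> k \<Longrightarrow> a k \<in> borel_measurable (G k)"
    and nn: "\<And>k \<omega>. 1 \<le> k \<Longrightarrow> \<omega> \<in> space M \<Longrightarrow> 0 \<le> a k \<omega>"
  shows "(\<integral>\<^sup>+\<omega>. (\<integral>\<^sup>+t. \<phi> (Y x t \<omega>) * ennreal (ctrl a t \<omega>) \<partial>discounting q) \<partial>M)
    = (\<Sum>k. \<integral>\<^sup>+\<omega>. jump_weight a k \<omega> * V \<phi> (U b x (T (Suc k) \<omega>) \<omega>) \<partial>M)"
proof -
  define W where "W y p = (\<integral>\<^sup>+s. \<phi> (barrier_flow b y (fst p) (snd p) s) \<partial>discounting q)" for y and p :: "(real \<Rightarrow> real) \<times> (nat \<Rightarrow> real)"
  define H where "H k p = jump_weight a k (fst p) * W (U b x (T (Suc k) (fst p)) (fst p)) (snd p)" for k p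
  have weight: "jump_weight a k \<in> borel_measurable (G (Suc k))" for k
  proof -
    note [measurable] = a[of "Suc k", simplified] T_measurable_G[OF order_refl, of "Suc k"]
    show ?thesis unfolding jump_weight_def by measurable
  qed
  have H: "H k \<in> borel_measurable (G (Suc k) \<Otimes>\<^sub>M (path_space \<Otimes>\<^sub>M seq_space))" for k
    unfolding H_def W_def
    by (intro borel_measurable_times_ennreal measurable_compose[OF measurable_fst weight]
        flow_nn_integral_measurable[OF \<phi>] measurable_compose[OF measurable_fst U_arrival_measurable_G]
        measurable_compose[OF measurable_snd measurable_fst] measurable_compose[OF measurable_snd measurable_snd] q)
  \<comment> \<open>A jump stays in force from its arrival on, so its contribution is an integral
    over a half-line; shifting time to the arrival and restarting the flow there leaves a functional
    of \<open>fut\<close>.\<close>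
  have path_eq: "(\<integral>\<^sup>+t. \<phi> (Y x t \<omega>) * ennreal (ctrl a t \<omega>) \<partial>discounting q) = (\<Sum>k. H k (\<omega>, fut (Suc k) \<omega>))"
    if w: "\<omega> \<in> space M" for \<omega>
  proof -
    have Ym[measurable]: "(\<lambda>t. Y x t \<omega>) \<in> borel_measurable borel"
      unfolding Y_def
      by (intro barrier_flow_measurable measurable_const)
         (use measurable_space[OF path_measurable w] in \<open>auto simp: space_PiM\<close>)
    have "(\<integral>\<^sup>+t. \<phi> (Y x t \<omega>) * ennreal (ctrl a t \<omega>) \<partial>discounting q)
        = (\<integral>\<^sup>+t. (\<Sum>k. ennreal (a (Suc k) \<omega>) * (\<phi> (Y x t \<omega>) * indicator {T (Suc k) \<omega>..} t)) \<partial>discounting q)"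
    proof (rule nn_integral_cong)
      fix t
      have "\<phi> (Y x t \<omega>) * ennreal (ctrl a t \<omega>) = (\<Sum>k. \<phi> (Y x t \<omega>) * (ennreal (a (Suc k) \<omega>) * indicator {T (Suc k) \<omega>..} t))"
        using nn w by (subst ctrl_suminf) auto
      then show "\<phi> (Y x t \<omega>) * ennreal (ctrl a t \<omega>)
          = (\<Sum>k. ennreal (a (Suc k) \<omega>) * (\<phi> (Y x t \<omega>) * indicator {T (Suc k) \<omega>..} t))"
        by (simp only: mult.left_commute)
    qed
    also have "\<dots> = (\<Sum>k. \<integral>\<^sup>+t. ennreal (a (Suc k) \<omega>) * (\<phi> (Y x t \<omega>) * indicator {T (Suc k) \<omega>..} t) \<partial>discounting q)"
      by (rule nn_integral_suminf) measurable
    also have "\<dots> = (\<Sum>k. H k (\<omega>, fut (Suc k) \<omega>))"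
    proof (rule suminf_cong)
      fix k
      have Tn: "0 \<le> T (Suc k) \<omega>" by (rule T_nonneg[OF w])
      have "(\<integral>\<^sup>+t. ennreal (a (Suc k) \<omega>) * (\<phi> (Y x t \<omega>) * indicator {T (Suc k) \<omega>..} t) \<partial>discounting q)
          = ennreal (a (Suc k) \<omega>) * (\<integral>\<^sup>+t. \<phi> (Y x t \<omega>) * indicator {T (Suc k) \<omega>..} t \<partial>discounting q)"
        by (rule nn_integral_cmult) measurable
      also have "(\<integral>\<^sup>+t. \<phi> (Y x t \<omega>) * indicator {T (Suc k) \<omega>..} t \<partial>discounting q)
          = ennreal (exp (- q * T (Suc k) \<omega>)) * (\<integral>\<^sup>+t. \<phi> (Y x (T (Suc k) \<omega> + t) \<omega>) \<partial>discounting q)"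
        by (rule nn_integral_discounting_shift[OF _ Tn]) measurable
      also have "(\<integral>\<^sup>+t. \<phi> (Y x (T (Suc k) \<omega> + t) \<omega>) \<partial>discounting q) = W (U b x (T (Suc k) \<omega>) \<omega>) (fut (Suc k) \<omega>)"
        unfolding W_def
      proof (rule nn_integral_cong_AE)
        show "AE t in discounting q. \<phi> (Y x (T (Suc k) \<omega> + t) \<omega>)
            = \<phi> (barrier_flow b (U b x (T (Suc k) \<omega>) \<omega>) (fst (fut (Suc k) \<omega>)) (snd (fut (Suc k) \<omega>)) t)"
          using AE_discounting
        proof eventually_elim
          case (elim t)
          then show ?case
            using U_eq_flow[OF w, of "T (Suc k) \<omega> + t" b x] U_restart[OF w elim, of b x "Suc k"] Tn
            by (simp add: Y_def fut_def)
        qed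
      qed
      finally show "(\<integral>\<^sup>+t. ennreal (a (Suc k) \<omega>) * (\<phi> (Y x t \<omega>) * indicator {T (Suc k) \<omega>..} t) \<partial>discounting q)
          = H k (\<omega>, fut (Suc k) \<omega>)"
        by (simp add: H_def jump_weight_def mult.assoc)
    qed
    finally show ?thesis .
  qed
  have "(\<integral>\<^sup>+\<omega>. (\<integral>\<^sup>+t. \<phi> (Y x t \<omega>) * ennreal (ctrl a t \<omega>) \<partial>discounting q) \<partial>M)
      = (\<integral>\<^sup>+\<omega>. (\<Sum>k. H k (\<omega>, fut (Suc k) \<omega>)) \<partial>M)"
    by (rule nn_integral_cong) (rule path_eq)
  also have "\<dots> = (\<Sum>k. \<integral>\<^sup>+\<omega>. H k (\<omega>, fut (Suc k) \<omega>) \<partial>M)"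
    by (intro nn_integral_suminf measurable_compose[OF _ H] measurable_Pair id_measurable_G fut_measurable)
  also have "\<dots> = (\<Sum>k. \<integral>\<^sup>+\<omega>. jump_weight a k \<omega> * V \<phi> (U b x (T (Suc k) \<omega>) \<omega>) \<partial>M)"
  proof (rule suminf_cong)
    fix k
    have "(\<integral>\<^sup>+\<omega>. H k (\<omega>, fut (Suc k) \<omega>) \<partial>M) = (\<integral>\<^sup>+\<omega>. (\<integral>\<^sup>+\<omega>'. H k (\<omega>, (path \<omega>', arr \<omega>')) \<partial>M) \<partial>M)"
      by (rule strong_markov[OF H])
    also have "\<dots> = (\<integral>\<^sup>+\<omega>. jump_weight a k \<omega> * V \<phi> (U b x (T (Suc k) \<omega>) \<omega>) \<partial>M)"
    proof (rule nn_integral_cong)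
      fix \<omega>
      have "(\<lambda>\<omega>'. \<integral>\<^sup>+t. \<phi> (barrier_flow b (U b x (T (Suc k) \<omega>) \<omega>) (path \<omega>') (arr \<omega>') t) \<partial>discounting q) \<in> borel_measurable M"
        by (intro flow_nn_integral_measurable[OF \<phi>] q) measurable
      then show "(\<integral>\<^sup>+\<omega>'. H k (\<omega>, (path \<omega>', arr \<omega>')) \<partial>M) = jump_weight a k \<omega> * V \<phi> (U b x (T (Suc k) \<omega>) \<omega>)"
        unfolding V_def H_def W_def fst_conv snd_conv by (rule nn_integral_cmult)
    qed
    finally show "(\<integral>\<^sup>+\<omega>. H k (\<omega>, fut (Suc k) \<omega>) \<partial>M) = (\<integral>\<^sup>+\<omega>. jump_weight a k \<omega> * V \<phi> (U b x (T (Suc k) \<omega>) \<omega>) \<partial>M)" .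
  qed
  finally show ?thesis .
qed

lemma jump_weight_measurable:
  assumes "\<And>k. 1 \<le> k \<Longrightarrow> a k \<in> borel_measurable (G k)"
  shows "jump_weight a k \<in> borel_measurable M"
proof -
  note [measurable] = measurable_G_imp[OF assms[of "Suc k", simplified]]
  show ?thesis unfolding jump_weight_def by measurable
qed

lemma V_one: "V (\<lambda>_. 1) y = ennreal (1 / q)"
  using nn_integral_discounting_exp[of 0 q] q by (simp add: V_def emeasure_space_1)

text \<open>The case of the constant payoff 1 in \<open>nn_integral_ctrl\<close>, for which
  \<open>V\<close> is 1/q.\<close>

lemma sum_jump_weight:
  assumes a: "\<And>k. 1 \<le> k \<Longrightarrow> a k \<in> borel_measurable (G k)"
    and nn: "\<And>k \<omega>. 1 \<le> k \<Longrightarrow> \<omega> \<in> space M \<Longrightarrow> 0 \<le> a k \<omega>"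
    and fin: "(\<integral>\<^sup>+\<omega>. (\<integral>\<^sup>+t. ennreal (ctrl a t \<omega>) \<partial>discounting q) \<partial>M) < \<top>"
  shows "(\<Sum>k. \<integral>\<^sup>+\<omega>. jump_weight a k \<omega> \<partial>M) < \<top>"
proof -
  note [measurable] = jump_weight_measurable[OF a]
  have "(\<integral>\<^sup>+\<omega>. (\<integral>\<^sup>+t. ennreal (ctrl a t \<omega>) \<partial>discounting q) \<partial>M) = (\<Sum>k. \<integral>\<^sup>+\<omega>. jump_weight a k \<omega> * ennreal (1 / q) \<partial>M)"
    using nn_integral_ctrl[of "\<lambda>_. 1" a 0] a nn by (simp add: V_one)
  also have "\<dots> = (\<Sum>k. \<integral>\<^sup>+\<omega>. jump_weight a k \<omega> \<partial>M) * ennreal (1 / q)"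
    by (simp add: nn_integral_multc)
  finally show ?thesis
    using fin q by (auto simp: ennreal_mult_less_top top_unique less_top)
qed

text \<open>At every arrival the barrier process is at or above b, so the values of \<open>V\<close>
  need only be compared there.\<close>

lemma nn_integral_ctrl_mono:
  assumes [measurable]: "\<phi> \<in> borel_measurable borel" "\<psi> \<in> borel_measurable borel"
    and a: "\<And>k. 1 \<le> k \<Longrightarrow> a k \<in> borel_measurable (G k)"
    and nn: "\<And>k \<omega>. 1 \<le> k \<Longrightarrow> \<omega> \<in> space M \<Longrightarrow> 0 \<le> a k \<omega>"
    and le: "\<And>y. b \<le> y \<Longrightarrow> V \<phi> y \<le> V \<psi> y"
  shows "(\<integral>\<^sup>+\<omega>. (\<integral>\<^sup>+t. \<phi> (Y x t \<omega>) * ennreal (ctrl a t \<omega>) \<partial>discounting q) \<partial>M)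
    \<le> (\<integral>\<^sup>+\<omega>. (\<integral>\<^sup>+t. \<psi> (Y x t \<omega>) * ennreal (ctrl a t \<omega>) \<partial>discounting q) \<partial>M)"
proof -
  have "(\<integral>\<^sup>+\<omega>. (\<integral>\<^sup>+t. \<phi> (Y x t \<omega>) * ennreal (ctrl a t \<omega>) \<partial>discounting q) \<partial>M)
      = (\<Sum>k. \<integral>\<^sup>+\<omega>. jump_weight a k \<omega> * V \<phi> (U b x (T (Suc k) \<omega>) \<omega>) \<partial>M)"
    by (rule nn_integral_ctrl) (use a nn in auto)
  also have "\<dots> \<le> (\<Sum>k. \<integral>\<^sup>+\<omega>. jump_weight a k \<omega> * V \<psi> (U b x (T (Suc k) \<omega>) \<omega>) \<partial>M)"
    by (intro suminf_le nn_integral_mono mult_left_mono le U_arrival_ge) auto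
  also have "\<dots> = (\<integral>\<^sup>+\<omega>. (\<integral>\<^sup>+t. \<psi> (Y x t \<omega>) * ennreal (ctrl a t \<omega>) \<partial>discounting q) \<partial>M)"
    by (rule nn_integral_ctrl[symmetric]) (use a nn in auto)
  finally show ?thesis .
qed

lemma nn_integral_ctrl_finite:
  assumes [measurable]: "\<phi> \<in> borel_measurable borel"
    and a: "\<And>k. 1 \<le> k \<Longrightarrow> a k \<in> borel_measurable (G k)"
    and nn: "\<And>k \<omega>. 1 \<le> k \<Longrightarrow> \<omega> \<in> space M \<Longrightarrow> 0 \<le> a k \<omega>"
    and fin: "(\<integral>\<^sup>+\<omega>. (\<integral>\<^sup>+t. ennreal (ctrl a t \<omega>) \<partial>discounting q) \<partial>M) < \<top>"
    and le: "\<And>y. b \<le> y \<Longrightarrow> V \<phi> y \<le> K" and K: "K < \<top>"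
  shows "(\<integral>\<^sup>+\<omega>. (\<integral>\<^sup>+t. \<phi> (Y x t \<omega>) * ennreal (ctrl a t \<omega>) \<partial>discounting q) \<partial>M) < \<top>"
proof -
  note [measurable] = jump_weight_measurable[OF a]
  have "(\<integral>\<^sup>+\<omega>. (\<integral>\<^sup>+t. \<phi> (Y x t \<omega>) * ennreal (ctrl a t \<omega>) \<partial>discounting q) \<partial>M)
      = (\<Sum>k. \<integral>\<^sup>+\<omega>. jump_weight a k \<omega> * V \<phi> (U b x (T (Suc k) \<omega>) \<omega>) \<partial>M)"
    by (rule nn_integral_ctrl) (use a nn in auto)
  also have "\<dots> \<le> (\<Sum>k. \<integral>\<^sup>+\<omega>. jump_weight a k \<omega> * K \<partial>M)"
    by (intro suminf_le nn_integral_mono mult_left_mono le U_arrival_ge) auto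
  also have "\<dots> = (\<Sum>k. \<integral>\<^sup>+\<omega>. jump_weight a k \<omega> \<partial>M) * K"
    by (simp add: nn_integral_multc)
  also have "\<dots> < \<top>"
    using sum_jump_weight[OF a nn fin] K by (simp add: ennreal_mult_less_top)
  finally show ?thesis .
qed

definition barrier_jump :: "real \<Rightarrow> nat \<Rightarrow> 'a \<Rightarrow> real" where
  "barrier_jump x k \<omega> = rmax (\<lambda>i. b - (x + L (T i \<omega>) \<omega>)) k - rmax (\<lambda>i. b - (x + L (T i \<omega>) \<omega>)) (k - 1)"

lemma barrier_jump_measurable: "barrier_jump x k \<in> borel_measurable (G k)"
proof -
  note [measurable] = rmax_arrivals_measurable_G[OF order_refl] rmax_arrivals_measurable_G[OF diff_le_self]
  show ?thesis unfolding barrier_jump_def by measurable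
qed

lemma barrier_jump_nonneg: "0 \<le> barrier_jump x k \<omega>"
  unfolding barrier_jump_def by (simp add: rmax_mono)

lemma ctrl_barrier_jump: "ctrl (barrier_jump x) t \<omega> = barrier_strategy L T b x t \<omega>"
  unfolding ctrl_def barrier_jump_def barrier_eq by (rule rmax_eq_sum[symmetric])

text \<open>Complementary slackness: the running maximum increases only when the current shortfall
  becomes the maximum, and then the process is lifted exactly to b.\<close>

lemma barrier_jump_at_barrier:
  assumes "\<omega> \<in> space M" "barrier_jump x (Suc k) \<omega> \<noteq> 0"
  shows "U b x (T (Suc k) \<omega>) \<omega> = b"
  using assms by (auto simp: U_arrival barrier_jump_def max_def split: if_splits)

lemma nn_integral_barrier:
  assumes [measurable]: "\<phi> \<in> borel_measurable borel"
  shows "(\<integral>\<^sup>+\<omega>. (\<integral>\<^sup>+t. \<phi> (Y x t \<omega>) * ennreal (ctrl (barrier_jump x) t \<omega>) \<partial>discounting q) \<partial>M)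
    = (\<Sum>k. \<integral>\<^sup>+\<omega>. jump_weight (barrier_jump x) k \<omega> * V \<phi> b \<partial>M)"
proof -
  have "jump_weight (barrier_jump x) k \<omega> * V \<phi> (U b x (T (Suc k) \<omega>) \<omega>) = jump_weight (barrier_jump x) k \<omega> * V \<phi> b"
    if "\<omega> \<in> space M" for k \<omega>
    using barrier_jump_at_barrier[OF that, of x k] by (cases "barrier_jump x (Suc k) \<omega> = 0") (auto simp: jump_weight_def)
  then show ?thesis
    using nn_integral_ctrl[OF assms, of "barrier_jump x" x] barrier_jump_measurable barrier_jump_nonneg
    by (simp cong: nn_integral_cong)
qed

end

text \<open>A strategy is tied to its jumps only almost surely, so cost integrands are identified
  with measurable functions only up to a null set; the completion makes them measurable.\<close>

lemma integral_completion_cong: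
  fixes f g :: "'a \<Rightarrow> real"
  assumes ae: "AE x in M. f x = g x" and g: "g \<in> borel_measurable M"
  shows "integral\<^sup>L (completion M) f = integral\<^sup>L M g"
proof -
  have ae': "AE x in completion M. f x = g x" using ae by (rule AE_completion)
  have gc: "g \<in> borel_measurable (completion M)" using g by (rule measurable_completion)
  have fc: "f \<in> borel_measurable (completion M)"
  proof (rule measurableI)
    fix A :: "real set" assume A: "A \<in> sets borel"
    show "f -` A \<inter> space (completion M) \<in> sets (completion M)"
    proof (rule completion.in_sets_AE[OF _ measurable_sets[OF gc A]])
      show "AE x in completion M. x \<in> g -` A \<inter> space (completion M) \<longleftrightarrow> x \<in> f -` A \<inter> space (completion M)"
        using ae' by eventually_elim auto
    qed auto
  qed simp
  have "integral\<^sup>L (completion M) f = integral\<^sup>L (completion M) g"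
    by (rule integral_cong_AE[OF fc gc ae'])
  also have "\<dots> = integral\<^sup>L M g" by (rule integral_completion[OF g])
  finally show ?thesis .
qed

section \<open>Comparison of costs on the product with discounted time\<close>

context barrier_problem
begin

abbreviation N :: "('a \<times> real) measure" where
  "N \<equiv> M \<Otimes>\<^sub>M discounting q"

text \<open>Only times \<open>t \<ge> 0\<close> carry mass, but \<open>L\<close> is not constrained at negative times.\<close>

definition X :: "real \<Rightarrow> 'a \<times> real \<Rightarrow> real" where
  "X x p = x + L (max 0 (snd p)) (fst p)"

lemma X_measurable [measurable]: "X x \<in> borel_measurable N"
proof -
  have "(\<lambda>p. (snd p, fst p)) \<in> measurable N (borel \<Otimes>\<^sub>M FL)"
    by (intro measurable_Pair measurable_compose[OF measurable_fst id_measurable_FL]) (simp cong: measurable_cong_sets)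
  from measurable_compose[OF this L_joint_measurable] show ?thesis
    unfolding X_def by simp
qed

lemma AE_N: "AE p in N. fst p \<in> space M \<and> 0 \<le> snd p"
proof (rule PN.AE_pair_measure)
  have "{p \<in> space N. fst p \<in> space M \<and> 0 \<le> snd p} = {p \<in> space N. 0 \<le> snd p}"
    by (auto simp: space_pair_measure)
  also have "\<dots> \<in> sets N"
    by (rule borel_measurable_le) (simp_all cong: measurable_cong_sets)
  finally show "{p \<in> space N. fst p \<in> space M \<and> 0 \<le> snd p} \<in> sets N" .
  have "AE y in discounting q. fst (x, y) \<in> space M \<and> 0 \<le> snd (x, y)" if "x \<in> space M" for x
    using AE_discounting by eventually_elim (use that in simp)
  then show "AE x in M. AE y in discounting q. fst (x, y) \<in> space M \<and> 0 \<le> snd (x, y)"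
    by (rule AE_I2)
qed

abbreviation YN :: "real \<Rightarrow> 'a \<times> real \<Rightarrow> real" where
  "YN x p \<equiv> Y x (snd p) (fst p)"

abbreviation RN :: "(nat \<Rightarrow> 'a \<Rightarrow> real) \<Rightarrow> 'a \<times> real \<Rightarrow> real" where
  "RN a p \<equiv> ctrl a (snd p) (fst p)"

lemma Y_eq: "\<omega> \<in> space M \<Longrightarrow> 0 \<le> t \<Longrightarrow> Y x t \<omega> = x + L t \<omega> + ctrl (barrier_jump x) t \<omega>"
  using U_eq_flow[of \<omega> t b x] by (simp add: Y_def U_def ctrl_barrier_jump)

lemma RN_nonneg:
  assumes "\<And>k \<omega>. 1 \<le> k \<Longrightarrow> \<omega> \<in> space M \<Longrightarrow> 0 \<le> a k \<omega>" "fst p \<in> space M"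
  shows "0 \<le> RN a p"
  unfolding ctrl_def using assms by (intro sum_nonneg) auto

text \<open>\<open>Vb\<close> is the equation \<open>\<Gamma> b = 0\<close> of the overview, split
  into positive and negative parts. The constant \<open>c\<close> will be C q, since a unit of
  control held over discounted time costs that much.\<close>

lemma barrier_cost_le:
  fixes f g :: "real \<Rightarrow> real"
  assumes mono: "mono g" and sub: "\<And>u v. f v \<ge> f u + (g u - c) * (v - u)"
    and Vb: "V (\<lambda>u. ennreal (max 0 (g u))) b = V (\<lambda>u. ennreal (max 0 (- g u))) b"
    and Vfin: "V (\<lambda>u. ennreal (max 0 (- g u))) b < \<top>"
    and a: "\<And>k. 1 \<le> k \<Longrightarrow> a k \<in> borel_measurable (G k)"
    and nn: "\<And>k \<omega>. 1 \<le> k \<Longrightarrow> \<omega> \<in> space M \<Longrightarrow> 0 \<le> a k \<omega>"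
    and fa: "integrable N (\<lambda>p. f (X x p + RN a p))" and Ra: "integrable N (RN a)"
    and fb: "integrable N (\<lambda>p. f (YN x p))" and Rb: "integrable N (RN (barrier_jump x))"
  shows "(LINT p|N. f (YN x p)) + c * (LINT p|N. RN (barrier_jump x) p)
    \<le> (LINT p|N. f (X x p + RN a p)) + c * (LINT p|N. RN a p)"
proof -
  let ?gp = "\<lambda>u. ennreal (max 0 (g u))" and ?gm = "\<lambda>u. ennreal (max 0 (- g u))"
  let ?B = "barrier_jump x"
  have g[measurable]: "g \<in> borel_measurable borel" using mono by (rule borel_measurable_mono)
  have gp: "?gp \<in> borel_measurable borel" and gm: "?gm \<in> borel_measurable borel" by measurable
  note [measurable] = Y_measurable
  have aM: "a k \<in> borel_measurable M" if "1 \<le> k" for k using measurable_G_imp[OF a[OF that]] .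
  have Ram[measurable]: "RN a \<in> borel_measurable N" using aM by (rule ctrl_measurable)
  have Rbm[measurable]: "RN ?B \<in> borel_measurable N"
    by (rule ctrl_measurable) (rule measurable_G_imp[OF barrier_jump_measurable])
  have flow: "g (barrier_flow b b w \<tau> t) \<le> g (barrier_flow b y w \<tau> t)" if "b \<le> y" for y w \<tau> t
    using mono barrier_flow_mono[OF that] by (rule monoD)
  have Vm: "V ?gm y \<le> V ?gm b" if "b \<le> y" for y
    unfolding V_def
    by (intro nn_integral_mono ennreal_leI max.mono order_refl) (simp only: neg_le_iff_le flow[OF that])
  have Vp: "V ?gp b \<le> V ?gp y" if "b \<le> y" for y
    unfolding V_def
    by (intro nn_integral_mono ennreal_leI max.mono order_refl flow[OF that])
  have Vmp: "V ?gm y \<le> V ?gp y" if "b \<le> y" for y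
    using Vm[OF that] Vp[OF that] unfolding Vb by (rule order_trans)
  have fst_eq: "(\<integral>\<^sup>+\<omega>. (\<integral>\<^sup>+t. \<phi> (Y x t \<omega>) * ennreal (ctrl d t \<omega>) \<partial>discounting q) \<partial>M) = (\<integral>\<^sup>+p. \<phi> (YN x p) * ennreal (RN d p) \<partial>N)"
    if "\<phi> \<in> borel_measurable borel" "RN d \<in> borel_measurable N" for \<phi> d
  proof -
    have "(\<lambda>p. \<phi> (YN x p) * ennreal (RN d p)) \<in> borel_measurable N"
      using that by measurable
    from disc.nn_integral_fst[OF this] show ?thesis by simp
  qed
  have real_eq: "ennreal (max 0 s) * ennreal r = ennreal (max 0 s * r)" for s r :: real
    by (simp add: ennreal_mult')
  have fin_of: "(\<integral>\<^sup>+\<omega>. (\<integral>\<^sup>+t. ennreal (ctrl d t \<omega>) \<partial>discounting q) \<partial>M) < \<top>" if "integrable N (RN d)" for d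
  proof -
    have "(\<integral>\<^sup>+\<omega>. (\<integral>\<^sup>+t. ennreal (ctrl d t \<omega>) \<partial>discounting q) \<partial>M) = (\<integral>\<^sup>+p. ennreal (RN d p) \<partial>N)"
      using fst_eq[of "\<lambda>_. 1" d] that by simp
    also have "\<dots> < \<top>" using integrableD(2)[OF that] nn_integral_mono[of N "\<lambda>p. ennreal (RN d p)" "\<lambda>p. ennreal (norm (RN d p))"]
      by (auto simp: less_top[symmetric] ennreal_leI top_unique)
    finally show ?thesis .
  qed
  have ma: "(\<integral>\<^sup>+p. ennreal (max 0 (- g (YN x p)) * RN a p) \<partial>N) < \<top>"
  proof -
    have "(\<integral>\<^sup>+\<omega>. (\<integral>\<^sup>+t. ?gm (Y x t \<omega>) * ennreal (ctrl a t \<omega>) \<partial>discounting q) \<partial>M) < \<top>"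
      by (rule nn_integral_ctrl_finite[OF gm a nn fin_of[OF Ra] Vm Vfin])
    then show ?thesis unfolding fst_eq[OF gm Ram] unfolding real_eq .
  qed
  have le_a: "(\<integral>\<^sup>+p. ennreal (max 0 (- g (YN x p)) * RN a p) \<partial>N) \<le> (\<integral>\<^sup>+p. ennreal (max 0 (g (YN x p)) * RN a p) \<partial>N)"
  proof -
    have "(\<integral>\<^sup>+\<omega>. (\<integral>\<^sup>+t. ?gm (Y x t \<omega>) * ennreal (ctrl a t \<omega>) \<partial>discounting q) \<partial>M)
        \<le> (\<integral>\<^sup>+\<omega>. (\<integral>\<^sup>+t. ?gp (Y x t \<omega>) * ennreal (ctrl a t \<omega>) \<partial>discounting q) \<partial>M)"
      by (rule nn_integral_ctrl_mono[OF gm gp a nn Vmp])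
    then show ?thesis unfolding fst_eq[OF gm Ram] fst_eq[OF gp Ram] unfolding real_eq .
  qed
  have mb: "(\<integral>\<^sup>+p. ennreal (max 0 (- g (YN x p)) * RN ?B p) \<partial>N) < \<top>"
  proof -
    have "(\<integral>\<^sup>+\<omega>. (\<integral>\<^sup>+t. ?gm (Y x t \<omega>) * ennreal (ctrl ?B t \<omega>) \<partial>discounting q) \<partial>M) < \<top>"
      by (rule nn_integral_ctrl_finite[OF gm barrier_jump_measurable barrier_jump_nonneg fin_of[OF Rb] Vm Vfin])
    then show ?thesis unfolding fst_eq[OF gm Rbm] unfolding real_eq .
  qed
  \<comment> \<open>Every jump of the barrier control carries the value at b, where the two parts of
    g balance.\<close>
  have eq_b: "(\<integral>\<^sup>+p. ennreal (max 0 (g (YN x p)) * RN ?B p) \<partial>N) = (\<integral>\<^sup>+p. ennreal (max 0 (- g (YN x p)) * RN ?B p) \<partial>N)"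
  proof -
    have "(\<integral>\<^sup>+\<omega>. (\<integral>\<^sup>+t. ?gp (Y x t \<omega>) * ennreal (ctrl ?B t \<omega>) \<partial>discounting q) \<partial>M)
        = (\<integral>\<^sup>+\<omega>. (\<integral>\<^sup>+t. ?gm (Y x t \<omega>) * ennreal (ctrl ?B t \<omega>) \<partial>discounting q) \<partial>M)"
      by (simp only: nn_integral_barrier[OF gp] nn_integral_barrier[OF gm] Vb)
    then show ?thesis unfolding fst_eq[OF gm Rbm] fst_eq[OF gp Rbm] unfolding real_eq .
  qed
  have Ra0: "AE p in N. 0 \<le> RN a p"
    using AE_N by eventually_elim (use nn in \<open>auto intro: RN_nonneg\<close>)
  have Rb0: "AE p in N. 0 \<le> RN ?B p"
    using AE_N by eventually_elim (use barrier_jump_nonneg in \<open>auto intro: RN_nonneg\<close>)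
  have i_ma: "integrable N (\<lambda>p. max 0 (- g (YN x p)) * RN a p)"
    using ma Ra0 by (intro integrableI_nonneg) auto
  have i_mb: "integrable N (\<lambda>p. max 0 (- g (YN x p)) * RN ?B p)"
    using mb Rb0 by (intro integrableI_nonneg) auto
  have i_pb: "integrable N (\<lambda>p. max 0 (g (YN x p)) * RN ?B p)"
    using mb Rb0 unfolding eq_b[symmetric] by (intro integrableI_nonneg) auto
  \<comment> \<open>The subgradient inequality at the barrier process with every product moved to
    the side where it occurs with a plus sign, because one of the four products is not yet known to
    be integrable.\<close>
  have pw: "AE p in N. f (YN x p) + c * RN ?B p + max 0 (g (YN x p)) * RN a p + max 0 (- g (YN x p)) * RN ?B p
      \<le> f (X x p + RN a p) + c * RN a p + max 0 (g (YN x p)) * RN ?B p + max 0 (- g (YN x p)) * RN a p"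
    using AE_N
  proof eventually_elim
    case (elim p)
    have Y: "YN x p = X x p + RN ?B p" using elim by (simp add: Y_eq X_def)
    have "f (YN x p) + (g (YN x p) - c) * (RN a p - RN ?B p) \<le> f (X x p + RN a p)"
      using sub[of "YN x p" "X x p + RN a p"] unfolding Y by simp
    moreover have "g (YN x p) = max 0 (g (YN x p)) - max 0 (- g (YN x p))" by simp
    ultimately show ?case by (smt (verit) left_diff_distrib right_diff_distrib)
  qed
  \<comment> \<open>In \<open>pw\<close> this nonnegative product is the only term whose
    integrability is still open, so solving for it gives an integrable bound.\<close>
  have i_pa: "integrable N (\<lambda>p. max 0 (g (YN x p)) * RN a p)"
  proof (rule Bochner_Integration.integrable_bound)
    show "integrable N (\<lambda>p. f (X x p + RN a p) + c * RN a p + max 0 (g (YN x p)) * RN ?B p + max 0 (- g (YN x p)) * RN a p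
        - f (YN x p) - c * RN ?B p - max 0 (- g (YN x p)) * RN ?B p)"
      by (intro Bochner_Integration.integrable_add Bochner_Integration.integrable_diff integrable_mult_right fa Ra fb Rb i_ma i_mb i_pb)
    show "AE p in N. norm (max 0 (g (YN x p)) * RN a p)
        \<le> norm (f (X x p + RN a p) + c * RN a p + max 0 (g (YN x p)) * RN ?B p + max 0 (- g (YN x p)) * RN a p
        - f (YN x p) - c * RN ?B p - max 0 (- g (YN x p)) * RN ?B p)"
      using pw Ra0
    proof eventually_elim
      case (elim p)
      have "0 \<le> max 0 (g (YN x p)) * RN a p" using elim(2) by simp
      then show ?case using elim(1) unfolding real_norm_def by linarith
    qed
  qed measurable
  have "(LINT p|N. f (YN x p) + c * RN ?B p + max 0 (g (YN x p)) * RN a p + max 0 (- g (YN x p)) * RN ?B p)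
      \<le> (LINT p|N. f (X x p + RN a p) + c * RN a p + max 0 (g (YN x p)) * RN ?B p + max 0 (- g (YN x p)) * RN a p)"
    by (intro integral_mono_AE pw Bochner_Integration.integrable_add integrable_mult_right fa Ra fb Rb i_ma i_mb i_pa i_pb)
  moreover have "(LINT p|N. f (YN x p) + c * RN ?B p + max 0 (g (YN x p)) * RN a p + max 0 (- g (YN x p)) * RN ?B p)
      = (LINT p|N. f (YN x p)) + c * (LINT p|N. RN ?B p) + (LINT p|N. max 0 (g (YN x p)) * RN a p) + (LINT p|N. max 0 (- g (YN x p)) * RN ?B p)"
    using fb Rb i_pa i_mb by simp
  moreover have "(LINT p|N. f (X x p + RN a p) + c * RN a p + max 0 (g (YN x p)) * RN ?B p + max 0 (- g (YN x p)) * RN a p)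
      = (LINT p|N. f (X x p + RN a p)) + c * (LINT p|N. RN a p) + (LINT p|N. max 0 (g (YN x p)) * RN ?B p) + (LINT p|N. max 0 (- g (YN x p)) * RN a p)"
    using fa Ra i_pb i_ma by simp
  moreover have "(LINT p|N. max 0 (g (YN x p)) * RN ?B p) = (LINT p|N. max 0 (- g (YN x p)) * RN ?B p)"
  proof -
    have "(LINT p|N. max 0 (g (YN x p)) * RN ?B p) = enn2real (\<integral>\<^sup>+p. ennreal (max 0 (g (YN x p)) * RN ?B p) \<partial>N)"
      using Rb0 by (intro integral_eq_nn_integral) auto
    moreover have "(LINT p|N. max 0 (- g (YN x p)) * RN ?B p) = enn2real (\<integral>\<^sup>+p. ennreal (max 0 (- g (YN x p)) * RN ?B p) \<partial>N)"
      using Rb0 by (intro integral_eq_nn_integral) auto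
    ultimately show ?thesis by (simp only: eq_b)
  qed
  moreover have "(LINT p|N. max 0 (- g (YN x p)) * RN a p) \<le> (LINT p|N. max 0 (g (YN x p)) * RN a p)"
  proof -
    have "ennreal (LINT p|N. max 0 (- g (YN x p)) * RN a p) \<le> ennreal (LINT p|N. max 0 (g (YN x p)) * RN a p)"
      using le_a Ra0 by (subst (1 2) nn_integral_eq_integral[symmetric]) (auto intro: i_ma i_pa)
    moreover have "0 \<le> (LINT p|N. max 0 (g (YN x p)) * RN a p)"
      using Ra0 by (intro integral_nonneg_AE) auto
    ultimately show ?thesis by (simp add: ennreal_le_iff)
  qed
  ultimately show ?thesis by linarith
qed

lemma integral_completion_iterated:
  assumes F: "integrable N F" and F': "AE \<omega> in M. \<forall>t\<ge>0. F' t \<omega> = F (\<omega>, t)"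
  shows "AE \<omega> in M. (LINT t:{0..}|lborel. exp (- q * t) * F' t \<omega>) = (LINT t|discounting q. F (\<omega>, t))"
    and "(LINT \<omega>|completion M. (LINT t:{0..}|lborel. exp (- q * t) * F' t \<omega>)) = (LINT p|N. F p)"
proof -
  have [measurable]: "F \<in> borel_measurable N" using F by auto
  have "(LINT t:{0..}|lborel. exp (- q * t) * F' t \<omega>) = (LINT t|discounting q. F (\<omega>, t))"
    if w: "\<omega> \<in> space M" and eq: "\<forall>t\<ge>0. F' t \<omega> = F (\<omega>, t)" for \<omega>
  proof -
    have "(\<lambda>t. F (\<omega>, t)) \<in> borel_measurable (discounting q)"
      by (rule measurable_compose[OF measurable_Pair1']) (use w in auto)
    then have m: "(\<lambda>t. F (\<omega>, t)) \<in> borel_measurable borel" by (simp cong: measurable_cong_sets)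
    have "(LINT t:{0..}|lborel. exp (- q * t) * F' t \<omega>) = (LINT t:{0..}|lborel. exp (- q * t) * F (\<omega>, t))"
      using eq by (intro set_lebesgue_integral_cong) auto
    then show ?thesis by (simp only: lintegral_discounting[OF m])
  qed
  with F' show ae: "AE \<omega> in M. (LINT t:{0..}|lborel. exp (- q * t) * F' t \<omega>) = (LINT t|discounting q. F (\<omega>, t))"
    using AE_space[of M] by (elim AE_mp) (auto intro!: AE_I2)
  have "(LINT \<omega>|completion M. (LINT t:{0..}|lborel. exp (- q * t) * F' t \<omega>)) = (LINT \<omega>|M. (LINT t|discounting q. F (\<omega>, t)))"
    by (rule integral_completion_cong[OF ae]) (rule borel_measurable_integrable[OF PN.integrable_fst'[OF F]])
  also have "\<dots> = (LINT p|N. F p)" by (rule PN.integral_fst'[OF F])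
  finally show "(LINT \<omega>|completion M. (LINT t:{0..}|lborel. exp (- q * t) * F' t \<omega>)) = (LINT p|N. F p)" .
qed

end

section \<open>Integrability\<close>

lemma even_power_add_le:
  fixes u v :: real
  assumes "even n"
  shows "(u + v) ^ n \<le> 2 ^ n * (u ^ n + v ^ n)"
proof -
  have "(u + v) ^ n = \<bar>u + v\<bar> ^ n" using assms by (simp add: power_even_abs)
  also have "\<dots> \<le> (2 * max \<bar>u\<bar> \<bar>v\<bar>) ^ n" by (intro power_mono) auto
  also have "\<dots> = 2 ^ n * max \<bar>u\<bar> \<bar>v\<bar> ^ n" by (simp add: power_mult_distrib)
  also have "max \<bar>u\<bar> \<bar>v\<bar> ^ n \<le> u ^ n + v ^ n"
    using assms by (auto simp: max_def power_even_abs zero_le_even_power)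
  finally show ?thesis by simp
qed

text \<open>Two applications of \<open>even_power_add_le\<close> give the factor 4^n; the factor in
  x absorbs the start and the extra 1 the leading constant. \<open>A\<close> stands for a sum that
  dominates the power of the control and whose integral can be computed.\<close>

lemma even_power_add3_le:
  fixes x l r A :: real
  assumes n: "even n" and A: "r ^ n \<le> A"
  shows "1 + (x + l + r) ^ n \<le> (4 ^ n * (1 + x ^ n) + 1) * (1 + l ^ n + A)"
proof -
  have nn: "0 \<le> x ^ n" "0 \<le> l ^ n" "0 \<le> r ^ n" "0 \<le> A"
    using n order_trans[OF _ A] by (simp_all add: zero_le_even_power)
  have four: "(4 :: real) ^ n = 2 ^ n * 2 ^ n" by (simp flip: power_mult_distrib)
  have two: "r ^ n \<le> 2 ^ n * r ^ n" using mult_right_mono[OF one_le_power[of "2 :: real" n] nn(3)] by simp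
  have "(x + l + r) ^ n \<le> 2 ^ n * ((x + l) ^ n + r ^ n)"
    by (rule even_power_add_le[OF n])
  also have "\<dots> \<le> 2 ^ n * (2 ^ n * (x ^ n + l ^ n) + 2 ^ n * r ^ n)"
    by (intro mult_left_mono add_mono even_power_add_le[OF n] two) simp
  also have "\<dots> = 4 ^ n * (x ^ n + l ^ n + r ^ n)"
    unfolding four by (simp only: distrib_left mult.assoc)
  also have "\<dots> \<le> 4 ^ n * ((1 + x ^ n) * (1 + l ^ n + A))"
  proof (rule mult_left_mono)
    have "x ^ n * 1 \<le> x ^ n * (1 + l ^ n + A)"
      using nn by (intro mult_left_mono) linarith+
    then show "x ^ n + l ^ n + r ^ n \<le> (1 + x ^ n) * (1 + l ^ n + A)"
      using A unfolding distrib_right[of 1] by simp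
  qed simp
  finally have "(x + l + r) ^ n \<le> 4 ^ n * (1 + x ^ n) * (1 + l ^ n + A)" by (simp only: mult.assoc)
  then show ?thesis using nn unfolding distrib_right[of _ 1] by simp
qed

context levy_poisson
begin

lemma nn_integral_exp_gap:
  assumes a: "0 < a"
  shows "(\<integral>\<^sup>+\<omega>. ennreal (exp (- a * gap i \<omega>)) \<partial>M) = ennreal (\<eta> / (\<eta> + a))"
proof -
  have "(\<integral>\<^sup>+\<omega>. ennreal (exp (- a * gap i \<omega>)) \<partial>M) = (\<integral>\<^sup>+u. ennreal (exp (- a * u)) \<partial>distr M borel (gap i))"
    by (subst nn_integral_distr) auto
  also have "\<dots> = (\<integral>\<^sup>+u. ennreal (exponential_density \<eta> u) * ennreal (exp (- a * u)) \<partial>lborel)"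
    unfolding distr_gap by (subst nn_integral_density) auto
  also have "\<dots> = (\<integral>\<^sup>+u. ennreal (\<eta> / (\<eta> + a)) * (ennreal ((\<eta> + a) * exp (- (\<eta> + a) * u)) * indicator {0..} u) \<partial>lborel)"
  proof (rule nn_integral_cong)
    fix u :: real
    show "ennreal (exponential_density \<eta> u) * ennreal (exp (- a * u))
        = ennreal (\<eta> / (\<eta> + a)) * (ennreal ((\<eta> + a) * exp (- (\<eta> + a) * u)) * indicator {0..} u)"
    proof (cases "0 \<le> u")
      case True
      have "exp (- u * \<eta>) * exp (- a * u) = exp (- (\<eta> + a) * u)"
        by (simp add: exp_add[symmetric] algebra_simps)
      moreover have "\<eta> / (\<eta> + a) * ((\<eta> + a) * exp (- (\<eta> + a) * u)) = \<eta> * exp (- (\<eta> + a) * u)"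
        using \<eta> a by simp
      ultimately have "\<eta> * exp (- u * \<eta>) * exp (- a * u) = \<eta> / (\<eta> + a) * ((\<eta> + a) * exp (- (\<eta> + a) * u))"
        by (simp only: mult.assoc)
      then show ?thesis
        using True \<eta> a by (simp add: exponential_density_def ennreal_mult'[symmetric] del: mult_minus_left mult_minus_right)
    qed (simp add: exponential_density_def)
  qed
  also have "\<dots> = ennreal (\<eta> / (\<eta> + a)) * ennreal (exp (- (\<eta> + a) * 0))"
    using \<eta> a by (subst nn_integral_cmult, measurable) (subst nn_integral_exp_Ici, auto)
  finally show ?thesis by simp
qed

text \<open>The k-th arrival is a sum of k independent exponential gaps. The ratio is below 1, so
  sums over arrivals become geometric series.\<close>

lemma nn_integral_exp_arrival:
  assumes a: "0 < a"
  shows "(\<integral>\<^sup>+\<omega>. ennreal (exp (- a * T k \<omega>)) \<partial>M) = ennreal ((\<eta> / (\<eta> + a)) ^ k)"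
proof -
  have "(\<integral>\<^sup>+\<omega>. ennreal (exp (- a * T k \<omega>)) \<partial>M) = (\<integral>\<^sup>+\<omega>. (\<Prod>i\<in>{..<k}. ennreal (exp (- a * gap i \<omega>))) \<partial>M)"
  proof (rule nn_integral_cong)
    fix \<omega> assume "\<omega> \<in> space M"
    then show "ennreal (exp (- a * T k \<omega>)) = (\<Prod>i\<in>{..<k}. ennreal (exp (- a * gap i \<omega>)))"
      by (simp add: T_eq_sum prod_ennreal exp_sum[symmetric] sum_distrib_left sum_negf)
  qed
  also have "\<dots> = (\<Prod>i\<in>{..<k}. \<integral>\<^sup>+\<omega>. ennreal (exp (- a * gap i \<omega>)) \<partial>M)"
    by (rule indep_vars_nn_integral[OF _ indep_vars_compose2[OF indep_vars_subset[OF indep_gaps]]]) auto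
  also have "\<dots> = ennreal ((\<eta> / (\<eta> + a)) ^ k)"
    using \<eta> a unfolding nn_integral_exp_gap[OF a] by (simp add: ennreal_power)
  finally show ?thesis .
qed

end

text \<open>The rate q/2 leaves half of the discount unspent, enough to integrate over time and to
  sum over arrivals.\<close>

locale barrier_moments = barrier_problem M L T \<eta> q b
  for M :: "'a measure" and L :: "real \<Rightarrow> 'a \<Rightarrow> real" and T :: "nat \<Rightarrow> 'a \<Rightarrow> real" and \<eta> q b :: real +
  fixes K :: real and m :: nat
  assumes K: "0 \<le> K" and m: "1 \<le> m"
    and moment: "\<And>t. 0 \<le> t \<Longrightarrow> (\<integral>\<^sup>+\<omega>. ennreal (L t \<omega> ^ (2 * m)) \<partial>M) \<le> ennreal (K * exp (q / 2 * t))"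
begin

text \<open>With frozen arrivals the moment bound applies at a fixed time; half of the discount
  offsets its growth and the other half yields the geometric factor.\<close>

lemma arrival_moment:
  "(\<integral>\<^sup>+\<omega>. ennreal (exp (- q * T k \<omega>)) * ennreal (L (T k \<omega>) \<omega> ^ (2 * m)) \<partial>M) \<le> ennreal (K * (\<eta> / (\<eta> + q / 2)) ^ k)"
proof -
  define H where "H p = ennreal (exp (- q * snd p k)) * ennreal (L (max 0 (snd p k)) (fst p) ^ (2 * m))" for p :: "'a \<times> (nat \<Rightarrow> real)"
  have c: "(\<lambda>p. snd p k) \<in> borel_measurable (FL \<Otimes>\<^sub>M seq_space)"
    by (rule measurable_compose[OF measurable_snd measurable_component_singleton]) simp
  have "(\<lambda>p. (snd p k, fst p)) \<in> measurable (FL \<Otimes>\<^sub>M seq_space) (borel \<Otimes>\<^sub>M FL)"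
    by (intro measurable_Pair c measurable_fst)
  from measurable_compose[OF this L_joint_measurable]
  have "(\<lambda>p. L (max 0 (snd p k)) (fst p)) \<in> borel_measurable (FL \<Otimes>\<^sub>M seq_space)" by simp
  note [measurable] = this c
  have H: "H \<in> borel_measurable (FL \<Otimes>\<^sub>M seq_space)"
    unfolding H_def by measurable
  have "(\<integral>\<^sup>+\<omega>. ennreal (exp (- q * T k \<omega>)) * ennreal (L (T k \<omega>) \<omega> ^ (2 * m)) \<partial>M) = (\<integral>\<^sup>+\<omega>. H (\<omega>, arr \<omega>) \<partial>M)"
    by (intro nn_integral_cong) (simp add: H_def arr_def T_nonneg max_absorb2)
  also have "\<dots> = (\<integral>\<^sup>+\<omega>'. (\<integral>\<^sup>+\<omega>. H (\<omega>, arr \<omega>') \<partial>M) \<partial>M)"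
    by (rule nn_integral_freeze[OF H])
  also have "\<dots> \<le> (\<integral>\<^sup>+\<omega>'. ennreal K * ennreal (exp (- (q / 2) * T k \<omega>')) \<partial>M)"
  proof (rule nn_integral_mono)
    fix \<omega>' assume w: "\<omega>' \<in> space M"
    have "(\<integral>\<^sup>+\<omega>. H (\<omega>, arr \<omega>') \<partial>M) = ennreal (exp (- q * T k \<omega>')) * (\<integral>\<^sup>+\<omega>. ennreal (L (T k \<omega>') \<omega> ^ (2 * m)) \<partial>M)"
      using T_nonneg[OF w, of k] by (simp add: H_def arr_def max_absorb2 nn_integral_cmult)
    also have "\<dots> \<le> ennreal (exp (- q * T k \<omega>')) * ennreal (K * exp (q / 2 * T k \<omega>'))"
      by (intro mult_left_mono moment T_nonneg[OF w]) simp
    also have "\<dots> = ennreal K * (ennreal (exp (- q * T k \<omega>')) * ennreal (exp (q / 2 * T k \<omega>')))"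
      using K by (simp add: ennreal_mult' mult_ac)
    also have "\<dots> = ennreal K * ennreal (exp (- (q / 2) * T k \<omega>'))"
      unfolding ennreal_exp_mult by (simp add: field_simps)
    finally show "(\<integral>\<^sup>+\<omega>. H (\<omega>, arr \<omega>') \<partial>M) \<le> ennreal K * ennreal (exp (- (q / 2) * T k \<omega>'))" .
  qed
  also have "\<dots> = ennreal (K * (\<eta> / (\<eta> + q / 2)) ^ k)"
    using K \<eta> q nn_integral_exp_arrival[of "q / 2" k]
    by (subst nn_integral_cmult) (simp_all add: ennreal_mult' del: times_divide_eq_left)
  finally show ?thesis .
qed

text \<open>Regarded as the k-th jump of a fictitious control, so that
  \<open>nn_integral_ctrl\<close> evaluates the discounted sum of these powers.\<close>

definition arr_power :: "real \<Rightarrow> nat \<Rightarrow> 'a \<Rightarrow> real" where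
  "arr_power x k \<omega> = (b - (x + L (T k \<omega>) \<omega>)) ^ (2 * m)"

lemma arr_power_measurable: "arr_power x k \<in> borel_measurable (G k)"
proof -
  note [measurable] = L_arrival_measurable_G[OF order_refl]
  show ?thesis unfolding arr_power_def by measurable
qed

lemma arr_power_nonneg: "0 \<le> arr_power x k \<omega>"
  by (simp add: arr_power_def)

text \<open>A common majorant, up to constants, for all functions of polynomial growth of the
  barrier process; the last summand dominates the even power of the barrier control.\<close>

definition Z :: "real \<Rightarrow> 'a \<times> real \<Rightarrow> real" where
  "Z x p = 1 + L (max 0 (snd p)) (fst p) ^ (2 * m) + RN (arr_power x) p"

lemma Z_parts_measurable [measurable]:
  "(\<lambda>p. L (max 0 (snd p)) (fst p)) \<in> borel_measurable N" "RN (arr_power x) \<in> borel_measurable N"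
  using X_measurable[of 0] ctrl_measurable[of "arr_power x", OF measurable_G_imp[OF arr_power_measurable]]
  by (simp_all add: X_def[abs_def])

text \<open>Each jump weight is bounded by a multiple of r^(k+1) with r < 1, so the sum over
  arrivals converges.\<close>

lemma nn_integral_arr_power: "(\<integral>\<^sup>+p. ennreal (RN (arr_power x) p) \<partial>N) < \<top>"
proof -
  \<comment> \<open>One constant above both coefficients that \<open>even_power_add_le\<close>
    produces when b - x and the path value are separated.\<close>
  define D where "D = 2 ^ (2 * m) * (1 + (b - x) ^ (2 * m))"
  have D: "0 \<le> D" "2 ^ (2 * m) * (b - x) ^ (2 * m) \<le> D" "2 ^ (2 * m) \<le> D"
    unfolding D_def distrib_left mult_1_right using zero_le_even_power'[of "b - x" m] by auto
  define r where "r = \<eta> / (\<eta> + q / 2)"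
  have r: "0 \<le> r" "r < 1" using \<eta> q by (auto simp: r_def field_simps)
  have le: "(\<integral>\<^sup>+\<omega>. jump_weight (arr_power x) k \<omega> \<partial>M) \<le> ennreal (D * (1 + K) * r ^ Suc k)" for k
  proof -
    note [measurable] = measurable_G_imp[OF L_arrival_measurable_G[OF order_refl]]
    have pw: "arr_power x (Suc k) \<omega> \<le> D + D * L (T (Suc k) \<omega>) \<omega> ^ (2 * m)" for \<omega>
    proof -
      have "arr_power x (Suc k) \<omega> \<le> 2 ^ (2 * m) * ((b - x) ^ (2 * m) + L (T (Suc k) \<omega>) \<omega> ^ (2 * m))"
        using even_power_add_le[of "2 * m" "b - x" "- L (T (Suc k) \<omega>) \<omega>"] by (simp add: arr_power_def algebra_simps)
      also have "\<dots> = 2 ^ (2 * m) * (b - x) ^ (2 * m) + 2 ^ (2 * m) * L (T (Suc k) \<omega>) \<omega> ^ (2 * m)"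
        by (simp add: distrib_left)
      also have "\<dots> \<le> D + D * L (T (Suc k) \<omega>) \<omega> ^ (2 * m)"
        using D by (intro add_mono mult_right_mono) auto
      finally show ?thesis .
    qed
    have "(\<integral>\<^sup>+\<omega>. jump_weight (arr_power x) k \<omega> \<partial>M)
        \<le> (\<integral>\<^sup>+\<omega>. ennreal D * ennreal (exp (- (q / 2) * T (Suc k) \<omega>))
           + ennreal D * (ennreal (exp (- q * T (Suc k) \<omega>)) * ennreal (L (T (Suc k) \<omega>) \<omega> ^ (2 * m))) \<partial>M)"
    proof (rule nn_integral_mono)
      fix \<omega> assume w: "\<omega> \<in> space M"
      \<comment> \<open>The discount is weakened to q/2 so that the constant term decays with the
        same ratio r as the moment term.\<close>
      have e: "exp (- q * T (Suc k) \<omega>) \<le> exp (- (q / 2) * T (Suc k) \<omega>)"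
        using q T_nonneg[OF w, of "Suc k"] by (simp add: field_simps)
      have "arr_power x (Suc k) \<omega> * exp (- q * T (Suc k) \<omega>)
          \<le> (D + D * L (T (Suc k) \<omega>) \<omega> ^ (2 * m)) * exp (- q * T (Suc k) \<omega>)"
        by (rule mult_right_mono[OF pw]) simp
      also have "\<dots> \<le> D * exp (- (q / 2) * T (Suc k) \<omega>) + D * (exp (- q * T (Suc k) \<omega>) * L (T (Suc k) \<omega>) \<omega> ^ (2 * m))"
        using mult_left_mono[OF e D(1)] by (simp add: algebra_simps)
      finally have "ennreal (arr_power x (Suc k) \<omega> * exp (- q * T (Suc k) \<omega>)) \<le> ennreal (D * exp (- (q / 2) * T (Suc k) \<omega>) + D * (exp (- q * T (Suc k) \<omega>) * L (T (Suc k) \<omega>) \<omega> ^ (2 * m)))"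
        by (rule ennreal_leI)
      then show "jump_weight (arr_power x) k \<omega> \<le> ennreal D * ennreal (exp (- (q / 2) * T (Suc k) \<omega>))
           + ennreal D * (ennreal (exp (- q * T (Suc k) \<omega>)) * ennreal (L (T (Suc k) \<omega>) \<omega> ^ (2 * m)))"
        using D(1) by (simp add: jump_weight_def ennreal_mult'[symmetric] ennreal_plus[symmetric] arr_power_nonneg
            del: ennreal_plus mult_minus_left)
    qed
    also have "\<dots> = ennreal D * ennreal (r ^ Suc k)
        + ennreal D * (\<integral>\<^sup>+\<omega>. ennreal (exp (- q * T (Suc k) \<omega>)) * ennreal (L (T (Suc k) \<omega>) \<omega> ^ (2 * m)) \<partial>M)"
      using nn_integral_exp_arrival[of "q / 2" "Suc k"] q
      by (simp add: nn_integral_add nn_integral_cmult r_def del: power_Suc times_divide_eq_left mult_minus_left)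
    also have "\<dots> \<le> ennreal D * ennreal (r ^ Suc k) + ennreal D * ennreal (K * r ^ Suc k)"
      using arrival_moment[of "Suc k"] by (intro add_left_mono mult_left_mono) (simp_all add: r_def)
    also have "\<dots> = ennreal (D * (1 + K) * r ^ Suc k)"
      using D(1) K r by (simp add: ennreal_mult'[symmetric] ennreal_plus[symmetric] algebra_simps del: ennreal_plus)
    finally show ?thesis .
  qed
  have "(\<integral>\<^sup>+\<omega>. (\<integral>\<^sup>+t. ennreal (ctrl (arr_power x) t \<omega>) \<partial>discounting q) \<partial>M)
      = (\<Sum>k. \<integral>\<^sup>+\<omega>. jump_weight (arr_power x) k \<omega> * ennreal (1 / q) \<partial>M)"
    using nn_integral_ctrl[of "\<lambda>_. 1" "arr_power x" 0] arr_power_measurable arr_power_nonneg by (simp add: V_one)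
  also have "\<dots> \<le> (\<Sum>k. ennreal (D * (1 + K) * r ^ Suc k * (1 / q)))"
  proof (rule suminf_le)
    fix k
    have "(\<integral>\<^sup>+\<omega>. jump_weight (arr_power x) k \<omega> * ennreal (1 / q) \<partial>M)
        = (\<integral>\<^sup>+\<omega>. jump_weight (arr_power x) k \<omega> \<partial>M) * ennreal (1 / q)"
      by (rule nn_integral_multc) (rule jump_weight_measurable[OF arr_power_measurable])
    also have "\<dots> \<le> ennreal (D * (1 + K) * r ^ Suc k) * ennreal (1 / q)"
      by (rule mult_right_mono[OF le]) simp
    finally show "(\<integral>\<^sup>+\<omega>. jump_weight (arr_power x) k \<omega> * ennreal (1 / q) \<partial>M) \<le> ennreal (D * (1 + K) * r ^ Suc k * (1 / q))"
      using D(1) K r q by (simp add: ennreal_mult'[symmetric] del: power_Suc)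
  qed auto
  also have "\<dots> < \<top>"
  proof -
    have "summable (\<lambda>k. D * (1 + K) * r ^ Suc k * (1 / q))"
      using r by (intro summable_mult2 summable_mult summable_Suc_iff[THEN iffD2] summable_geometric) auto
    moreover have "0 \<le> D * (1 + K) * r ^ Suc k * (1 / q)" for k using D(1) K r q by simp
    ultimately show ?thesis by (simp add: ennreal_suminf_neq_top less_top[symmetric])
  qed
  finally have "(\<integral>\<^sup>+\<omega>. (\<integral>\<^sup>+t. ennreal (ctrl (arr_power x) t \<omega>) \<partial>discounting q) \<partial>M) < \<top>" .
  then show ?thesis
    using disc.nn_integral_fst[of "\<lambda>p. ennreal (RN (arr_power x) p)" M] by simp
qed

lemma integrable_Z: "integrable N (Z x)"
proof -
  have P: "0 \<le> RN (arr_power x) p" for p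
    unfolding ctrl_def by (intro sum_nonneg) (simp add: arr_power_nonneg)
  have "integrable N (\<lambda>p. 1 :: real)"
  proof -
    have "(\<integral>\<^sup>+p. (1 :: ennreal) \<partial>N) = (\<integral>\<^sup>+\<omega>. (\<integral>\<^sup>+t. 1 \<partial>discounting q) \<partial>M)"
      by (subst disc.nn_integral_fst[symmetric]) auto
    also have "\<dots> = ennreal (1 / q)" using V_one[of 0] by (simp add: V_def)
    finally show ?thesis by (intro integrableI_nonneg) auto
  qed
  moreover have "integrable N (\<lambda>p. L (max 0 (snd p)) (fst p) ^ (2 * m))"
  proof (rule integrableI_nonneg)
    have "(\<integral>\<^sup>+p. ennreal (L (max 0 (snd p)) (fst p) ^ (2 * m)) \<partial>N)
        = (\<integral>\<^sup>+t. (\<integral>\<^sup>+\<omega>. ennreal (L (max 0 t) \<omega> ^ (2 * m)) \<partial>M) \<partial>discounting q)"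
      by (subst PN.nn_integral_snd[symmetric]) auto
    also have "\<dots> \<le> (\<integral>\<^sup>+t. ennreal K * ennreal (exp (q / 2 * t)) \<partial>discounting q)"
    proof (rule nn_integral_mono_AE)
      show "AE t in discounting q. (\<integral>\<^sup>+\<omega>. ennreal (L (max 0 t) \<omega> ^ (2 * m)) \<partial>M) \<le> ennreal K * ennreal (exp (q / 2 * t))"
        using AE_discounting
      proof eventually_elim
        case (elim t)
        then show ?case using moment[of t] K by (simp add: max_absorb2 ennreal_mult'[symmetric])
      qed
    qed
    also have "\<dots> = ennreal K * ennreal (1 / (q - q / 2))"
      using nn_integral_discounting_exp[of "q / 2" q] q
      by (subst nn_integral_cmult) (simp_all cong: measurable_cong_sets)
    also have "\<dots> < \<infinity>" by (simp add: ennreal_mult_less_top)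
    finally show "(\<integral>\<^sup>+p. ennreal (L (max 0 (snd p)) (fst p) ^ (2 * m)) \<partial>N) < \<infinity>" .
  qed auto
  moreover have "integrable N (RN (arr_power x))"
    using nn_integral_arr_power[of x] P by (intro integrableI_nonneg) auto
  ultimately show ?thesis
    unfolding Z_def[abs_def] by (intro Bochner_Integration.integrable_add)
qed

lemma barrier_control_power_le: "RN (barrier_jump x) p ^ (2 * m) \<le> RN (arr_power x) p"
  unfolding ctrl_barrier_jump barrier_eq using m
  by (simp only: ctrl_def arr_power_def) (intro rmax_power_le, auto)

lemma integrable_barrier_control: "integrable N (RN (barrier_jump x))"
proof (rule Bochner_Integration.integrable_bound[OF integrable_Z[of x]])
  show "AE p in N. norm (RN (barrier_jump x) p) \<le> norm (Z x p)"
  proof (rule AE_I2)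
    fix p
    have R: "0 \<le> RN (barrier_jump x) p"
      unfolding ctrl_def by (intro sum_nonneg) (simp add: barrier_jump_nonneg)
    have "RN (barrier_jump x) p \<le> 1 + RN (barrier_jump x) p ^ (2 * m)"
    proof (cases "1 \<le> RN (barrier_jump x) p")
      case True
      then have "RN (barrier_jump x) p ^ 1 \<le> RN (barrier_jump x) p ^ (2 * m)"
        using m by (intro power_increasing) auto
      then show ?thesis by simp
    next
      case False
      then show ?thesis using  zero_le_even_power'[of "RN (barrier_jump x) p" m] by linarith
    qed
    also have "\<dots> \<le> Z x p"
      unfolding Z_def using barrier_control_power_le[of x p] zero_le_even_power'[of "L (max 0 (snd p)) (fst p)" m] by linarith
    finally show "norm (RN (barrier_jump x) p) \<le> norm (Z x p)" using R by simp
  qed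
qed (rule ctrl_measurable, rule measurable_G_imp[OF barrier_jump_measurable])

lemma integrable_polynomial_growth:
  assumes [measurable]: "\<phi> \<in> borel_measurable borel" and \<phi>: "\<And>u. \<bar>\<phi> u\<bar> \<le> c * (1 + u ^ (2 * m))"
  shows "integrable N (\<lambda>p. \<phi> (YN x p))"
proof -
  note [measurable] = Y_measurable
  define D where "D = 4 ^ (2 * m) * (1 + x ^ (2 * m)) + 1"
  have c: "0 \<le> c" using order_trans[OF abs_ge_zero \<phi>[of 0]] m by (simp add: power_0_left)
  show ?thesis
  proof (rule Bochner_Integration.integrable_bound)
    show "integrable N (\<lambda>p. c * (D * Z x p))"
      by (intro integrable_mult_right integrable_Z)
    show "AE p in N. norm (\<phi> (YN x p)) \<le> norm (c * (D * Z x p))"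
      using AE_N
    proof eventually_elim
      case (elim p)
      let ?l = "L (max 0 (snd p)) (fst p)" and ?r = "RN (barrier_jump x) p" and ?n = "2 * m"
      have Y: "YN x p = x + ?l + ?r" using elim by (simp add: Y_eq)
      have "1 + YN x p ^ ?n \<le> D * Z x p"
        unfolding Y D_def Z_def by (rule even_power_add3_le) (simp, rule barrier_control_power_le)
      then have "\<bar>\<phi> (YN x p)\<bar> \<le> c * (D * Z x p)"
        using order_trans[OF \<phi>[of "YN x p"] mult_left_mono[OF _ c]] by simp
      then show ?case by simp
    qed
  qed measurable
qed

end

section \<open>The barrier control as a strategy\<close>

text \<open>Scaling t keeps the points positive for t > 0, so the process is never sampled at
  negative times; the double successor makes this true already for n = 0.\<close>

definition left_grid :: "nat \<Rightarrow> real \<Rightarrow> real" where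
  "left_grid n t = t - t / real (Suc (Suc n))"

lemma left_grid_bounds: "0 < t \<Longrightarrow> 0 < left_grid n t" "0 < t \<Longrightarrow> left_grid n t < t"
  by (simp_all add: left_grid_def divide_less_eq)

lemma left_grid_gap_tendsto: "(\<lambda>n. t / real (Suc (Suc n))) \<longlonglongrightarrow> 0"
  using LIMSEQ_Suc[OF LIMSEQ_inverse_real_of_nat[THEN tendsto_mult_right_zero, of t]] by (simp add: divide_inverse)

lemma left_grid_filterlim:
  assumes "0 < t"
  shows "filterlim (\<lambda>n. left_grid n t) (at_left t) sequentially"
  unfolding filterlim_at
proof
  show "\<forall>\<^sub>F n in sequentially. left_grid n t \<in> {..<t} \<and> left_grid n t \<noteq> t"
    using left_grid_bounds(2)[OF assms] by (intro always_eventually allI) (metis lessThan_iff less_irrefl)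
  show "(\<lambda>n. left_grid n t) \<longlonglongrightarrow> t"
    using tendsto_diff[OF tendsto_const left_grid_gap_tendsto, of t t] by (simp add: left_grid_def)
qed

text \<open>A limit along a sequence, so that adaptedness passes to it. At time 0 there is no left
  limit, and the default 0 is adapted and nonnegative.\<close>

definition left_lim :: "(real \<Rightarrow> real) \<Rightarrow> real \<Rightarrow> real" where
  "left_lim v t = (if t \<le> 0 then 0 else lim (\<lambda>n. v (left_grid n t)))"

lemma left_lim_eq:
  assumes "0 < t" "(v \<longlongrightarrow> l) (at_left t)"
  shows "left_lim v t = l"
  using filterlim_compose[OF assms(2) left_grid_filterlim[OF assms(1)]] assms(1)
  by (simp add: left_lim_def limI)

lemma left_lim_between:
  assumes l: "\<And>t. 0 < t \<Longrightarrow> \<exists>l. (v \<longlongrightarrow> l) (at_left t)"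
    and s: "0 \<le> a" "a < s" "s < c" and close: "\<And>r. a < r \<Longrightarrow> r < c \<Longrightarrow> \<bar>v r - w\<bar> \<le> e"
  shows "\<bar>left_lim v s - w\<bar> \<le> e"
proof -
  have "0 < s" using s by simp
  then obtain l' where l': "(v \<longlongrightarrow> l') (at_left s)" using l by blast
  have "((\<lambda>r. \<bar>v r - w\<bar>) \<longlongrightarrow> \<bar>l' - w\<bar>) (at_left s)"
    by (intro tendsto_intros l')
  moreover have "\<forall>\<^sub>F r in at_left s. \<bar>v r - w\<bar> \<le> e"
    using eventually_at_left_real[OF s(2)] by eventually_elim (use s close in auto)
  ultimately have "\<bar>l' - w\<bar> \<le> e" by (rule tendsto_upperbound) simp
  then show ?thesis using left_lim_eq[OF \<open>0 < s\<close> l'] by simp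
qed

text \<open>On a one-sided punctured neighbourhood where v is close to its limit, the left limits of
  v are equally close, so both one-sided limits of v are inherited.\<close>

lemma caglad_left_lim:
  assumes l: "\<And>t. 0 < t \<Longrightarrow> \<exists>l. (v \<longlongrightarrow> l) (at_left t)"
    and r: "\<And>t. 0 \<le> t \<Longrightarrow> (v \<longlongrightarrow> v t) (at_right t)"
  shows "caglad (left_lim v)"
  unfolding caglad_def
proof (intro conjI allI impI)
  fix t :: real assume t: "0 < t"
  obtain l' where l': "(v \<longlongrightarrow> l') (at_left t)" using l[OF t] by blast
  have eq: "left_lim v t = l'" by (rule left_lim_eq[OF t l'])
  show "(left_lim v \<longlongrightarrow> left_lim v t) (at_left t)"
    unfolding eq
  proof (rule tendstoI)
    fix e :: real assume "0 < e"
    then have "\<forall>\<^sub>F s in at_left t. dist (v s) l' < e / 2" using tendstoD[OF l', of "e / 2"] by simp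
    then obtain a where a: "a < t" "\<And>s. a < s \<Longrightarrow> s < t \<Longrightarrow> dist (v s) l' < e / 2"
      unfolding eventually_at_left_field by auto
    have "\<forall>\<^sub>F s in at_left t. max 0 a < s \<and> s < t"
      using eventually_at_left_real[of "max 0 a" t] t a(1) by simp
    then show "\<forall>\<^sub>F s in at_left t. dist (left_lim v s) l' < e"
    proof eventually_elim
      case (elim s)
      have "\<bar>left_lim v s - l'\<bar> \<le> e / 2"
        by (rule left_lim_between[OF l, of "max 0 a" s t]) (use elim a(2) in \<open>auto simp: dist_real_def intro: less_imp_le\<close>)
      then show ?case using \<open>0 < e\<close> by (simp add: dist_real_def)
    qed
  qed
next
  fix t :: real assume t: "0 \<le> t"
  show "\<exists>l. (left_lim v \<longlongrightarrow> l) (at_right t)"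
  proof (intro exI[of _ "v t"] tendstoI)
    fix e :: real assume "0 < e"
    then have "\<forall>\<^sub>F s in at_right t. dist (v s) (v t) < e / 2" using tendstoD[OF r[OF t], of "e / 2"] by simp
    then obtain c where c: "t < c" "\<And>s. t < s \<Longrightarrow> s < c \<Longrightarrow> dist (v s) (v t) < e / 2"
      unfolding eventually_at_right_field by auto
    have "\<forall>\<^sub>F s in at_right t. t < s \<and> s < c"
      using eventually_at_right_real[OF c(1)] by simp
    then show "\<forall>\<^sub>F s in at_right t. dist (left_lim v s) (v t) < e"
    proof eventually_elim
      case (elim s)
      have "\<bar>left_lim v s - v t\<bar> \<le> e / 2"
        by (rule left_lim_between[OF l, of t s c]) (use elim c(2) t in \<open>auto simp: dist_real_def intro: less_imp_le\<close>)
      then show ?case using \<open>0 < e\<close> by (simp add: dist_real_def)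
    qed
  qed
qed

lemma left_lim_nonneg:
  assumes l: "\<And>t. 0 < t \<Longrightarrow> \<exists>l. (v \<longlongrightarrow> l) (at_left t)" and "\<And>t. 0 \<le> v t"
  shows "0 \<le> left_lim v t"
proof (cases "0 < t")
  case True
  then obtain l' where l': "(v \<longlongrightarrow> l') (at_left t)" using l by blast
  have "0 \<le> l'" by (rule tendsto_lowerbound[OF l']) (use assms(2) in auto)
  then show ?thesis using left_lim_eq[OF True l'] by simp
qed (simp add: left_lim_def)

section \<open>No jumps of the path at arrivals\<close>

context levy_poisson
begin

text \<open>By stationarity the increment over [t - \<delta>, t] has the law of
  \<open>L \<delta>\<close>, which tends to 0 with \<delta> by right-continuity at 0. Truncating at
  1 gives bounded integrals, and Fatou's lemma transfers the limit to the jump at t.\<close>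

lemma AE_no_fixed_jump:
  assumes t: "0 < t"
  shows "AE \<omega> in M. left_lim (\<lambda>s. L s \<omega>) t = L t \<omega>"
proof -
  have [measurable]: "L (left_grid n t) \<in> borel_measurable M" for n
    using left_grid_bounds(1)[OF t, of n] by simp
  have [measurable]: "L t \<in> borel_measurable M" using t by simp
  define \<delta> where "\<delta> n = t / real (Suc (Suc n))" for n
  have gap: "0 \<le> \<delta> n" "0 < \<delta> n" for n using t by (simp_all add: \<delta>_def)
  have grid: "left_grid n t + \<delta> n = t" for n by (simp add: left_grid_def \<delta>_def)
  have \<delta>_lim: "\<delta> \<longlonglongrightarrow> 0" using left_grid_gap_tendsto[of t] by (simp add: \<delta>_def[abs_def])
  note [measurable] = L_measurable[OF gap(1)]
  have lim: "(\<lambda>n. L (left_grid n t) \<omega>) \<longlonglongrightarrow> left_lim (\<lambda>s. L s \<omega>) t" if w: "\<omega> \<in> space M" for \<omega>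
  proof -
    obtain l where l: "((\<lambda>s. L s \<omega>) \<longlongrightarrow> l) (at_left t)" using L_left[OF w t] by blast
    show ?thesis
      using filterlim_compose[OF l left_grid_filterlim[OF t]] left_lim_eq[OF t l] by simp
  qed
  have meas[measurable]: "(\<lambda>\<omega>. left_lim (\<lambda>s. L s \<omega>) t) \<in> borel_measurable M"
    by (rule borel_measurable_LIMSEQ_real[OF lim]) auto
  have zero: "(\<lambda>n. \<integral>\<^sup>+\<omega>. ennreal (min 1 \<bar>L (\<delta> n) \<omega>\<bar>) \<partial>M) \<longlonglongrightarrow> (\<integral>\<^sup>+\<omega>. 0 \<partial>M)"
  proof (rule nn_integral_dominated_convergence[where w = "\<lambda>_. 1"])
    show "AE \<omega> in M. (\<lambda>n. ennreal (min 1 \<bar>L (\<delta> n) \<omega>\<bar>)) \<longlonglongrightarrow> 0"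
    proof (rule AE_I2)
      fix \<omega> assume w: "\<omega> \<in> space M"
      have "filterlim (\<lambda>n. \<delta> n) (at_right 0) sequentially"
        unfolding filterlim_at using \<delta>_lim gap(2) by (auto intro!: always_eventually simp: less_imp_neq[symmetric])
      from filterlim_compose[OF L_right[OF w order_refl] this]
      have "(\<lambda>n. L (\<delta> n) \<omega>) \<longlonglongrightarrow> 0" by (simp add: L_zero[OF w])
      then have "(\<lambda>n. min 1 \<bar>L (\<delta> n) \<omega>\<bar>) \<longlonglongrightarrow> min 1 \<bar>0\<bar>"
        by (intro tendsto_min tendsto_const tendsto_rabs)
      then show "(\<lambda>n. ennreal (min 1 \<bar>L (\<delta> n) \<omega>\<bar>)) \<longlonglongrightarrow> 0"
        using tendsto_ennrealI by force
    qed
    show "AE \<omega> in M. ennreal (min 1 \<bar>L (\<delta> n) \<omega>\<bar>) \<le> 1" for n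
      by (intro AE_I2) (simp add: ennreal_le_1)
  qed (auto simp: emeasure_space_1)
  have "(\<integral>\<^sup>+\<omega>. ennreal (min 1 \<bar>L t \<omega> - left_lim (\<lambda>s. L s \<omega>) t\<bar>) \<partial>M)
      = (\<integral>\<^sup>+\<omega>. liminf (\<lambda>n. ennreal (min 1 \<bar>L t \<omega> - L (left_grid n t) \<omega>\<bar>)) \<partial>M)"
  proof (rule nn_integral_cong)
    fix \<omega> assume w: "\<omega> \<in> space M"
    have "(\<lambda>n. ennreal (min 1 \<bar>L t \<omega> - L (left_grid n t) \<omega>\<bar>)) \<longlonglongrightarrow> ennreal (min 1 \<bar>L t \<omega> - left_lim (\<lambda>s. L s \<omega>) t\<bar>)"
      by (intro tendsto_ennrealI tendsto_min tendsto_const tendsto_rabs tendsto_diff lim[OF w])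
    then show "ennreal (min 1 \<bar>L t \<omega> - left_lim (\<lambda>s. L s \<omega>) t\<bar>) = liminf (\<lambda>n. ennreal (min 1 \<bar>L t \<omega> - L (left_grid n t) \<omega>\<bar>))"
      by (intro lim_imp_Liminf[symmetric]) auto
  qed
  also have "\<dots> \<le> liminf (\<lambda>n. \<integral>\<^sup>+\<omega>. ennreal (min 1 \<bar>L t \<omega> - L (left_grid n t) \<omega>\<bar>) \<partial>M)"
    by (rule nn_integral_liminf) measurable
  also have "(\<lambda>n. \<integral>\<^sup>+\<omega>. ennreal (min 1 \<bar>L t \<omega> - L (left_grid n t) \<omega>\<bar>) \<partial>M)
      = (\<lambda>n. \<integral>\<^sup>+\<omega>. ennreal (min 1 \<bar>L (\<delta> n) \<omega>\<bar>) \<partial>M)"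
  proof
    fix n
    have "(\<integral>\<^sup>+\<omega>. ennreal (min 1 \<bar>L t \<omega> - L (left_grid n t) \<omega>\<bar>) \<partial>M)
        = (\<integral>\<^sup>+u. ennreal (min 1 \<bar>u\<bar>) \<partial>distr M borel (\<lambda>\<omega>. L (left_grid n t + \<delta> n) \<omega> - L (left_grid n t) \<omega>))"
      by (subst nn_integral_distr) (auto simp: grid)
    also have "\<dots> = (\<integral>\<^sup>+\<omega>. ennreal (min 1 \<bar>L (\<delta> n) \<omega>\<bar>) \<partial>M)"
      unfolding stationary[OF less_imp_le[OF left_grid_bounds(1)[OF t]] gap(1)]
      by (subst nn_integral_distr) auto
    finally show "(\<integral>\<^sup>+\<omega>. ennreal (min 1 \<bar>L t \<omega> - L (left_grid n t) \<omega>\<bar>) \<partial>M)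
        = (\<integral>\<^sup>+\<omega>. ennreal (min 1 \<bar>L (\<delta> n) \<omega>\<bar>) \<partial>M)" .
  qed
  also have "liminf (\<lambda>n. \<integral>\<^sup>+\<omega>. ennreal (min 1 \<bar>L (\<delta> n) \<omega>\<bar>) \<partial>M) = 0"
    using zero by (intro lim_imp_Liminf) auto
  finally have "(\<integral>\<^sup>+\<omega>. ennreal (min 1 \<bar>L t \<omega> - left_lim (\<lambda>s. L s \<omega>) t\<bar>) \<partial>M) = 0" by simp
  then have "AE \<omega> in M. ennreal (min 1 \<bar>L t \<omega> - left_lim (\<lambda>s. L s \<omega>) t\<bar>) = 0"
    by (subst (asm) nn_integral_0_iff_AE) auto
  then show ?thesis by eventually_elim (auto simp: min_def split: if_splits)
qed

text \<open>Arrivals are independent of the path; once frozen they are fixed times, at which almost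
  surely nothing jumps.\<close>

lemma AE_no_jump_at_arrival: "AE \<omega> in M. \<forall>k\<ge>1. left_lim (\<lambda>s. L s \<omega>) (T k \<omega>) = L (T k \<omega>) \<omega>"
proof -
  have "AE \<omega> in M. left_lim (\<lambda>s. L s \<omega>) (T k \<omega>) = L (T k \<omega>) \<omega>" if k: "1 \<le> k" for k
  proof -
    \<comment> \<open>The limit is spelled out with times truncated at 0 because \<open>H\<close>
      must be measurable on the whole sequence space, where the coordinate may be negative.\<close>
    define H where "H p = (if lim (\<lambda>n. L (max 0 (left_grid n (snd p k))) (fst p)) = L (max 0 (snd p k)) (fst p) then 0 else 1 :: ennreal)"
      for p :: "'a \<times> (nat \<Rightarrow> real)"
    have c: "(\<lambda>p. snd p k) \<in> borel_measurable (FL \<Otimes>\<^sub>M seq_space)"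
      by (rule measurable_compose[OF measurable_snd measurable_component_singleton]) simp
    have Lc: "(\<lambda>p. L (max 0 (h (snd p k))) (fst p)) \<in> borel_measurable (FL \<Otimes>\<^sub>M seq_space)" if h: "h \<in> borel_measurable borel" for h
    proof -
      have "(\<lambda>p. (h (snd p k), fst p)) \<in> measurable (FL \<Otimes>\<^sub>M seq_space) (borel \<Otimes>\<^sub>M FL)"
        by (intro measurable_Pair measurable_compose[OF c h] measurable_fst)
      from measurable_compose[OF this L_joint_measurable] show ?thesis by simp
    qed
    have [measurable]: "(\<lambda>p. L (max 0 (left_grid n (snd p k))) (fst p)) \<in> borel_measurable (FL \<Otimes>\<^sub>M seq_space)" for n
      by (rule Lc) (simp add: left_grid_def)
    have [measurable]: "(\<lambda>p. L (max 0 (snd p k)) (fst p)) \<in> borel_measurable (FL \<Otimes>\<^sub>M seq_space)"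
      by (rule Lc[of "\<lambda>t. t"]) simp
    have H: "H \<in> borel_measurable (FL \<Otimes>\<^sub>M seq_space)"
      unfolding H_def by measurable
    have Heq: "H (\<omega>, arr \<omega>') = (if left_lim (\<lambda>s. L s \<omega>) (T k \<omega>') = L (T k \<omega>') \<omega> then 0 else 1)"
      if "\<omega>' \<in> space M" for \<omega> \<omega>'
    proof -
      have "0 < T k \<omega>'" using arrival_times.pos[OF arrival_times[OF that] k] .
      then show ?thesis
        using left_grid_bounds(1)[of "T k \<omega>'"] by (simp add: H_def arr_def left_lim_def max_absorb2 less_imp_le)
    qed
    have "(\<integral>\<^sup>+\<omega>. H (\<omega>, arr \<omega>) \<partial>M) = (\<integral>\<^sup>+\<omega>'. (\<integral>\<^sup>+\<omega>. H (\<omega>, arr \<omega>') \<partial>M) \<partial>M)"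
      by (rule nn_integral_freeze[OF H])
    also have "\<dots> = (\<integral>\<^sup>+\<omega>'. 0 \<partial>M)"
    proof (rule nn_integral_cong)
      fix \<omega>' assume w: "\<omega>' \<in> space M"
      have "(\<integral>\<^sup>+\<omega>. H (\<omega>, arr \<omega>') \<partial>M) = (\<integral>\<^sup>+\<omega>. 0 \<partial>M)"
      proof (rule nn_integral_cong_AE)
        show "AE \<omega> in M. H (\<omega>, arr \<omega>') = 0"
          using AE_no_fixed_jump[OF arrival_times.pos[OF arrival_times[OF w] k]]
          by eventually_elim (simp add: Heq[OF w])
      qed
      then show "(\<integral>\<^sup>+\<omega>. H (\<omega>, arr \<omega>') \<partial>M) = 0" by simp
    qed
    finally have "(\<integral>\<^sup>+\<omega>. H (\<omega>, arr \<omega>) \<partial>M) = 0" by simp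
    moreover have "(\<lambda>\<omega>. H (\<omega>, arr \<omega>)) \<in> borel_measurable M"
      by (intro measurable_compose[OF _ H] measurable_Pair id_measurable_FL arr_measurable)
    ultimately have "AE \<omega> in M. H (\<omega>, arr \<omega>) = 0"
      by (simp add: nn_integral_0_iff_AE)
    with AE_space show ?thesis
      by eventually_elim (auto simp: Heq split: if_splits)
  qed
  then show ?thesis by (simp add: AE_all_countable)
qed

section \<open>Adaptedness of the barrier control\<close>

lemma space_natural_filtration [simp]: "space (natural_filtration M L T t) = space M"
  unfolding natural_filtration_def by (rule space_measure_of) auto

lemma L_adapted:
  assumes "0 \<le> s" "s \<le> t"
  shows "L s \<in> borel_measurable (natural_filtration M L T t)"
proof (rule measurableI)
  fix B :: "real set" assume "B \<in> sets borel"
  then show "L s -` B \<inter> space (natural_filtration M L T t) \<in> sets (natural_filtration M L T t)"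
    using assms unfolding space_natural_filtration unfolding natural_filtration_def
    by (subst sets_measure_of) (auto intro!: sigma_sets.Basic)
qed simp

lemma counting_adapted:
  assumes "0 \<le> s" "s \<le> t"
  shows "counting T s \<in> measurable (natural_filtration M L T t) (count_space UNIV)"
proof (rule measurableI)
  fix B :: "nat set"
  show "counting T s -` B \<inter> space (natural_filtration M L T t) \<in> sets (natural_filtration M L T t)"
    using assms unfolding space_natural_filtration unfolding natural_filtration_def
  proof (subst sets_measure_of)
    show "counting T s -` B \<inter> space M \<in> sigma_sets (space M)
      ({L s -` B \<inter> space M |s B. 0 \<le> s \<and> s \<le> t \<and> B \<in> sets borel} \<union>
       {counting T s -` B \<inter> space M |s B. 0 \<le> s \<and> s \<le> t})"
      using assms by (intro sigma_sets.Basic UnI2 CollectI exI[of _ s] exI[of _ B]) simp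
  qed auto
qed simp

text \<open>For 0 \<le> a < s and k \<ge> 1, whether the k-th arrival is at most a is decided by the
  count at a; all other cases are trivial.\<close>

lemma stopped_arrival_adapted:
  assumes s: "0 \<le> s" "s \<le> t"
  shows "(\<lambda>\<omega>. min (T k \<omega>) s) \<in> borel_measurable (natural_filtration M L T t)"
proof (subst borel_measurable_iff_le, rule allI)
  let ?F = "natural_filtration M L T t"
  fix a :: real
  consider "s \<le> a" | "a < s" "a < 0" | "a < s" "0 \<le> a" "k = 0" | "a < s" "0 \<le> a" "1 \<le> k" by linarith
  then show "{\<omega> \<in> space ?F. min (T k \<omega>) s \<le> a} \<in> sets ?F"
  proof cases
    case 1
    then have "{\<omega> \<in> space ?F. min (T k \<omega>) s \<le> a} = space ?F" by auto
    then show ?thesis by (simp only: sets.top)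
  next
    case 2
    then have "{\<omega> \<in> space ?F. min (T k \<omega>) s \<le> a} = {}" using T_nonneg[of _ k] s by (force simp: min_le_iff_disj)
    then show ?thesis by (simp only: sets.empty_sets)
  next
    case 3
    then have "{\<omega> \<in> space ?F. min (T k \<omega>) s \<le> a} = space ?F" using T_zero by (auto simp: min_le_iff_disj)
    then show ?thesis by (simp only: sets.top)
  next
    case 4
    have "{\<omega> \<in> space ?F. min (T k \<omega>) s \<le> a} = counting T a -` {k..} \<inter> space ?F"
      using 4 arrival_times.le_cnt_iff[OF arrival_times] by (auto simp: min_le_iff_disj counting_eq_cnt)
    also have "\<dots> \<in> sets ?F"
      by (rule measurable_sets[OF counting_adapted]) (use 4 s in auto)
    finally show ?thesis .
  qed
qed

text \<open>The control at s involves only arrivals up to s, so arrivals and path may be stopped at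
  s, and the stopped quantities are measurable at that time.\<close>

lemma barrier_adapted:
  assumes s: "0 \<le> s" "s \<le> t"
  shows "barrier_strategy L T b x s \<in> borel_measurable (natural_filtration M L T t)"
proof -
  let ?F = "natural_filtration M L T t"
  have "(\<lambda>p. (\<lambda>r \<omega>. L (min r s) \<omega>) (max 0 (fst p)) (snd p)) \<in> borel_measurable (borel \<Otimes>\<^sub>M ?F)"
    by (rule right_continuous_joint_measurable) (use s in \<open>auto intro!: L_adapted L_stopped_right\<close>)
  from measurable_compose[OF measurable_Pair[OF stopped_arrival_adapted[OF s] measurable_ident] this]
  have Lk[measurable]: "(\<lambda>\<omega>. L (min (max 0 (min (T k \<omega>) s)) s) \<omega>) \<in> borel_measurable ?F" for k
    by (simp add: id_def)
  have "(\<lambda>\<omega>. rmax (\<lambda>k. b - (x + L (min (max 0 (min (T k \<omega>) s)) s) \<omega>)) n) \<in> borel_measurable ?F" for n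
    by (rule rmax_measurable) measurable
  from measurable_compose_countable[OF this counting_adapted[OF s]]
  have "(\<lambda>\<omega>. rmax (\<lambda>k. b - (x + L (min (max 0 (min (T k \<omega>) s)) s) \<omega>)) (counting T s \<omega>)) \<in> borel_measurable ?F" .
  moreover have "rmax (\<lambda>k. b - (x + L (min (max 0 (min (T k \<omega>) s)) s) \<omega>)) (counting T s \<omega>) = barrier_strategy L T b x s \<omega>"
    if "\<omega> \<in> space M" for \<omega>
    unfolding barrier_strategy_eq_rmax counting_eq_cnt
  proof (rule rmax_cong)
    fix k assume "1 \<le> k" "k \<le> cnt (\<lambda>k. T k \<omega>) s"
    then have "T k \<omega> \<le> s" "0 \<le> T k \<omega>"
      using arrival_times.le_cnt_iff[OF arrival_times[OF that]] T_nonneg[OF that] by auto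
    then show "b - (x + L (min (max 0 (min (T k \<omega>) s)) s) \<omega>) = b - (x + L (T k \<omega>) \<omega>)"
      by (simp add: max_absorb2 min_absorb1)
  qed
  ultimately show ?thesis by (subst (asm) measurable_cong) simp_all
qed

text \<open>The push that the barrier strategy would make if an arrival occurred now. Its left limit
  at an arrival is the candidate integrand.\<close>

definition shortfall :: "real \<Rightarrow> real \<Rightarrow> 'a \<Rightarrow> real \<Rightarrow> real" where
  "shortfall b x \<omega> t = max 0 (b - (x + L t \<omega>) - barrier_strategy L T b x t \<omega>)"

lemma shortfall_right:
  assumes w: "\<omega> \<in> space M" and t: "0 \<le> t"
  shows "(shortfall b x \<omega> \<longlongrightarrow> shortfall b x \<omega> t) (at_right t)"
proof -
  obtain d where d: "0 < d" "\<forall>s. t \<le> s \<and> s < t + d \<longrightarrow> cnt (\<lambda>k. T k \<omega>) s = cnt (\<lambda>k. T k \<omega>) t"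
    using arrival_times.cnt_right_const[OF arrival_times[OF w] t] by (elim exE conjE) (rule that)
  have td: "t < t + d" using d(1) by simp
  have "\<forall>\<^sub>F s in at_right t. max 0 (b - (x + L s \<omega>) - barrier_strategy L T b x t \<omega>) = shortfall b x \<omega> s"
    using eventually_at_right_real[OF td]
  proof eventually_elim
    case (elim s)
    then have "cnt (\<lambda>k. T k \<omega>) s = cnt (\<lambda>k. T k \<omega>) t" by (intro d(2)[rule_format]) auto
    then show ?case by (simp add: shortfall_def barrier_strategy_eq_rmax)
  qed
  moreover have "((\<lambda>s. max 0 (b - (x + L s \<omega>) - barrier_strategy L T b x t \<omega>)) \<longlongrightarrow> shortfall b x \<omega> t) (at_right t)"
    unfolding shortfall_def by (intro tendsto_max tendsto_diff tendsto_add tendsto_const L_right[OF w t])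
  ultimately show ?thesis by (rule Lim_transform_eventually[rotated])
qed

lemma shortfall_left:
  assumes w: "\<omega> \<in> space M" and t: "0 < t" and l: "((\<lambda>s. L s \<omega>) \<longlongrightarrow> l) (at_left t)"
    and d: "0 < d" "\<forall>s. t - d < s \<and> s < t \<longrightarrow> cnt (\<lambda>k. T k \<omega>) s = n"
  shows "(shortfall b x \<omega> \<longlongrightarrow> max 0 (b - (x + l) - rmax (\<lambda>k. b - (x + L (T k \<omega>) \<omega>)) n)) (at_left t)"
proof -
  have td: "t - d < t" using d(1) by simp
  have "\<forall>\<^sub>F s in at_left t. max 0 (b - (x + L s \<omega>) - rmax (\<lambda>k. b - (x + L (T k \<omega>) \<omega>)) n) = shortfall b x \<omega> s"
    using eventually_at_left_real[OF td]
  proof eventually_elim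
    case (elim s)
    then have "cnt (\<lambda>k. T k \<omega>) s = n" by (intro d(2)[rule_format]) auto
    then show ?case by (simp add: shortfall_def barrier_strategy_eq_rmax)
  qed
  moreover have "((\<lambda>s. max 0 (b - (x + L s \<omega>) - rmax (\<lambda>k. b - (x + L (T k \<omega>) \<omega>)) n)) \<longlongrightarrow> max 0 (b - (x + l) - rmax (\<lambda>k. b - (x + L (T k \<omega>) \<omega>)) n)) (at_left t)"
    by (intro tendsto_max tendsto_diff tendsto_add tendsto_const l)
  ultimately show ?thesis by (rule Lim_transform_eventually[rotated])
qed

lemma shortfall_has_left_limit:
  assumes w: "\<omega> \<in> space M" and t: "0 < t"
  shows "\<exists>l. (shortfall b x \<omega> \<longlongrightarrow> l) (at_left t)"
proof -
  obtain l where l: "((\<lambda>s. L s \<omega>) \<longlongrightarrow> l) (at_left t)" using L_left[OF w t] by blast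
  obtain n d where d: "0 < d" "\<forall>s. t - d < s \<and> s < t \<longrightarrow> cnt (\<lambda>k. T k \<omega>) s = n"
    using arrival_times.cnt_left_const[OF arrival_times[OF w] t] by (elim exE conjE) (rule that)
  show ?thesis using shortfall_left[OF w t l d] by (rule exI)
qed

text \<open>The barrier control is the stochastic integral of the left limits of the shortfall below the
  barrier, because the process almost surely does not jump at an arrival time.\<close>

lemma strategy_barrier: "strategy M L T (barrier_strategy L T b x)"
  unfolding strategy_def
proof (intro exI[of _ "\<lambda>t \<omega>. left_lim (shortfall b x \<omega>) t"] conjI ballI allI impI)
  fix \<omega> assume w: "\<omega> \<in> space M"
  show "caglad (\<lambda>t. left_lim (shortfall b x \<omega>) t)"
    using caglad_left_lim[OF shortfall_has_left_limit[OF w] shortfall_right[OF w]] .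
  show "0 \<le> left_lim (shortfall b x \<omega>) t" for t
    by (rule left_lim_nonneg[OF shortfall_has_left_limit[OF w]]) (simp_all add: shortfall_def)
next
  fix t :: real assume t: "0 \<le> t"
  let ?F = "natural_filtration M L T t"
  show "(\<lambda>\<omega>. left_lim (shortfall b x \<omega>) t) \<in> borel_measurable ?F"
  proof (cases "t = 0")
    case False
    then have t0: "0 < t" using t by simp
    have "(\<lambda>\<omega>. shortfall b x \<omega> (left_grid n t)) \<in> borel_measurable ?F" for n
    proof -
      have s: "0 \<le> left_grid n t" "left_grid n t \<le> t" using left_grid_bounds[OF t0, of n] by simp_all
      note [measurable] = L_adapted[OF s] barrier_adapted[OF s]
      show ?thesis unfolding shortfall_def by measurable
    qed
    then show ?thesis using t0 unfolding left_lim_def by (simp add: borel_measurable_lim_metric)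
  qed (simp add: left_lim_def)
next
  show "AE \<omega> in M. \<forall>t\<ge>0. barrier_strategy L T b x t \<omega> = (\<Sum>k\<in>arrivals T t \<omega>. left_lim (shortfall b x \<omega>) (T k \<omega>))"
    using AE_no_jump_at_arrival AE_space
  proof eventually_elim
    case (elim \<omega>)
    interpret A: arrival_times "\<lambda>k. T k \<omega>" by (rule arrival_times[OF elim(2)])
    let ?c = "\<lambda>k. b - (x + L (T k \<omega>) \<omega>)"
    \<comment> \<open>Just before the k-th arrival only k - 1 arrivals have been counted. As the
      path does not jump there, the left limit of the shortfall compares the value at the arrival
      with the previous maximum, which is the increment of the maximum.\<close>
    have jump: "left_lim (shortfall b x \<omega>) (T k \<omega>) = rmax ?c k - rmax ?c (k - 1)" if k: "1 \<le> k" for k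
    proof -
      have pos: "0 < T k \<omega>" by (rule A.pos[OF k])
      obtain l where l: "((\<lambda>s. L s \<omega>) \<longlongrightarrow> l) (at_left (T k \<omega>))" using L_left[OF elim(2) pos] by blast
      have "l = L (T k \<omega>) \<omega>" using elim(1) k left_lim_eq[OF pos l] by simp
      note l = l[unfolded this]
      obtain j where j: "k = Suc j" using k by (cases k) auto
      have lt: "T j \<omega> < T k \<omega>" using strict_monoD[OF A.strict, of j k] j by simp
      have "(shortfall b x \<omega> \<longlongrightarrow> max 0 (b - (x + L (T k \<omega>) \<omega>) - rmax ?c j)) (at_left (T k \<omega>))"
        by (rule shortfall_left[OF elim(2) pos l, of "T k \<omega> - T j \<omega>"]) (use lt j in \<open>auto intro!: A.cnt_eqI\<close>)
      then have "left_lim (shortfall b x \<omega>) (T k \<omega>) = max 0 (?c k - rmax ?c j)"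
        by (rule left_lim_eq[OF pos])
      also have "\<dots> = rmax ?c k - rmax ?c (k - 1)"
        unfolding j by (simp add: max_def)
      finally show ?thesis .
    qed
    show ?case
    proof (intro allI impI)
      fix t :: real assume "0 \<le> t"
      have "arrivals T t \<omega> = {1..cnt (\<lambda>k. T k \<omega>) t}"
        using A.arrivals_eq[of t] by (simp add: arrivals_def)
      then have eq: "(\<Sum>k\<in>arrivals T t \<omega>. left_lim (shortfall b x \<omega>) (T k \<omega>)) = (\<Sum>k\<in>{1..cnt (\<lambda>k. T k \<omega>) t}. rmax ?c k - rmax ?c (k - 1))"
        using jump by (intro sum.cong) auto
      show "barrier_strategy L T b x t \<omega> = (\<Sum>k\<in>arrivals T t \<omega>. left_lim (shortfall b x \<omega>) (T k \<omega>))"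
        unfolding barrier_strategy_eq_rmax eq by (rule rmax_eq_sum)
    qed
  qed
qed

end

section \<open>Costs and optimality\<close>

context barrier_problem
begin

lemma ctrl_neg: "\<omega> \<in> space M \<Longrightarrow> t < 0 \<Longrightarrow> ctrl a t \<omega> = 0"
  using arrival_times.cnt_neg[OF arrival_times] by (simp add: ctrl_def arr_def)

lemma ctrl_mono:
  assumes w: "\<omega> \<in> space M" and nn: "\<And>k. 1 \<le> k \<Longrightarrow> 0 \<le> a k \<omega>" and "s \<le> t"
  shows "ctrl a s \<omega> \<le> ctrl a t \<omega>"
  unfolding ctrl_def arr_def using arrival_times.cnt_mono[OF arrival_times[OF w] \<open>s \<le> t\<close>] nn
  by (intro sum_mono2) auto

lemma ctrl_right_continuous:
  assumes w: "\<omega> \<in> space M"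
  shows "continuous (at_right t) (\<lambda>t. ctrl a t \<omega>)"
proof -
  have lt: "t < T (Suc (cnt (arr \<omega>) t)) \<omega>"
    using arrival_times.cnt_bounds(2)[OF arrival_times[OF w], of t] by (simp add: arr_def)
  have "\<forall>\<^sub>F s in at_right t. ctrl a t \<omega> = ctrl a s \<omega>"
    using eventually_at_right_real[OF lt]
  proof eventually_elim
    case (elim s)
    then have "cnt (arr \<omega>) s = cnt (arr \<omega>) t"
      unfolding arr_def by (intro arrival_times.cnt_eq_right[OF arrival_times[OF w]]) auto
    then show ?case by (simp add: ctrl_def)
  qed
  then show ?thesis
    unfolding continuous_within by (rule Lim_transform_eventually[OF tendsto_const])
qed

lemma nn_integral_control_measure:
  assumes w: "\<omega> \<in> space M" and nn: "\<And>k. 1 \<le> k \<Longrightarrow> 0 \<le> a k \<omega>" and eq: "\<forall>t\<ge>0. R t \<omega> = ctrl a t \<omega>"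
  shows "(\<integral>\<^sup>+t\<in>{0..}. ennreal (exp (- q * t)) \<partial>control_measure R \<omega>) = (\<integral>\<^sup>+t. ennreal (q * ctrl a t \<omega>) \<partial>discounting q)"
proof -
  have "(\<lambda>t. if t < 0 then 0 else R t \<omega>) = (\<lambda>t. ctrl a t \<omega>)"
    using eq ctrl_neg[OF w] by (auto simp: fun_eq_iff)
  then have "control_measure R \<omega> = interval_measure (\<lambda>t. ctrl a t \<omega>)"
    by (simp add: control_measure_def)
  then show ?thesis
    using nn_integral_exp_interval_measure[OF q ctrl_neg[OF w] ctrl_mono[OF w] ctrl_right_continuous[OF w], of a] nn
    by simp
qed

lemma ctrl_section_measurable:
  assumes a: "\<And>k. 1 \<le> k \<Longrightarrow> a k \<in> borel_measurable M" and w: "\<omega> \<in> space M"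
  shows "(\<lambda>t. ctrl a t \<omega>) \<in> borel_measurable (discounting q)"
  using measurable_compose[OF measurable_Pair1' ctrl_measurable[OF a]] w by simp

lemma integral_control_measure:
  assumes a: "\<And>k. 1 \<le> k \<Longrightarrow> a k \<in> borel_measurable M"
    and w: "\<omega> \<in> space M" and nn: "\<And>k. 1 \<le> k \<Longrightarrow> 0 \<le> a k \<omega>" and eq: "\<forall>t\<ge>0. R t \<omega> = ctrl a t \<omega>"
  shows "(LINT t:{0..}|control_measure R \<omega>. exp (- q * t)) = q * (LINT t|discounting q. ctrl a t \<omega>)"
proof -
  have [measurable_cong]: "sets (control_measure R \<omega>) = sets borel" by (simp add: control_measure_def)
  note [measurable] = ctrl_section_measurable[OF a w]
  have "(LINT t:{0..}|control_measure R \<omega>. exp (- q * t))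
      = enn2real (\<integral>\<^sup>+t. ennreal (indicator {0..} t *\<^sub>R exp (- q * t)) \<partial>control_measure R \<omega>)"
    unfolding set_lebesgue_integral_def by (rule integral_eq_nn_integral) auto
  also have "(\<integral>\<^sup>+t. ennreal (indicator {0..} t *\<^sub>R exp (- q * t)) \<partial>control_measure R \<omega>)
      = (\<integral>\<^sup>+t\<in>{0..}. ennreal (exp (- q * t)) \<partial>control_measure R \<omega>)"
    by (intro nn_integral_cong) (auto simp: indicator_def)
  also have "\<dots> = (\<integral>\<^sup>+t. ennreal (q * ctrl a t \<omega>) \<partial>discounting q)"
    by (rule nn_integral_control_measure[where a = a]) (use w nn eq in auto)
  also have "enn2real \<dots> = (LINT t|discounting q. q * ctrl a t \<omega>)"
  proof (rule integral_eq_nn_integral[symmetric])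
    have "0 \<le> ctrl a t \<omega>" for t unfolding ctrl_def using nn by (intro sum_nonneg) auto
    then show "AE t in discounting q. 0 \<le> q * ctrl a t \<omega>" using q by (intro AE_I2) simp
  qed measurable
  finally show ?thesis by simp
qed

context
  fixes a :: "nat \<Rightarrow> 'a \<Rightarrow> real" and R :: "real \<Rightarrow> 'a \<Rightarrow> real" and f :: "real \<Rightarrow> real" and x :: real
  assumes a: "\<And>k. 1 \<le> k \<Longrightarrow> a k \<in> borel_measurable M"
    and nn: "\<And>k \<omega>. 1 \<le> k \<Longrightarrow> \<omega> \<in> space M \<Longrightarrow> 0 \<le> a k \<omega>"
    and ae: "AE \<omega> in M. \<forall>t\<ge>0. R t \<omega> = ctrl a t \<omega>"
    and f: "f \<in> borel_measurable borel"
begin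

lemma controlled_measurable: "(\<lambda>p. f (X x p + RN a p)) \<in> borel_measurable N"
  by (rule measurable_compose[OF borel_measurable_add[OF X_measurable ctrl_measurable[OF a]] f])

text \<open>Extended integrals over the completion and over M agree for any integrand, so the almost
  sure jump representation of R suffices to rewrite both terms on the product space.\<close>

lemma admissible_functional_eq:
  "(\<integral>\<^sup>+\<omega>. ((\<integral>\<^sup>+t\<in>{0..}. ennreal (exp (- q * t) * \<bar>f (x + L t \<omega> + R t \<omega>)\<bar>) \<partial>lborel)
        + (\<integral>\<^sup>+t\<in>{0..}. ennreal (exp (- q * t)) \<partial>control_measure R \<omega>)) \<partial>completion M)
    = (\<integral>\<^sup>+p. ennreal \<bar>f (X x p + RN a p)\<bar> \<partial>N) + (\<integral>\<^sup>+p. ennreal (q * RN a p) \<partial>N)"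
proof -
  note [measurable] = controlled_measurable ctrl_measurable[OF a]
  have "(\<integral>\<^sup>+\<omega>. ((\<integral>\<^sup>+t\<in>{0..}. ennreal (exp (- q * t) * \<bar>f (x + L t \<omega> + R t \<omega>)\<bar>) \<partial>lborel)
        + (\<integral>\<^sup>+t\<in>{0..}. ennreal (exp (- q * t)) \<partial>control_measure R \<omega>)) \<partial>completion M)
      = (\<integral>\<^sup>+\<omega>. (\<integral>\<^sup>+t. ennreal \<bar>f (X x (\<omega>, t) + RN a (\<omega>, t))\<bar> \<partial>discounting q)
        + (\<integral>\<^sup>+t. ennreal (q * RN a (\<omega>, t)) \<partial>discounting q) \<partial>M)"
    unfolding nn_integral_completion
  proof (rule nn_integral_cong_AE)
    show "AE \<omega> in M. (\<integral>\<^sup>+t\<in>{0..}. ennreal (exp (- q * t) * \<bar>f (x + L t \<omega> + R t \<omega>)\<bar>) \<partial>lborel)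
        + (\<integral>\<^sup>+t\<in>{0..}. ennreal (exp (- q * t)) \<partial>control_measure R \<omega>)
      = (\<integral>\<^sup>+t. ennreal \<bar>f (X x (\<omega>, t) + RN a (\<omega>, t))\<bar> \<partial>discounting q)
        + (\<integral>\<^sup>+t. ennreal (q * RN a (\<omega>, t)) \<partial>discounting q)"
      using ae AE_space
    proof eventually_elim
      case (elim \<omega>)
      have "(\<lambda>t. f (X x (\<omega>, t) + RN a (\<omega>, t))) \<in> borel_measurable (discounting q)"
        using measurable_compose[OF measurable_Pair1' controlled_measurable] elim(2) by simp
      then have m: "(\<lambda>t. ennreal \<bar>f (X x (\<omega>, t) + RN a (\<omega>, t))\<bar>) \<in> borel_measurable borel"
        by (simp cong: measurable_cong_sets)
      have "(\<integral>\<^sup>+t. ennreal \<bar>f (X x (\<omega>, t) + RN a (\<omega>, t))\<bar> \<partial>discounting q)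
          = (\<integral>\<^sup>+t\<in>{0..}. ennreal (exp (- q * t)) * ennreal \<bar>f (X x (\<omega>, t) + RN a (\<omega>, t))\<bar> \<partial>lborel)"
        by (rule nn_integral_discounting[OF m])
      also have "\<dots> = (\<integral>\<^sup>+t\<in>{0..}. ennreal (exp (- q * t) * \<bar>f (x + L t \<omega> + R t \<omega>)\<bar>) \<partial>lborel)"
        using elim(1) by (intro nn_integral_cong) (auto simp: indicator_def X_def max_absorb2 ennreal_mult'[symmetric])
      finally show ?case
        using nn_integral_control_measure[where a = a and R = R, OF elim(2) nn[OF _ elim(2)] elim(1)] by simp
    qed
  qed
  also have "\<dots> = (\<integral>\<^sup>+\<omega>. (\<integral>\<^sup>+t. ennreal \<bar>f (X x (\<omega>, t) + RN a (\<omega>, t))\<bar> \<partial>discounting q) \<partial>M)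
      + (\<integral>\<^sup>+\<omega>. (\<integral>\<^sup>+t. ennreal (q * RN a (\<omega>, t)) \<partial>discounting q) \<partial>M)"
    by (rule nn_integral_add; rule disc.borel_measurable_nn_integral_fst) measurable
  also have "\<dots> = (\<integral>\<^sup>+p. ennreal \<bar>f (X x p + RN a p)\<bar> \<partial>N) + (\<integral>\<^sup>+p. ennreal (q * RN a p) \<partial>N)"
    by (intro arg_cong2[where f = "(+)"] disc.nn_integral_fst) measurable
  finally show ?thesis .
qed

lemma cost_eq:
  assumes F: "integrable N (\<lambda>p. f (X x p + RN a p))" and Ri: "integrable N (RN a)"
  shows "cost M L q C f R x = (LINT p|N. f (X x p + RN a p)) + C * q * (LINT p|N. RN a p)"
proof -
  let ?F = "\<lambda>\<omega>. LINT t|discounting q. f (X x (\<omega>, t) + RN a (\<omega>, t))"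
  let ?R = "\<lambda>\<omega>. LINT t|discounting q. RN a (\<omega>, t)"
  have "AE \<omega> in M. \<forall>t\<ge>0. f (x + L t \<omega> + R t \<omega>) = f (X x (\<omega>, t) + RN a (\<omega>, t))"
    using ae by eventually_elim (simp add: X_def max_absorb2)
  from integral_completion_iterated(1)[OF F this]
  have "AE \<omega> in M. (LINT t:{0..}|lborel. exp (- q * t) * f (x + L t \<omega> + R t \<omega>)) + C * (LINT t:{0..}|control_measure R \<omega>. exp (- q * t))
      = ?F \<omega> + C * q * ?R \<omega>"
    using ae AE_space
  proof eventually_elim
    case (elim \<omega>)
    then show ?case using integral_control_measure[where a = a and R = R, OF a elim(3) nn[OF _ elim(3)] elim(2)] by simp
  qed
  then have "cost M L q C f R x = (LINT \<omega>|M. ?F \<omega> + C * q * ?R \<omega>)"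
    unfolding cost_def
    by (rule integral_completion_cong)
       (intro borel_measurable_add borel_measurable_times borel_measurable_const
          borel_measurable_integrable[OF PN.integrable_fst'[OF F]] borel_measurable_integrable[OF PN.integrable_fst'[OF Ri]])
  also have "\<dots> = (LINT \<omega>|M. ?F \<omega>) + C * q * (LINT \<omega>|M. ?R \<omega>)"
    using PN.integrable_fst'[OF F] PN.integrable_fst'[OF Ri] by simp
  also have "\<dots> = (LINT p|N. f (X x p + RN a p)) + C * q * (LINT p|N. RN a p)"
    using PN.integral_fst'[OF F] PN.integral_fst'[OF Ri] by simp
  finally show ?thesis .
qed

lemma admissible_imp_integrable:
  assumes "R \<in> admissible_strategies M L T q f x"
  shows "integrable N (\<lambda>p. f (X x p + RN a p))" "integrable N (RN a)"
proof -
  note [measurable] = controlled_measurable ctrl_measurable[OF a]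
  have "(\<integral>\<^sup>+p. ennreal \<bar>f (X x p + RN a p)\<bar> \<partial>N) + (\<integral>\<^sup>+p. ennreal (q * RN a p) \<partial>N) < \<infinity>"
    using assms unfolding admissible_strategies_def admissible_functional_eq[symmetric] by simp
  then have 1: "(\<integral>\<^sup>+p. ennreal \<bar>f (X x p + RN a p)\<bar> \<partial>N) < \<infinity>" and 2: "(\<integral>\<^sup>+p. ennreal (q * RN a p) \<partial>N) < \<infinity>"
    by (simp_all add: ennreal_add_less_top)
  show "integrable N (\<lambda>p. f (X x p + RN a p))"
    by (rule integrableI_bounded) (use 1 in simp_all)
  have "AE p in N. 0 \<le> q * RN a p"
    using AE_N by eventually_elim (use q nn in \<open>auto intro!: mult_nonneg_nonneg RN_nonneg\<close>)
  then have "integrable N (\<lambda>p. q * RN a p)"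
    using 2 by (intro integrableI_nonneg) auto
  then show "integrable N (RN a)" using q by simp
qed

end

end

context barrier_moments
begin

text \<open>The barrier control is admissible by the moment bounds, and every competitor is reduced
  to its jumps, to which \<open>barrier_cost_le\<close> applies with c = C q.\<close>

lemma barrier_optimal:
  fixes f g :: "real \<Rightarrow> real"
  assumes f[measurable]: "f \<in> borel_measurable borel" and growth: "\<And>u. \<bar>f u\<bar> \<le> c * (1 + u ^ (2 * m))"
    and mono: "mono g" and sub: "\<And>u v. f v \<ge> f u + (g u - C * q) * (v - u)"
    and Vb: "V (\<lambda>u. ennreal (max 0 (g u))) b = V (\<lambda>u. ennreal (max 0 (- g u))) b"
    and Vfin: "V (\<lambda>u. ennreal (max 0 (- g u))) b < \<top>"
  shows "optimal_strategy M L T q C f x (barrier_strategy L T b x)"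
    and "value_function M L T q C f x = ereal (cost M L q C f (barrier_strategy L T b x) x)"
proof -
  let ?B = "barrier_strategy L T b x" and ?j = "barrier_jump x"
  have jm: "?j k \<in> borel_measurable M" for k by (rule measurable_G_imp[OF barrier_jump_measurable])
  have jeq: "AE \<omega> in M. \<forall>t\<ge>0. ?B t \<omega> = ctrl ?j t \<omega>" by (simp add: ctrl_barrier_jump)
  note barrier = admissible_functional_eq[where a = ?j and R = ?B and f = f and x = x, OF jm barrier_jump_nonneg jeq f]
    cost_eq[where a = ?j and R = ?B and f = f and x = x, OF jm barrier_jump_nonneg jeq f]
  have Yj: "AE p in N. f (YN x p) = f (X x p + RN ?j p)"
    using AE_N by eventually_elim (simp add: Y_eq X_def)
  have iY: "integrable N (\<lambda>p. f (YN x p))" by (rule integrable_polynomial_growth[OF f growth])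
  have iR: "integrable N (RN ?j)" by (rule integrable_barrier_control)
  have mX: "(\<lambda>p. f (X x p + RN ?j p)) \<in> borel_measurable N"
    by (rule measurable_compose[OF borel_measurable_add[OF X_measurable ctrl_measurable[OF jm]] f])
  have iX: "integrable N (\<lambda>p. f (X x p + RN ?j p))"
    using iY Yj mX by (subst (asm) integrable_cong_AE) (auto intro: measurable_compose[OF Y_measurable f])
  have eqX: "(LINT p|N. f (X x p + RN ?j p)) = (LINT p|N. f (YN x p))"
    by (rule integral_cong_AE[OF mX measurable_compose[OF Y_measurable f]]) (use Yj in eventually_elim, simp)
  have adm: "?B \<in> admissible_strategies M L T q f x"
  proof -
    have "(\<integral>\<^sup>+p. ennreal \<bar>f (X x p + RN ?j p)\<bar> \<partial>N) < \<infinity>"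
      using iX unfolding integrable_iff_bounded by simp
    moreover have "(\<integral>\<^sup>+p. ennreal (q * RN ?j p) \<partial>N) < \<infinity>"
    proof -
      have "(\<integral>\<^sup>+p. ennreal (q * RN ?j p) \<partial>N) \<le> (\<integral>\<^sup>+p. ennreal (norm (q * RN ?j p)) \<partial>N)"
        by (intro nn_integral_mono ennreal_leI) simp
      also have "\<dots> < \<infinity>" using integrable_mult_right[OF iR, of q] unfolding integrable_iff_bounded by simp
      finally show ?thesis .
    qed
    ultimately show ?thesis
      unfolding admissible_strategies_def using strategy_barrier barrier(1) by (simp add: ennreal_add_less_top)
  qed
  have costB: "cost M L q C f ?B x = (LINT p|N. f (YN x p)) + C * q * (LINT p|N. RN ?j p)"
    using barrier(2)[OF iX iR] eqX by simp
  have le: "cost M L q C f ?B x \<le> cost M L q C f R x" if R: "R \<in> admissible_strategies M L T q f x" for R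
  proof -
    from R have "strategy M L T R" by (simp add: admissible_strategies_def)
    then obtain \<nu> where cag: "\<forall>\<omega>\<in>space M. caglad (\<lambda>t. \<nu> t \<omega>) \<and> (\<forall>t\<ge>0. \<nu> t \<omega> \<ge> 0)"
      and ad: "\<forall>t\<ge>0. \<nu> t \<in> borel_measurable (natural_filtration M L T t)"
      and R_eq: "AE \<omega> in M. \<forall>t\<ge>0. R t \<omega> = (\<Sum>k\<in>arrivals T t \<omega>. \<nu> (T k \<omega>) \<omega>)"
      unfolding strategy_def by (elim exE conjE) (rule that)
    \<comment> \<open>The jump of R at the k-th arrival. The information constraint on R enters only
      through the measurability \<open>aG\<close> of these jumps.\<close>
    define a where "a k \<omega> = \<nu> (T k \<omega>) \<omega>" for k \<omega>
    have aG: "a k \<in> borel_measurable (G k)" if "1 \<le> k" for k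
      unfolding a_def by (rule adapted_arrival_measurable_G[OF _ _ that]) (use cag ad in auto)
    have aM: "a k \<in> borel_measurable M" if "1 \<le> k" for k
      by (rule measurable_G_imp[OF aG[OF that]])
    have nn: "0 \<le> a k \<omega>" if "1 \<le> k" "\<omega> \<in> space M" for k \<omega>
      unfolding a_def using cag that(2) T_nonneg[OF that(2), of k] by blast
    have ae: "AE \<omega> in M. \<forall>t\<ge>0. R t \<omega> = ctrl a t \<omega>"
      using R_eq AE_space
    proof eventually_elim
      case (elim \<omega>)
      have "arrivals T t \<omega> = {1..cnt (arr \<omega>) t}" for t
        using arrival_times.arrivals_eq[OF arrival_times[OF elim(2)], of t] by (simp add: arrivals_def arr_def)
      then show ?case using elim(1) by (simp add: ctrl_def a_def)
    qed
    note iR' = admissible_imp_integrable[OF aM nn ae f R]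
    have "cost M L q C f R x = (LINT p|N. f (X x p + RN a p)) + C * q * (LINT p|N. RN a p)"
      by (rule cost_eq[OF aM nn ae f iR'])
    then show ?thesis
      unfolding costB using barrier_cost_le[OF mono sub Vb Vfin aG nn iR' iY iR] by simp
  qed
  show val: "value_function M L T q C f x = ereal (cost M L q C f ?B x)"
    unfolding value_function_def
    by (intro antisym INF_lower2[OF adm order_refl] INF_greatest) (simp add: le)
  show "optimal_strategy M L T q C f x ?B"
    unfolding optimal_strategy_def using adm val by simp
qed

end

section \<open>The optimal barrier\<close>

lemma abs_min_le: "a \<le> b \<Longrightarrow> 0 < c \<Longrightarrow> \<bar>min b c\<bar> \<le> \<bar>a\<bar> + (c :: real)"
  by linarith

lemma abs_max_le: "b \<le> a \<Longrightarrow> c < 0 \<Longrightarrow> \<bar>max b c\<bar> \<le> \<bar>a\<bar> + (- c :: real)"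
  by linarith

lemma polynomial_growth_shift:
  fixes \<phi> :: "real \<Rightarrow> real"
  assumes n: "even n" and \<phi>: "\<And>u. \<bar>\<phi> u\<bar> \<le> c * (1 + u ^ n)"
  obtains c' where "\<And>u. \<bar>\<phi> (s + u)\<bar> \<le> c' * (1 + u ^ n)"
proof
  fix u
  have nn: "0 \<le> z ^ n" for z :: real using n by (rule zero_le_even_power)
  have "0 \<le> c * (1 + 0 ^ n)" using order_trans[OF abs_ge_zero \<phi>[of 0]] .
  moreover have "0 < 1 + (0 :: real) ^ n" using nn[of 0] by linarith
  ultimately have c: "0 \<le> c" by (simp add: zero_le_mult_iff)
  have "1 + (s + u) ^ n \<le> 1 + (2 ^ n * s ^ n + 2 ^ n * u ^ n)"
    using even_power_add_le[OF n, of s u] by (simp add: distrib_left)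
  also have "\<dots> \<le> (1 + 2 ^ n * s ^ n + 2 ^ n) * (1 + u ^ n)"
  proof -
    have "0 \<le> (1 + 2 ^ n * s ^ n) * u ^ n" using nn by (intro mult_nonneg_nonneg add_nonneg_nonneg) auto
    then show ?thesis by (simp add: distrib_left distrib_right)
  qed
  finally have "c * (1 + (s + u) ^ n) \<le> c * ((1 + 2 ^ n * s ^ n + 2 ^ n) * (1 + u ^ n))"
    using c by (rule mult_left_mono)
  then show "\<bar>\<phi> (s + u)\<bar> \<le> c * (1 + 2 ^ n * s ^ n + 2 ^ n) * (1 + u ^ n)"
    using \<phi>[of "s + u"] by (simp only: mult.assoc)
qed

text \<open>The subgradient inequality at u + 1 and u - 1 bounds the slope at u by three values of
  f.\<close>

lemma subgradient_growth:
  fixes f h :: "real \<Rightarrow> real"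
  assumes n: "even n" and f: "\<And>u. \<bar>f u\<bar> \<le> c * (1 + u ^ n)" and sub: "\<And>u v. f v \<ge> f u + h u * (v - u)"
  obtains c' where "\<And>u. \<bar>h u\<bar> \<le> c' * (1 + u ^ n)"
proof -
  obtain c1 where c1: "\<And>u. \<bar>f (1 + u)\<bar> \<le> c1 * (1 + u ^ n)"
    using polynomial_growth_shift[OF n f, of 1] by metis
  obtain c2 where c2: "\<And>u. \<bar>f (-1 + u)\<bar> \<le> c2 * (1 + u ^ n)"
    using polynomial_growth_shift[OF n f, of "-1"] by metis
  have "\<bar>h u\<bar> \<le> (c1 + c2 + c) * (1 + u ^ n)" for u
  proof -
    have "h u \<le> f (1 + u) - f u" "- h u \<le> f (-1 + u) - f u"
      using sub[of u "1 + u"] sub[of u "-1 + u"] by simp_all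
    then have "\<bar>h u\<bar> \<le> \<bar>f (1 + u)\<bar> + \<bar>f (-1 + u)\<bar> + \<bar>f u\<bar>" by linarith
    also have "\<dots> \<le> (c1 + c2 + c) * (1 + u ^ n)"
      unfolding distrib_right[of _ _ "1 + u ^ n"] by (intro add_mono c1 c2 f)
    finally show ?thesis .
  qed
  then show ?thesis by (rule that)
qed

section \<open>The barrier flow started at its own barrier\<close>

context barrier_moments
begin

text \<open>The flow is translation equivariant: started at its own barrier b', it equals b' + D
  with D free of b'. Dependence on the barrier thus becomes a shift of the argument of the
  derivative of f.\<close>

definition D :: "'a \<times> real \<Rightarrow> real" where
  "D p = barrier_flow 0 0 (path (fst p)) (arr (fst p)) (snd p)"

lemma flow_eq_D: "barrier_flow b' b' (path \<omega>) (arr \<omega>) t = b' + D (\<omega>, t)"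
  by (simp add: barrier_flow_def D_def)

lemma D_measurable [measurable]: "D \<in> borel_measurable N"
proof -
  \<comment> \<open>The locale assumptions do not mention the barrier, so it can be reset to 0,
    which is the flow in the definition of \<open>D\<close>.\<close>
  interpret B0: barrier_moments M L T \<eta> q 0 K m by (rule barrier_moments_axioms)
  show ?thesis using B0.Y_measurable[of 0] by (simp add: B0.Y_def D_def[abs_def])
qed

lemma integrable_D:
  assumes \<phi>: "\<phi> \<in> borel_measurable borel" and g: "\<And>u. \<bar>\<phi> u\<bar> \<le> c * (1 + u ^ (2 * m))"
  shows "integrable N (\<lambda>p. \<phi> (s + D p))"
proof -
  interpret B0: barrier_moments M L T \<eta> q 0 K m by (rule barrier_moments_axioms)
  obtain c' where "\<And>u. \<bar>\<phi> (s + u)\<bar> \<le> c' * (1 + u ^ (2 * m))"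
    using polynomial_growth_shift[OF _ g, of s] by (metis dvd_triv_left)
  moreover have "(\<lambda>u. \<phi> (s + u)) \<in> borel_measurable borel"
    using \<phi> by measurable
  ultimately show ?thesis
    using B0.integrable_polynomial_growth[of "\<lambda>u. \<phi> (s + u)" c' 0] by (simp add: B0.Y_def D_def)
qed

lemma V_eq_D:
  assumes [measurable]: "\<phi> \<in> borel_measurable borel"
  shows "V \<phi> b = (\<integral>\<^sup>+p. \<phi> (b + D p) \<partial>N)"
  unfolding V_def flow_eq_D by (rule disc.nn_integral_fst) measurable

lemma rho_eq_D:
  assumes "integrable N (\<lambda>p. right_deriv f (s + D p))"
  shows "rho M L T q f s = (LINT p|N. right_deriv f (s + D p))"
  unfolding rho_def
proof (rule integral_completion_iterated(2)[OF assms])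
  show "AE \<omega> in M. \<forall>t\<ge>0. right_deriv f (s + L t \<omega> + barrier_strategy L T s s t \<omega>) = right_deriv f (s + D (\<omega>, t))"
    using AE_space
  proof eventually_elim
    case (elim \<omega>)
    show ?case
    proof (intro allI impI)
      fix t :: real assume "0 \<le> t"
      from U_eq_flow[OF elim this, of s s]
      have "s + L t \<omega> + barrier_strategy L T s s t \<omega> = s + D (\<omega>, t)"
        unfolding U_def flow_eq_D .
      then show "right_deriv f (s + L t \<omega> + barrier_strategy L T s s t \<omega>) = right_deriv f (s + D (\<omega>, t))"
        by (simp only:)
    qed
  qed
qed

lemma emeasure_N: "emeasure N (space N) = ennreal (1 / q)"
proof -
  have "emeasure N (space N) = (\<integral>\<^sup>+p. 1 \<partial>N)" by simp
  also have "\<dots> = (\<integral>\<^sup>+\<omega>. (\<integral>\<^sup>+t. 1 \<partial>discounting q) \<partial>M)" by (subst disc.nn_integral_fst[symmetric]) auto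
  also have "\<dots> = ennreal (1 / q)" using V_one[of 0] by (simp add: V_def)
  finally show ?thesis .
qed

text \<open>The total mass 1/q is the reason why C becomes C q when it is moved under the
  integral.\<close>

lemma const_N: "integrable N (\<lambda>_. c :: real)" "(LINT p|N. c :: real) = c / q"
proof -
  interpret fN: finite_measure N by (rule finite_measureI) (simp add: emeasure_N)
  show "integrable N (\<lambda>_. c :: real)" by simp
  show "(LINT p|N. c :: real) = c / q" using q by (simp add: measure_def emeasure_N)
qed

text \<open>By right-continuity the integral of the right derivative plus \<open>C\<close> is nonnegative at \<open>b\<^sup>*\<close>, and that of
  the left derivative is nonpositive; \<open>g\<close> interpolates between the two.\<close>

lemma optimal_barrier_exists:
  assumes f: "convex_on UNIV f" and growth: "\<And>u. \<bar>f u\<bar> \<le> c * (1 + u ^ (2 * m))"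
    and neg: "right_deriv_neg_inf f < ereal (- C * q)" and pos: "ereal (- C * q) < right_deriv_pos_inf f"
  obtains s g where "b_star M L T q C f = ereal s" "mono g" "\<And>u v. f v \<ge> f u + (g u - C * q) * (v - u)"
    "integrable N (\<lambda>p. g (s + D p))" "(LINT p|N. g (s + D p)) = 0"
proof -
  let ?r = "right_deriv f" and ?l = "left_limit (right_deriv f)"
  have sub_r: "f v \<ge> f u + ?r u * (v - u)" for u v by (rule right_deriv_tendsto_Inf(2)[OF f])
  have sub_l: "f v \<ge> f u + ?l u * (v - u)" for u v by (rule left_limit_subgradient[OF f sub_r])
  have mono_r: "mono ?r" by (rule right_deriv_mono[OF f])
  have mono_l: "mono ?l" using sub_l by (rule subgradient_mono)
  have mr[measurable]: "?r \<in> borel_measurable borel" by (rule borel_measurable_mono[OF mono_r])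
  have ml[measurable]: "?l \<in> borel_measurable borel" by (rule borel_measurable_mono[OF mono_l])
  obtain cr where cr: "\<And>u. \<bar>?r u\<bar> \<le> cr * (1 + u ^ (2 * m))"
    by (rule subgradient_growth[OF _ growth sub_r], simp, rule that)
  obtain cl where cl: "\<And>u. \<bar>?l u\<bar> \<le> cl * (1 + u ^ (2 * m))"
    by (rule subgradient_growth[OF _ growth sub_l], simp, rule that)
  have ir: "integrable N (\<lambda>p. ?r (s + D p))" for s by (rule integrable_D[OF mr cr])
  have il: "integrable N (\<lambda>p. ?l (s + D p))" for s by (rule integrable_D[OF ml cl])
  have iC: "integrable N (\<lambda>p. ?r (s + D p) + C * q)" for s
    by (intro Bochner_Integration.integrable_add ir const_N(1))
  \<comment> \<open>Equal to rho + C, but written as one integral of a function monotone in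
    s.\<close>
  define J where "J s = (LINT p|N. ?r (s + D p) + C * q)" for s
  have J_eq: "J s = rho M L T q f s + C" for s
    unfolding J_def rho_eq_D[OF ir]
    by (subst Bochner_Integration.integral_add[OF ir const_N(1)], subst const_N(2)) (use q in simp)
  have J_mono: "J s \<le> J t" if "s \<le> t" for s t
    unfolding J_def by (intro integral_mono iC add_right_mono monoD[OF mono_r]) (use that in simp)
  define S where "S = {s. J s \<ge> 0}"
  have S_eq: "S = {s. rho M L T q f s + C \<ge> 0}" by (simp add: S_def J_eq)
  have "\<exists>n::nat. 0 < J (real n)"
  proof -
    obtain x0 where "- C * q < ?r x0" using right_deriv_pos_inf_greater[OF f pos] .
    define c0 where "c0 = ?r x0 + C * q"
    have c0: "0 < c0" using \<open>- C * q < ?r x0\<close> by (simp add: c0_def)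
    \<comment> \<open>Capping at c0 > 0 bounds the increasing integrands from above, and their value
      for n = 0 bounds them from below, so dominated convergence drives the capped integrals to a
      positive limit.\<close>
    have "(\<lambda>n. LINT p|N. min (?r (real n + D p) + C * q) c0) \<longlonglongrightarrow> (LINT p|N. c0)"
    proof (rule integral_dominated_convergence[where w = "\<lambda>p. \<bar>?r (0 + D p) + C * q\<bar> + c0"])
      show "integrable N (\<lambda>p. \<bar>?r (0 + D p) + C * q\<bar> + c0)"
        by (intro Bochner_Integration.integrable_add integrable_abs iC const_N(1))
      show "AE p in N. (\<lambda>n. min (?r (real n + D p) + C * q) c0) \<longlonglongrightarrow> c0"
      proof (rule AE_I2)
        fix p
        obtain n0 where n0: "x0 - D p \<le> real n0" using real_arch_simple by blast
        have "min (?r (real n + D p) + C * q) c0 = c0" if "n0 \<le> n" for n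
        proof -
          have "real n0 \<le> real n" using that by simp
          then have "x0 \<le> real n + D p" using n0 by linarith
          then have "?r x0 \<le> ?r (real n + D p)" by (rule monoD[OF mono_r])
          then show ?thesis by (simp add: c0_def)
        qed
        then have "\<forall>\<^sub>F n in sequentially. c0 = min (?r (real n + D p) + C * q) c0"
          unfolding eventually_sequentially by metis
        then show "(\<lambda>n. min (?r (real n + D p) + C * q) c0) \<longlonglongrightarrow> c0"
          by (rule Lim_transform_eventually[OF tendsto_const])
      qed
      show "AE p in N. norm (min (?r (real n + D p) + C * q) c0) \<le> \<bar>?r (0 + D p) + C * q\<bar> + c0" for n
      proof (rule AE_I2)
        fix p
        have "?r (0 + D p) \<le> ?r (real n + D p)" by (rule monoD[OF mono_r]) simp
        then have "?r (0 + D p) + C * q \<le> ?r (real n + D p) + C * q" by (rule add_right_mono)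
        then show "norm (min (?r (real n + D p) + C * q) c0) \<le> \<bar>?r (0 + D p) + C * q\<bar> + c0"
          unfolding real_norm_def using c0 by (rule abs_min_le)
      qed
    qed measurable
    moreover have "0 < (LINT p|N. c0)" unfolding const_N(2) using c0 q by simp
    ultimately have "\<forall>\<^sub>F n in sequentially. 0 < (LINT p|N. min (?r (real n + D p) + C * q) c0)"
      by (rule order_tendstoD(1))
    then obtain n where n: "0 < (LINT p|N. min (?r (real n + D p) + C * q) c0)"
      by (auto simp: eventually_sequentially)
    have "(LINT p|N. min (?r (real n + D p) + C * q) c0) \<le> J (real n)"
      unfolding J_def by (intro integral_mono integrable_min iC const_N(1)) simp
    with n show ?thesis by (intro exI[of _ n]) simp
  qed
  then obtain n1 :: nat where "0 < J (real n1)" ..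
  then have "real n1 \<in> S" by (simp add: S_def)
  then have S_ne: "S \<noteq> {}" by blast
  have "\<exists>n::nat. J (- real n) < 0"
  proof -
    obtain x1 where "?r x1 < - C * q" using right_deriv_neg_inf_less[OF f neg] .
    define c1 where "c1 = ?r x1 + C * q"
    have c1: "c1 < 0" using \<open>?r x1 < - C * q\<close> by (simp add: c1_def)
    have "(\<lambda>n. LINT p|N. max (?r (- real n + D p) + C * q) c1) \<longlonglongrightarrow> (LINT p|N. c1)"
    proof (rule integral_dominated_convergence[where w = "\<lambda>p. \<bar>?r (0 + D p) + C * q\<bar> + (- c1)"])
      show "integrable N (\<lambda>p. \<bar>?r (0 + D p) + C * q\<bar> + (- c1))"
        by (intro Bochner_Integration.integrable_add integrable_abs iC const_N(1))
      show "AE p in N. (\<lambda>n. max (?r (- real n + D p) + C * q) c1) \<longlonglongrightarrow> c1"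
      proof (rule AE_I2)
        fix p
        obtain n0 where n0: "D p - x1 \<le> real n0" using real_arch_simple by blast
        have "max (?r (- real n + D p) + C * q) c1 = c1" if "n0 \<le> n" for n
        proof -
          have "real n0 \<le> real n" using that by simp
          then have "- real n + D p \<le> x1" using n0 by linarith
          then have "?r (- real n + D p) \<le> ?r x1" by (rule monoD[OF mono_r])
          then show ?thesis by (simp add: c1_def)
        qed
        then have "\<forall>\<^sub>F n in sequentially. c1 = max (?r (- real n + D p) + C * q) c1"
          unfolding eventually_sequentially by metis
        then show "(\<lambda>n. max (?r (- real n + D p) + C * q) c1) \<longlonglongrightarrow> c1"
          by (rule Lim_transform_eventually[OF tendsto_const])
      qed
      show "AE p in N. norm (max (?r (- real n + D p) + C * q) c1) \<le> \<bar>?r (0 + D p) + C * q\<bar> + (- c1)" for n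
      proof (rule AE_I2)
        fix p
        have "?r (- real n + D p) \<le> ?r (0 + D p)" by (rule monoD[OF mono_r]) simp
        then have "?r (- real n + D p) + C * q \<le> ?r (0 + D p) + C * q" by (rule add_right_mono)
        then show "norm (max (?r (- real n + D p) + C * q) c1) \<le> \<bar>?r (0 + D p) + C * q\<bar> + (- c1)"
          unfolding real_norm_def using c1 by (rule abs_max_le)
      qed
    qed measurable
    moreover have "(LINT p|N. c1) < 0" unfolding const_N(2) using c1 q by (simp add: divide_neg_pos)
    ultimately have "\<forall>\<^sub>F n in sequentially. (LINT p|N. max (?r (- real n + D p) + C * q) c1) < 0"
      by (rule order_tendstoD(2))
    then obtain n where n: "(LINT p|N. max (?r (- real n + D p) + C * q) c1) < 0"
      by (auto simp: eventually_sequentially)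
    have "J (- real n) \<le> (LINT p|N. max (?r (- real n + D p) + C * q) c1)"
      unfolding J_def by (intro integral_mono integrable_max iC const_N(1)) simp
    with n show ?thesis by (intro exI[of _ n]) simp
  qed
  then obtain n0 :: nat where n0: "J (- real n0) < 0" by blast
  have S_bdd: "bdd_below S"
  proof (rule bdd_belowI)
    fix s assume "s \<in> S"
    then show "- real n0 \<le> s" using J_mono[of s "- real n0"] n0 by (force simp: S_def)
  qed
  define s where "s = Inf S"
  have b: "b_star M L T q C f = ereal s"
    unfolding b_star_def S_eq[symmetric] s_def using ereal_Inf'[OF S_bdd S_ne] by simp
  have up: "(\<lambda>n. s + 1 / real (Suc n)) \<longlonglongrightarrow> s"
    using tendsto_add[OF tendsto_const LIMSEQ_inverse_real_of_nat, of s] by (simp add: inverse_eq_divide)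
  \<comment> \<open>Points just to the right of the infimum have a nonnegative integral, and
    right-continuity of the right derivative carries this to s.\<close>
  have Jr: "0 \<le> J s"
  proof -
    have "(\<lambda>n. J (s + 1 / real (Suc n))) \<longlonglongrightarrow> J s"
      unfolding J_def
    proof (rule integral_dominated_convergence[where w = "\<lambda>p. \<bar>?r (s + D p) + C * q\<bar> + \<bar>?r ((s + 1) + D p) + C * q\<bar>"])
      show "integrable N (\<lambda>p. \<bar>?r (s + D p) + C * q\<bar> + \<bar>?r ((s + 1) + D p) + C * q\<bar>)"
        by (intro Bochner_Integration.integrable_add integrable_abs iC)
      show "AE p in N. (\<lambda>n. ?r (s + 1 / real (Suc n) + D p) + C * q) \<longlonglongrightarrow> ?r (s + D p) + C * q"
      proof (rule AE_I2)
        fix p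
        have "filterlim (\<lambda>n. s + 1 / real (Suc n) + D p) (at_right (s + D p)) sequentially"
          unfolding filterlim_at
        proof
          show "\<forall>\<^sub>F n in sequentially. s + 1 / real (Suc n) + D p \<in> {s + D p<..} \<and> s + 1 / real (Suc n) + D p \<noteq> s + D p"
            by (intro always_eventually) simp
          show "(\<lambda>n. s + 1 / real (Suc n) + D p) \<longlonglongrightarrow> s + D p" by (intro tendsto_add up tendsto_const)
        qed
        from filterlim_compose[OF right_deriv_right_continuous[OF f] this]
        show "(\<lambda>n. ?r (s + 1 / real (Suc n) + D p) + C * q) \<longlonglongrightarrow> ?r (s + D p) + C * q"
          by (intro tendsto_add tendsto_const)
      qed
      show "AE p in N. norm (?r (s + 1 / real (Suc n) + D p) + C * q) \<le> \<bar>?r (s + D p) + C * q\<bar> + \<bar>?r ((s + 1) + D p) + C * q\<bar>" for n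
      proof (rule AE_I2)
        fix p
        have "?r (s + D p) \<le> ?r (s + 1 / real (Suc n) + D p)" "?r (s + 1 / real (Suc n) + D p) \<le> ?r ((s + 1) + D p)"
          by (rule monoD[OF mono_r], simp)+
        then show "norm (?r (s + 1 / real (Suc n) + D p) + C * q) \<le> \<bar>?r (s + D p) + C * q\<bar> + \<bar>?r ((s + 1) + D p) + C * q\<bar>"
          unfolding real_norm_def by linarith
      qed
    qed measurable
    moreover have "0 \<le> J (s + 1 / real (Suc n))" for n
    proof -
      have "Inf S < s + 1 / real (Suc n)" by (simp add: s_def)
      then obtain s' where "s' \<in> S" "s' < s + 1 / real (Suc n)" using cInf_lessD[OF S_ne] by blast
      then show ?thesis using J_mono[of s' "s + 1 / real (Suc n)"] by (simp add: S_def)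
    qed
    ultimately show ?thesis by (intro LIMSEQ_le_const) auto
  qed
  define J' where "J' = (LINT p|N. ?l (s + D p) + C * q)"
  \<comment> \<open>Points to the left of s are outside S; in the limit the right derivative turns
    into the left derivative.\<close>
  have Jl: "J' \<le> 0"
  proof -
    have "(\<lambda>n. J (s - 1 / real (Suc n))) \<longlonglongrightarrow> J'"
      unfolding J_def J'_def
    proof (rule integral_dominated_convergence[where w = "\<lambda>p. \<bar>?r (s + D p) + C * q\<bar> + \<bar>?r ((s - 1) + D p) + C * q\<bar>"])
      show "integrable N (\<lambda>p. \<bar>?r (s + D p) + C * q\<bar> + \<bar>?r ((s - 1) + D p) + C * q\<bar>)"
        by (intro Bochner_Integration.integrable_add integrable_abs iC)
      show "AE p in N. (\<lambda>n. ?r (s - 1 / real (Suc n) + D p) + C * q) \<longlonglongrightarrow> ?l (s + D p) + C * q"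
      proof (rule AE_I2)
        fix p
        have "s - 1 / real (Suc n) + D p = s + D p - 1 / real (Suc n)" for n by simp
        then show "(\<lambda>n. ?r (s - 1 / real (Suc n) + D p) + C * q) \<longlonglongrightarrow> ?l (s + D p) + C * q"
          using left_limit_tendsto[OF mono_r, of "s + D p"] by (simp only: tendsto_add tendsto_const)
      qed
      show "AE p in N. norm (?r (s - 1 / real (Suc n) + D p) + C * q) \<le> \<bar>?r (s + D p) + C * q\<bar> + \<bar>?r ((s - 1) + D p) + C * q\<bar>" for n
      proof (rule AE_I2)
        fix p
        have "?r (s - 1 / real (Suc n) + D p) \<le> ?r (s + D p)" "?r ((s - 1) + D p) \<le> ?r (s - 1 / real (Suc n) + D p)"
          by (rule monoD[OF mono_r], simp)+
        then show "norm (?r (s - 1 / real (Suc n) + D p) + C * q) \<le> \<bar>?r (s + D p) + C * q\<bar> + \<bar>?r ((s - 1) + D p) + C * q\<bar>"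
          unfolding real_norm_def by linarith
      qed
    qed measurable
    moreover have "J (s - 1 / real (Suc n)) \<le> 0" for n
    proof -
      have "s - 1 / real (Suc n) \<notin> S"
        using cInf_lower[OF _ S_bdd, of "s - 1 / real (Suc n)"] by (auto simp: s_def)
      then show ?thesis by (simp add: S_def)
    qed
    ultimately show ?thesis by (intro LIMSEQ_le_const2) auto
  qed
  \<comment> \<open>A convex weight balancing a nonnegative against a nonpositive number. If
    \<open>J s\<close> is 0 the right derivative alone does; otherwise the linear equation has a
    positive denominator.\<close>
  obtain w where w: "0 \<le> w" "w \<le> 1" "w * J s + (1 - w) * J' = 0"
  proof (cases "J s = 0")
    case True
    then show ?thesis using that[of 1] by simp
  next
    case False
    then have d: "0 < J s - J'" using Jr Jl by simp
    show ?thesis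
    proof (rule that[of "- J' / (J s - J')"])
      show "0 \<le> - J' / (J s - J')" using d Jl by (intro divide_nonneg_pos) auto
      show "- J' / (J s - J') \<le> 1" unfolding pos_divide_le_eq[OF d] using Jr by simp
      have "1 - - J' / (J s - J') = J s / (J s - J')" using d by (simp add: field_simps)
      then show "- J' / (J s - J') * J s + (1 - - J' / (J s - J')) * J' = 0" by simp
    qed
  qed
  \<comment> \<open>Without the constant C q this is a convex combination of subgradients, hence
    itself a subgradient; the constant makes its integral vanish at s by the choice of w.\<close>
  define g where "g u = w * ?r u + (1 - w) * ?l u + C * q" for u
  have g_eq: "g u = w * (?r u + C * q) + (1 - w) * (?l u + C * q)" for u
    by (simp add: g_def algebra_simps)
  have "mono g"
    unfolding g_def using w(1,2)
    by (intro monoI add_right_mono add_mono mult_left_mono monoD[OF mono_r] monoD[OF mono_l]) auto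
  moreover have "f v \<ge> f u + (g u - C * q) * (v - u)" for u v
  proof -
    have "w * (f u + ?r u * (v - u)) + (1 - w) * (f u + ?l u * (v - u)) \<le> w * f v + (1 - w) * f v"
      using w(1,2) sub_r[of u v] sub_l[of u v] by (intro add_mono mult_left_mono) auto
    moreover have "w * (f u + ?r u * (v - u)) + (1 - w) * (f u + ?l u * (v - u)) = f u + (g u - C * q) * (v - u)"
      by (simp add: g_def algebra_simps)
    moreover have "w * f v + (1 - w) * f v = f v" by (simp add: algebra_simps)
    ultimately show ?thesis by simp
  qed
  moreover have iCl: "integrable N (\<lambda>p. ?l (s + D p) + C * q)"
    by (intro Bochner_Integration.integrable_add il const_N(1))
  have "integrable N (\<lambda>p. g (s + D p))"
    unfolding g_eq by (intro Bochner_Integration.integrable_add integrable_mult_right iC iCl)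
  moreover have "(LINT p|N. g (s + D p)) = 0"
    unfolding g_eq
    by (subst Bochner_Integration.integral_add[OF integrable_mult_right[OF iC] integrable_mult_right[OF iCl]])
       (use w(3) in \<open>simp add: J_def J'_def\<close>)
  ultimately show ?thesis by (intro that[OF b])
qed

end

text \<open>Turns a vanishing real integral into the balance of extended integrals that the
  comparison of costs asks for.\<close>

lemma nn_integral_pos_neg_parts_eq:
  fixes f :: "'a \<Rightarrow> real"
  assumes f: "integrable M f" and 0: "integral\<^sup>L M f = 0"
  shows "(\<integral>\<^sup>+x. ennreal (max 0 (f x)) \<partial>M) = (\<integral>\<^sup>+x. ennreal (max 0 (- f x)) \<partial>M)"
    and "(\<integral>\<^sup>+x. ennreal (max 0 (- f x)) \<partial>M) < \<top>"
proof -
  have i: "integrable M (\<lambda>x. max 0 (f x))" "integrable M (\<lambda>x. max 0 (- f x))"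
    using f by (auto intro!: integrable_max)
  have "f x = max 0 (f x) - max 0 (- f x)" for x by simp
  then have "integral\<^sup>L M f = (LINT x|M. max 0 (f x)) - (LINT x|M. max 0 (- f x))"
    using Bochner_Integration.integral_diff[OF i] by simp
  with 0 show "(\<integral>\<^sup>+x. ennreal (max 0 (f x)) \<partial>M) = (\<integral>\<^sup>+x. ennreal (max 0 (- f x)) \<partial>M)"
    using nn_integral_eq_integral[OF i(1)] nn_integral_eq_integral[OF i(2)] by simp
  show "(\<integral>\<^sup>+x. ennreal (max 0 (- f x)) \<partial>M) < \<top>"
    using nn_integral_eq_integral[OF i(2)] by simp
qed

theorem theorem4p1:
  fixes M :: "'a measure"
    and L :: "real \<Rightarrow> 'a \<Rightarrow> real"
    and T :: "nat \<Rightarrow> 'a \<Rightarrow> real"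
    and \<Lambda> :: "real measure"
    and f :: "real \<Rightarrow> real"
    and q \<eta> C k1 k2 \<theta> :: real
    and p :: nat
  assumes "q > 0" and "\<eta> > 0"
    and "convex_on UNIV f"
    and "k1 > 0" and "k2 > 0" and "p \<ge> 1"
    and "\<And>x. \<bar>f x\<bar> \<le> k1 + k2 * \<bar>x\<bar> ^ p"
    and "right_deriv_neg_inf f < ereal (- C * q)"
    and "ereal (- C * q) < right_deriv_pos_inf f"
    and "levy_process M L"
    and "levy_measure_of M L \<Lambda>"
    and "\<not> driftless_compound_poisson M L"
    and "\<theta> > 0"
    and "(\<integral>\<^sup>+z\<in>- {-1<..<1}. ennreal (exp (\<theta> * \<bar>z\<bar>)) \<partial>\<Lambda>) < \<infinity>"
    and "poisson_process M \<eta> T"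
    and "independent_processes M L T"
  shows "\<exists>b. b_star M L T q C f = ereal b \<and>
    (\<forall>x. optimal_strategy M L T q C f x (barrier_strategy L T b x) \<and>
         value_function M L T q C f x = ereal (cost M L q C f (barrier_strategy L T b x) x))"
proof -
  have "0 < q / 2" using \<open>q > 0\<close> by simp
  obtain K where K: "0 \<le> K" "\<And>t. 0 \<le> t \<Longrightarrow> (\<integral>\<^sup>+\<omega>. ennreal (L t \<omega> ^ (2 * p)) \<partial>M) \<le> ennreal (K * exp (q / 2 * t))"
    by (rule levy_even_moment[OF \<open>levy_process M L\<close> \<open>levy_measure_of M L \<Lambda>\<close> \<open>\<theta> > 0\<close> assms(14) \<open>0 < q / 2\<close>, of p], rule that)
  have "prob_space M" using \<open>levy_process M L\<close> by (simp add: levy_process_def)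
  \<comment> \<open>This predicate contains no barrier, so one proof of it serves the instance at 0,
    used to find s, and the instance at s.\<close>
  then have axioms: "barrier_moments M L T \<eta> q K p"
    by (intro barrier_moments.intro barrier_problem.intro levy_poisson.intro levy.intro
        levy_axioms.intro levy_poisson_axioms.intro barrier_problem_axioms.intro barrier_moments_axioms.intro K assms)
  interpret B0: barrier_moments M L T \<eta> q 0 K p by (rule axioms)
  \<comment> \<open>The growth bound is rewritten with the even exponent 2p through y \<le> 1 + y^2,
    because the moment bounds are for even powers.\<close>
  have growth: "\<bar>f u\<bar> \<le> (k1 + k2) * (1 + u ^ (2 * p))" for u
  proof -
    have "\<bar>u\<bar> ^ p \<le> 1 + (\<bar>u\<bar> ^ p)\<^sup>2"
    proof (cases "\<bar>u\<bar> ^ p \<le> 1")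
      case True
      then show ?thesis using zero_le_power2[of "\<bar>u\<bar> ^ p"] by linarith
    next
      case False
      then have "\<bar>u\<bar> ^ p * 1 \<le> \<bar>u\<bar> ^ p * \<bar>u\<bar> ^ p" by (intro mult_left_mono) auto
      then show ?thesis by (simp add: power2_eq_square)
    qed
    also have "(\<bar>u\<bar> ^ p)\<^sup>2 = (\<bar>u\<bar>\<^sup>2) ^ p" by (simp only: power_mult[symmetric] mult.commute)
    also have "\<dots> = u ^ (2 * p)" by (simp add: power_mult)
    finally have "k1 + k2 * \<bar>u\<bar> ^ p \<le> k1 + k2 * (1 + u ^ (2 * p))"
      using \<open>k2 > 0\<close> by simp
    also have "\<dots> \<le> (k1 + k2) * (1 + u ^ (2 * p))"
      using \<open>k1 > 0\<close> zero_le_even_power'[of u p] by (simp add: distrib_right)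
    finally show ?thesis using assms(7)[of u] by linarith
  qed
  obtain s g where b: "b_star M L T q C f = ereal s" and mono: "mono g"
    and sub: "\<And>u v. f v \<ge> f u + (g u - C * q) * (v - u)"
    and g: "integrable B0.N (\<lambda>p. g (s + B0.D p))" "(LINT p|B0.N. g (s + B0.D p)) = 0"
    by (rule B0.optimal_barrier_exists[OF \<open>convex_on UNIV f\<close> growth assms(8,9)], rule that)
  interpret B: barrier_moments M L T \<eta> q s K p by (rule axioms)
  have [measurable]: "g \<in> borel_measurable borel" using mono by (rule borel_measurable_mono)
  have fm: "f \<in> borel_measurable borel"
    by (rule borel_measurable_continuous_onI[OF convex_on_continuous[OF open_UNIV \<open>convex_on UNIV f\<close>]])
  have V: "B.V (\<lambda>u. ennreal (max 0 (g u))) s = (\<integral>\<^sup>+p. ennreal (max 0 (g (s + B0.D p))) \<partial>B0.N)"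
    "B.V (\<lambda>u. ennreal (max 0 (- g u))) s = (\<integral>\<^sup>+p. ennreal (max 0 (- g (s + B0.D p))) \<partial>B0.N)"
    by (rule B.V_eq_D, measurable)+
  have Vb: "B.V (\<lambda>u. ennreal (max 0 (g u))) s = B.V (\<lambda>u. ennreal (max 0 (- g u))) s"
    "B.V (\<lambda>u. ennreal (max 0 (- g u))) s < \<top>"
    unfolding V using nn_integral_pos_neg_parts_eq[OF g] by simp_all
  have "optimal_strategy M L T q C f x (barrier_strategy L T s x)"
    "value_function M L T q C f x = ereal (cost M L q C f (barrier_strategy L T s x) x)" for x
    using B.barrier_optimal[OF fm growth mono sub Vb] by simp_all
  with b show ?thesis by blast
qed

end
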